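(* Given PIBQFs $q_1,q_2$, the following recursive procedure terminates and its output is $\mathrm{Int}^{RS}(q_1,q_2)$. (1) Compute the continued fraction expansions of the first roots $q_{1,f}$ and $q_{2,f}$ and translate them (by the rule in the context) into the river sequences $r_1=(x_1,\dots,x_m)$ of $q_1$ and $r_2=(y_1,\dots,y_n)$ of $q_2$, with $L=0$ and $R=1$. Let $i_{1,0},i_{1,1}\subseteq\mathbb Z/m$ be the sets of indices $i$ with $x_i=0$, respectively $x_i=1$, and let $i_{2,0},i_{2,1}\subseteq\mathbb Z/n$ be the sets of indices $j$ with $y_j=0$, respectively $y_j=1$. (2) Initialize $S$ to be the empty word, $T_1=i_{1,0}+1$, $T_2=i_{2,1}+1$, $k=1$, and a global counter $I=0$; call Step 3 with $(S,T_1,T_2,k)$. (3) Given $(S,T_1,T_2,k)$: if $T_1$ or $T_2$ is empty, return to the previous layer $k-1$. (4) Increment $I$ by $|i_{1,1}\cap T_1|\cdot|i_{2,0}\cap T_2|$. (5) Set $S'=S0$, $T_1'=(i_{1,0}\cap T_1)+1$, $T_2'=(i_{2,0}\cap T_2)+1$, and call Step 3 with input $(S',T_1',T_2',k+1)$. (6) Set $S'=S1$, $T_1'=(i_{1,1}\cap T_1)+1$, $T_2'=(i_{2,1}\cap T_2)+1$, and call Step 3 with input $(S',T_1',T_2',k+1)$. (7) If $k=1$, output $I$ and stop; otherwise return to the previous layer $k-1$.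
   Context: Forms. Write $[A,B,C]$ for the integral form $Ax^2+Bxy+Cy^2$, of discriminant $D=B^2-4AC$. A PIBQF is such a form with $\gcd(A,B,C)=1$ and $D>0$ not a perfect square; its first root is $q_f=\frac{-B+\sqrt D}{2A}$. $\mathrm{PSL}(2,\mathbb Z)$ acts on forms by $(\gamma\circ q)(x,y)=q(ax+by,cx+dy)$ for $\gamma=\begin{pmatrix}a&b\\c&d\end{pmatrix}$. Topograph. Let $G$ be the infinite $3$-regular tree drawn in the oriented plane. For an oriented edge $e$ pointing to a vertex $V$, let $\bar e$ be its reversal and let $\mathrm{left}(e)$ be the edge obtained by travelling along $e$ to $V$ and taking the left branch, oriented away from $V$. With $S=\begin{pmatrix}0&1\\-1&0\end{pmatrix}$ and $T=\begin{pmatrix}1&1\\0&1\end{pmatrix}$, the topograph of $q$ is $G$ together with the unique assignment $e\mapsto f(e)$ of forms to oriented edges such that $f(e_0)=q$ for a chosen base oriented edge $e_0$, $f(\bar e)=S\circ f(e)$, $f(\mathrm{left}(e))=T\circ f(e)$. If $f(e)=[A,B,C]$ then $A$ is the number in the region to the left of $e$ and $C$ the number in the region to its right. River. For a PIBQF, the river is the set of edges whose form $[A,B,C]$ satisfies $AC<0$; it is a bi-infinite path separating regions with positive numbers from those with negative numbers, and it flows in the direction which has the positive regions on its left. Following the flow and recording at each vertex whether the river turns left ($L$) or right ($R$) gives a bi-infinite periodic sequence; one least period, up to cyclic shift, is the river sequence. Continued fraction rule. Let $q_f=[a_0,a_1,\dots,a_s,\overline{a_{s+1},\dots,a_{s+p}}]$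 where $s$ is the smallest integer such that the expansion is periodic after index $s$ and $p$ is the smallest even integer that is a period. Then the river sequence of $q$ is the sequence consisting of $s+1 \bmod 2$ repeated $a_{s+1}$ times, then $s+2\bmod 2$ repeated $a_{s+2}$ times, ..., then $s+p \bmod 2$ repeated $a_{s+p}$ times, with $1=R$, $0=L$. $\mathrm{Int}^{RS}$. Let $T_i,R_i$ be the topograph and river of $q_i$ (the topographs $T_1, T_2$ here are not to be confused with the index sets in the algorithm). A superimposition is an isomorphism $\varphi$ from the tree of the second topograph to that of the first preserving the planar cyclic orientation at every vertex. The rivers meet and cross if $R_1$ and $\varphi(R_2)$ share a finite nonempty path and $\varphi(R_2)$ joins this path from one side of $R_1$ and leaves it on the other side. $\mathrm{Int}^{RS}(q_1,q_2)$ is the number of superimpositions, modulo translations of each river by its period (i.e. $\varphi\equiv\tau_1^a\varphi\tau_2^b$ with $\tau_i$ the automorphism of the $i$-th topograph translating its river by one least period), for which the rivers meet and cross, the second river (followed along its flow) joins $R_1$ from the right-hand side of $R_1$ (with respect to the flow of $R_1$), and the two rivers flow in the same direction along their shared path. Notation. For a set $I$ of indices of a cyclic sequence of length $n$, $I+k=\{i+k \bmod n: i\in I\}$. $S0$, $S1$ denote the word $S$ with the letter $0$, respectively $1$, appended. *)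

theory Defs
  imports "HOL-Analysis.Analysis"
begin

section \<open>Integral binary quadratic forms\<close>

text \<open>\<^term>\<open>BQF A B C\<close> is the form \<open>A x\<^sup>2 + B x y + C y\<^sup>2\<close>.\<close>

datatype bqf = BQF (cA: int) (cB: int) (cC: int)

definition bqf_eval :: "bqf \<Rightarrow> int \<Rightarrow> int \<Rightarrow> int" where
  "bqf_eval q x y = cA q * x^2 + cB q * x * y + cC q * y^2"

definition disc :: "bqf \<Rightarrow> int" where
  "disc q = (cB q)^2 - 4 * cA q * cC q"

definition PIBQF :: "bqf \<Rightarrow> bool" where
  "PIBQF q \<longleftrightarrow> gcd (cA q) (gcd (cB q) (cC q)) = 1 \<and> disc q > 0 \<and> \<not> (\<exists>k. disc q = k^2)"

definition first_root :: "bqf \<Rightarrow> real" where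
  "first_root q = (- of_int (cB q) + sqrt (of_int (disc q))) / (2 * of_int (cA q))"

definition act :: "int^2^2 \<Rightarrow> bqf \<Rightarrow> bqf" where
  "act g q = (let a = g$1$1; b = g$1$2; c = g$2$1; d = g$2$2 in
     BQF (cA q * a^2 + cB q * a * c + cC q * c^2)
         (2 * cA q * a * b + cB q * (a * d + b * c) + 2 * cC q * c * d)
         (cA q * b^2 + cB q * b * d + cC q * d^2))"

text \<open>The coefficients above are those of the substituted form:\<close>

lemma bqf_eval_act:
  "bqf_eval (act g q) x y = bqf_eval q (g$1$1 * x + g$1$2 * y) (g$2$1 * x + g$2$2 * y)"
  by (simp add: bqf_eval_def act_def Let_def power2_eq_square algebra_simps)

definition S_mat :: "int^2^2" where
  "S_mat = vector [vector [0, 1], vector [-1, 0]]"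

definition T_mat :: "int^2^2" where
  "T_mat = vector [vector [1, 1], vector [0, 1]]"

section \<open>The infinite 3-regular plane tree\<close>

text \<open>
  The vertices are all elements of the type \<open>'v\<close>; an oriented edge from \<open>u\<close> to \<open>v\<close>
  is the pair \<open>(u, v)\<close>, and every edge occurs with both orientations. A drawing of
  the tree in the oriented plane is recorded by the cyclic order of the neighbours at every
  vertex: \<open>cw G v u\<close> is the neighbour of \<open>v\<close> that comes directly after \<open>u\<close>
  when turning clockwise around \<open>v\<close>.
\<close>

record 'v plane_graph =
  arcs :: "('v \<times> 'v) set"
  cw :: "'v \<Rightarrow> 'v \<Rightarrow> 'v"

definition nbrs :: "('v, 'x) plane_graph_scheme \<Rightarrow> 'v \<Rightarrow> 'v set" where
  "nbrs G v = {u. (v, u) \<in> arcs G}"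

definition simple_path :: "('v, 'x) plane_graph_scheme \<Rightarrow> 'v \<Rightarrow> 'v \<Rightarrow> 'v list \<Rightarrow> bool" where
  "simple_path G u v xs \<longleftrightarrow> xs \<noteq> [] \<and> hd xs = u \<and> last xs = v \<and> distinct xs \<and>
     successively (\<lambda>x y. (x, y) \<in> arcs G) xs"

text \<open>
  A permutation of three neighbours is a cyclic order exactly when it has no fixed point.
\<close>

definition cubic_plane_tree :: "('v, 'x) plane_graph_scheme \<Rightarrow> bool" where
  "cubic_plane_tree G \<longleftrightarrow>
     sym (arcs G) \<and> irrefl (arcs G) \<and>
     (\<forall>u v. \<exists>!xs. simple_path G u v xs) \<and>
     (\<forall>v. card (nbrs G v) = 3) \<and>
     (\<forall>v. bij_betw (cw G v) (nbrs G v) (nbrs G v) \<and> (\<forall>u\<in>nbrs G v. cw G v u \<noteq> u))"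

abbreviation rev_arc :: "'v \<times> 'v \<Rightarrow> 'v \<times> 'v" where
  "rev_arc \<equiv> prod.swap"

text \<open>
  Arriving at \<open>v\<close> from \<open>u\<close>, the branch directly clockwise from the one behind is
  the left one, and the next one the right one.
\<close>

definition left_arc :: "('v, 'x) plane_graph_scheme \<Rightarrow> 'v \<times> 'v \<Rightarrow> 'v \<times> 'v" where
  "left_arc G e = (snd e, cw G (snd e) (fst e))"

definition right_arc :: "('v, 'x) plane_graph_scheme \<Rightarrow> 'v \<times> 'v \<Rightarrow> 'v \<times> 'v" where
  "right_arc G e = (snd e, cw G (snd e) (cw G (snd e) (fst e)))"

definition plane_iso ::
  "('v, 'x) plane_graph_scheme \<Rightarrow> ('w, 'y) plane_graph_scheme \<Rightarrow> ('v \<Rightarrow> 'w) \<Rightarrow> bool" where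
  "plane_iso G H \<phi> \<longleftrightarrow> bij \<phi> \<and>
     (\<forall>u v. (u, v) \<in> arcs G \<longleftrightarrow> (\<phi> u, \<phi> v) \<in> arcs H) \<and>
     (\<forall>v. \<forall>u\<in>nbrs G v. \<phi> (cw G v u) = cw H (\<phi> v) (\<phi> u))"

section \<open>Topographs and rivers\<close>

record 'v topograph = "'v plane_graph" +
  form :: "'v \<times> 'v \<Rightarrow> bqf"

text \<open>The values of \<^const>\<open>form\<close> outside the oriented edges are irrelevant.\<close>

definition topograph_of :: "'v topograph \<Rightarrow> bqf \<Rightarrow> bool" where
  "topograph_of T q \<longleftrightarrow> cubic_plane_tree T \<and>
     (\<exists>e\<^sub>0\<in>arcs T. form T e\<^sub>0 = q) \<and>
     (\<forall>e\<in>arcs T. form T (rev_arc e) = act S_mat (form T e) \<and>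
                 form T (left_arc T e) = act T_mat (form T e))"

text \<open>The river, as a set of oriented edges with both orientations of each of its edges.\<close>

definition river :: "'v topograph \<Rightarrow> ('v \<times> 'v) set" where
  "river T = {e \<in> arcs T. cA (form T e) * cC (form T e) < 0}"

text \<open>
  The river edges oriented along the flow: the coefficient \<open>A\<close> belongs to the region on
  the left, which has to be the positive one.
\<close>

definition flow :: "'v topograph \<Rightarrow> ('v \<times> 'v) set" where
  "flow T = {e \<in> river T. cA (form T e) > 0}"

definition downstream :: "'v topograph \<Rightarrow> 'v \<times> 'v \<Rightarrow> 'v \<times> 'v" where
  "downstream T e = (if left_arc T e \<in> flow T then left_arc T e else right_arc T e)"

text \<open>The turn of the river at the end point of a flow edge, with \<open>0\<close> for left and
  \<open>1\<close> for right.\<close>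

definition river_turn :: "'v topograph \<Rightarrow> 'v \<times> 'v \<Rightarrow> nat" where
  "river_turn T e = (if left_arc T e \<in> flow T then 0 else 1)"

definition river_period :: "'v topograph \<Rightarrow> nat" where
  "river_period T = (LEAST m. m > 0 \<and>
     (\<forall>e\<in>flow T. river_turn T ((downstream T ^^ m) e) = river_turn T e))"

definition river_translation :: "'v topograph \<Rightarrow> ('v \<Rightarrow> 'v) \<Rightarrow> bool" where
  "river_translation T \<tau> \<longleftrightarrow> plane_iso T T \<tau> \<and>
     (\<forall>e\<in>arcs T. form T (map_prod \<tau> \<tau> e) = form T e) \<and>
     (\<forall>e\<in>flow T. map_prod \<tau> \<tau> e = (downstream T ^^ river_period T) e)"

text \<open>Oriented edges that leave the river of \<open>T\<close> on its left-hand, respectively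
  right-hand side (with respect to its flow).\<close>

definition on_left_bank :: "'v topograph \<Rightarrow> 'v \<times> 'v \<Rightarrow> bool" where
  "on_left_bank T x \<longleftrightarrow> x \<notin> river T \<and> (\<exists>a\<in>flow T. x = left_arc T a)"

definition on_right_bank :: "'v topograph \<Rightarrow> 'v \<times> 'v \<Rightarrow> bool" where
  "on_right_bank T x \<longleftrightarrow> x \<notin> river T \<and> (\<exists>a\<in>flow T. x = right_arc T a)"

section \<open>Superimpositions and the intersection number\<close>

definition superimposition :: "'v topograph \<Rightarrow> 'w topograph \<Rightarrow> ('w \<Rightarrow> 'v) \<Rightarrow> bool" where
  "superimposition T\<^sub>1 T\<^sub>2 \<phi> \<longleftrightarrow> plane_iso T\<^sub>2 T\<^sub>1 \<phi>"

text \<open>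
  The rivers meet and cross: the list \<open>p\<close> is the finite nonempty shared path, traversed
  along the flow of the second river, and \<open>d\<close> and \<open>x\<close> are the edges through which
  the second river joins and leaves this path; they lie on different sides of the first river.
\<close>

definition cross_along ::
  "'v topograph \<Rightarrow> 'w topograph \<Rightarrow> ('w \<Rightarrow> 'v) \<Rightarrow>
     ('v \<times> 'v) list \<Rightarrow> 'v \<times> 'v \<Rightarrow> 'v \<times> 'v \<Rightarrow> bool" where
  "cross_along T\<^sub>1 T\<^sub>2 \<phi> p d x \<longleftrightarrow>
     p \<noteq> [] \<and>
     set (d # p @ [x]) \<subseteq> map_prod \<phi> \<phi> ` flow T\<^sub>2 \<and>
     successively (\<lambda>a b. snd a = fst b) (d # p @ [x]) \<and>
     river T\<^sub>1 \<inter> map_prod \<phi> \<phi> ` river T\<^sub>2 = set p \<union> rev_arc ` set p \<and>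
     (on_right_bank T\<^sub>1 (rev_arc d) \<and> on_left_bank T\<^sub>1 x \<or>
      on_left_bank T\<^sub>1 (rev_arc d) \<and> on_right_bank T\<^sub>1 x)"

text \<open>Superimpositions for which, in addition, the second river joins from the right, and
  the rivers flow in the same direction along the shared path.\<close>

definition RS_superimpositions :: "'v topograph \<Rightarrow> 'w topograph \<Rightarrow> ('w \<Rightarrow> 'v) set" where
  "RS_superimpositions T\<^sub>1 T\<^sub>2 = {\<phi>. superimposition T\<^sub>1 T\<^sub>2 \<phi> \<and>
     (\<exists>p d x. cross_along T\<^sub>1 T\<^sub>2 \<phi> p d x \<and>
        on_right_bank T\<^sub>1 (rev_arc d) \<and> set p \<subseteq> flow T\<^sub>1)}"

definition int_iterate :: "('a \<Rightarrow> 'a) \<Rightarrow> int \<Rightarrow> 'a \<Rightarrow> 'a" where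
  "int_iterate f a = (if a \<ge> 0 then f ^^ nat a else inv f ^^ nat (- a))"

definition RS_equiv ::
  "'v topograph \<Rightarrow> 'w topograph \<Rightarrow> (('w \<Rightarrow> 'v) \<times> ('w \<Rightarrow> 'v)) set" where
  "RS_equiv T\<^sub>1 T\<^sub>2 = {(\<phi>, \<psi>).
     \<phi> \<in> RS_superimpositions T\<^sub>1 T\<^sub>2 \<and> \<psi> \<in> RS_superimpositions T\<^sub>1 T\<^sub>2 \<and>
     (\<exists>\<tau>\<^sub>1 \<tau>\<^sub>2 a b. river_translation T\<^sub>1 \<tau>\<^sub>1 \<and> river_translation T\<^sub>2 \<tau>\<^sub>2 \<and>
        \<psi> = int_iterate \<tau>\<^sub>1 a \<circ> \<phi> \<circ> int_iterate \<tau>\<^sub>2 b)}"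

definition RS_classes :: "'v topograph \<Rightarrow> 'w topograph \<Rightarrow> ('w \<Rightarrow> 'v) set set" where
  "RS_classes T\<^sub>1 T\<^sub>2 = RS_superimpositions T\<^sub>1 T\<^sub>2 // RS_equiv T\<^sub>1 T\<^sub>2"

definition Int_RS :: "'v topograph \<Rightarrow> 'w topograph \<Rightarrow> nat" where
  "Int_RS T\<^sub>1 T\<^sub>2 = card (RS_classes T\<^sub>1 T\<^sub>2)"

section \<open>Continued fractions and river sequences\<close>

primrec cf_rem :: "real \<Rightarrow> nat \<Rightarrow> real" where
  "cf_rem x 0 = x"
| "cf_rem x (Suc n) = 1 / frac (cf_rem x n)"

definition cf_coeff :: "real \<Rightarrow> nat \<Rightarrow> int" where
  "cf_coeff x n = \<lfloor>cf_rem x n\<rfloor>"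

definition cf_period_from :: "real \<Rightarrow> nat \<Rightarrow> nat \<Rightarrow> bool" where
  "cf_period_from x t p \<longleftrightarrow> p > 0 \<and> (\<forall>n\<ge>t. cf_coeff x (n + p) = cf_coeff x n)"

text \<open>
  Here \<open>t = s + 1\<close> is the length of the preperiod \<open>a\<^sub>0, \<dots>, a\<^sub>s\<close>, so a purely
  periodic expansion has \<open>s = -1\<close>. Letters: \<open>0\<close> is left, \<open>1\<close> is right.
\<close>

definition cf_river_sequence :: "bqf \<Rightarrow> nat list \<Rightarrow> bool" where
  "cf_river_sequence q r \<longleftrightarrow> (\<exists>t p.
     is_arg_min id (\<lambda>t. \<exists>p. cf_period_from (first_root q) t p) t \<and>
     is_arg_min id (\<lambda>p. even p \<and> cf_period_from (first_root q) t p) p \<and>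
     r = concat (map (\<lambda>j. replicate (nat (cf_coeff (first_root q) j)) (j mod 2)) [t..<t + p]))"

section \<open>The procedure\<close>

text \<open>A cyclic sequence of length \<open>n\<close> is a list, with \<open>{0..<n}\<close> as its set of
  indices modulo \<open>n\<close>.\<close>

definition letter_indices :: "nat list \<Rightarrow> nat \<Rightarrow> nat set" where
  "letter_indices r c = {i. i < length r \<and> r ! i = c}"

definition shift :: "nat \<Rightarrow> nat set \<Rightarrow> nat \<Rightarrow> nat set" where
  "shift n I k = (\<lambda>i. (i + k) mod n) ` I"

text \<open>
  Evaluation semantics of the recursive Step 3: \<open>step3 r\<^sub>1 r\<^sub>2 S T\<^sub>1 T\<^sub>2 k I I'\<close> holds
  if the call with arguments \<open>(S, T\<^sub>1, T\<^sub>2, k)\<close>, made when the global counter is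
  \<open>I\<close>, returns, and the global counter is \<open>I'\<close> when it does. The rules are
  deterministic and derivations are finite, so a call that does not terminate is related to
  no \<open>I'\<close>.
\<close>

inductive step3 ::
  "nat list \<Rightarrow> nat list \<Rightarrow> nat list \<Rightarrow> nat set \<Rightarrow> nat set \<Rightarrow> nat \<Rightarrow> nat \<Rightarrow> nat \<Rightarrow> bool"
  for r\<^sub>1 r\<^sub>2 :: "nat list"
where
  return: "T\<^sub>1 = {} \<or> T\<^sub>2 = {} \<Longrightarrow> step3 r\<^sub>1 r\<^sub>2 S T\<^sub>1 T\<^sub>2 k I I"
| recurse:
  "\<lbrakk> T\<^sub>1 \<noteq> {}; T\<^sub>2 \<noteq> {};
     step3 r\<^sub>1 r\<^sub>2 (S @ [0])
       (shift (length r\<^sub>1) (letter_indices r\<^sub>1 0 \<inter> T\<^sub>1) 1)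
       (shift (length r\<^sub>2) (letter_indices r\<^sub>2 0 \<inter> T\<^sub>2) 1)
       (k + 1)
       (I + card (letter_indices r\<^sub>1 1 \<inter> T\<^sub>1) * card (letter_indices r\<^sub>2 0 \<inter> T\<^sub>2))
       I';
     step3 r\<^sub>1 r\<^sub>2 (S @ [1])
       (shift (length r\<^sub>1) (letter_indices r\<^sub>1 1 \<inter> T\<^sub>1) 1)
       (shift (length r\<^sub>2) (letter_indices r\<^sub>2 1 \<inter> T\<^sub>2) 1)
       (k + 1) I' I'' \<rbrakk>
   \<Longrightarrow> step3 r\<^sub>1 r\<^sub>2 S T\<^sub>1 T\<^sub>2 k I I''"

definition procedure_outputs :: "bqf \<Rightarrow> bqf \<Rightarrow> nat \<Rightarrow> bool" where
  "procedure_outputs q\<^sub>1 q\<^sub>2 N \<longleftrightarrow> (\<exists>r\<^sub>1 r\<^sub>2.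
     cf_river_sequence q\<^sub>1 r\<^sub>1 \<and> cf_river_sequence q\<^sub>2 r\<^sub>2 \<and>
     step3 r\<^sub>1 r\<^sub>2 []
       (shift (length r\<^sub>1) (letter_indices r\<^sub>1 0) 1)
       (shift (length r\<^sub>2) (letter_indices r\<^sub>2 1) 1)
       1 0 N)"

end

(*
  A flow edge carries a form whose first root x is positive and whose second root is negative, and
  the river turns left exactly if x > 1; turning left replaces x by x - 1 and turning right replaces
  1/x by 1/x - 1.  So the turns are the partial quotients of x in unary, and since every form of the
  topograph has the same first root up to the action of PSL(2,Z), the river reads off the tail of the
  continued fraction of the first root of q.  There are finitely many forms of given discriminant with
  A > 0 > C, which makes the river periodic.

  Superimpositions correspond to pairs of edges that they identify.  One that crosses from the right in
  the same direction is determined by the pair (e1, e2) of flow edges at which the shared path starts,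
  and up to translations only the positions i, j of e1, e2 in the two cyclic sequences matter.  The
  conditions on (i, j) are that the first river turned left and the second one right just before, and
  that at the first later disagreement the first river turns right and the second one left.  The
  recursion sorts the pairs (i, j) by the common word S of turns along the shared path; it terminates
  because two periodic sequences that agree for long enough agree everywhere.
*)
theory Submission
  imports Defs
begin

section \<open>The moves of the topograph on forms\<close>

text \<open>Two periods of different origin have to coincide. The list \<open>r\<close> is cut out
  of the continued fraction by a least even period, whereas translations are measured by the least
  period of the turns and must preserve forms. The bridge is an expansion argument: the steps x -> x
  - 1 and 1/x -> 1/x - 1 never bring two roots with the same turns closer together, so equal
  periodic turns force equal roots, hence equal forms and equal complete quotients. Evenness enters
  because left and right runs alternate. Periodicity also bounds the recursion: a starting pair is
  preceded by the unequal letters 0 and 1, and these come back mn - 1 letters later, so S stays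
  shorter than mn. The geometry is reduced to words. In a tree a walk without backtracking is
  determined by its end, so once an oriented edge is fixed, every vertex has as coordinates a side
  of that edge and a word of turns. This yields an isomorphism for any prescribed image of one edge,
  and it shows that two rivers share exactly the edges up to which their words agree.\<close>

definition left_form :: "bqf \<Rightarrow> bqf" where
  "left_form f = BQF (cA f) (2 * cA f + cB f) (cA f + cB f + cC f)"

definition right_form :: "bqf \<Rightarrow> bqf" where
  "right_form f = BQF (cA f + cB f + cC f) (cB f + 2 * cC f) (cC f)"

definition rev_form :: "bqf \<Rightarrow> bqf" where
  "rev_form f = BQF (cC f) (- cB f) (cA f)"

lemma act_T_mat: "act T_mat f = left_form f"
  by (simp add: act_def T_mat_def left_form_def algebra_simps)

lemma act_S_mat: "act S_mat f = rev_form f"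
  by (simp add: act_def S_mat_def rev_form_def algebra_simps)

lemma left_form_sel [simp]:
  "cA (left_form f) = cA f" "cB (left_form f) = 2 * cA f + cB f"
  "cC (left_form f) = cA f + cB f + cC f"
  by (simp_all add: left_form_def)

lemma right_form_sel [simp]:
  "cA (right_form f) = cA f + cB f + cC f" "cB (right_form f) = cB f + 2 * cC f"
  "cC (right_form f) = cC f"
  by (simp_all add: right_form_def)

lemma rev_form_sel [simp]:
  "cA (rev_form f) = cC f" "cB (rev_form f) = - cB f" "cC (rev_form f) = cA f"
  by (simp_all add: rev_form_def)

text \<open>A topograph prescribes forms only for reversals and left turns. Going left, turning
  round and going left again ends on the right branch, so the right turn gets its form from this
  identity.\<close>

lemma left_rev_left_form: "left_form (rev_form (left_form f)) = right_form f"
  by (auto intro!: bqf.expand)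

lemma disc_left_form [simp]: "disc (left_form f) = disc f"
  by (simp add: disc_def power2_eq_square algebra_simps)

lemma disc_right_form [simp]: "disc (right_form f) = disc f"
  by (simp add: disc_def power2_eq_square algebra_simps)

lemma disc_rev_form [simp]: "disc (rev_form f) = disc f"
  by (simp add: disc_def)

section \<open>Indefinite forms and their irrational first roots\<close>

definition indef :: "bqf \<Rightarrow> bool" where
  "indef f \<longleftrightarrow> disc f > 0 \<and> \<not> (\<exists>k. disc f = k\<^sup>2)"

lemma PIBQF_indef: "PIBQF q \<Longrightarrow> indef q"
  by (simp add: PIBQF_def indef_def)

lemma indef_moves [simp]:
  "indef (left_form f) \<longleftrightarrow> indef f" "indef (right_form f) \<longleftrightarrow> indef f"
  "indef (rev_form f) \<longleftrightarrow> indef f"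
  by (simp_all add: indef_def)

text \<open>If an outer coefficient vanished, the discriminant would be the square of the middle
  one.\<close>

lemma indef_nonzero:
  assumes "indef f" shows "cA f \<noteq> 0" "cC f \<noteq> 0"
  using assms unfolding indef_def disc_def by auto

lemma sqrt_nonsquare_irrational:
  fixes D :: int
  assumes "D > 0" "\<not> (\<exists>k. D = k\<^sup>2)"
  shows "sqrt (of_int D) \<notin> \<rat>"
proof
  assume "sqrt (of_int D) \<in> \<rat>"
  then obtain a b :: int where ab: "sqrt (of_int D) = of_int a / of_int b" "b > 0" "coprime a b"
    by (metis Rats_cases')
  have "real_of_int D = (of_int a / of_int b)\<^sup>2"
    using ab(1) assms(1) by (metis less_eq_real_def of_int_0_less_iff real_sqrt_pow2)
  then have "real_of_int (D * b\<^sup>2) = real_of_int (a\<^sup>2)"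
    using ab(2) by (simp add: field_simps)
  then have eq: "D * b\<^sup>2 = a\<^sup>2" by (simp only: of_int_eq_iff)
  then have "b dvd a\<^sup>2" by (metis dvd_mult dvd_triv_left power2_eq_square)
  moreover have "coprime b (a\<^sup>2)" using ab(3) by (simp add: coprime_commute)
  ultimately have "is_unit b" using coprime_absorb_left by blast
  then have "b = 1" using ab(2) by simp
  then show False using eq assms(2) by auto
qed

lemma sqrt_disc_irrational: "indef f \<Longrightarrow> sqrt (of_int (disc f)) \<notin> \<rat>"
  by (simp add: indef_def sqrt_nonsquare_irrational)

lemma sqrt_disc_conv:
  "indef f \<Longrightarrow> sqrt (of_int (disc f)) = 2 * of_int (cA f) * first_root f + of_int (cB f)"
  using indef_nonzero[of f] by (simp add: first_root_def)

lemma first_root_irrational: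
  assumes "indef f" shows "first_root f \<notin> \<rat>"
  using sqrt_disc_irrational[OF assms] sqrt_disc_conv[OF assms] by auto

text \<open>Write r for the common root. Since r is irrational, 1 and r are linearly independent
  over the rationals, so the expression 2Ar + B for the root of the discriminant determines A and B;
  the discriminant then gives C.\<close>

lemma first_root_inject:
  assumes "indef f" "indef g" "disc f = disc g" "first_root f = first_root g"
  shows "f = g"
proof -
  let ?r = "first_root f"
  have eq: "2 * of_int (cA f) * ?r + of_int (cB f) = 2 * of_int (cA g) * ?r + of_int (cB g)"
    using sqrt_disc_conv[OF assms(1)] sqrt_disc_conv[OF assms(2)] assms(3,4) by simp
  have A: "cA f = cA g"
  proof (rule ccontr)
    assume "cA f \<noteq> cA g"
    then have ne: "real_of_int (2 * (cA f - cA g)) \<noteq> 0" by simp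
    have "?r * of_int (2 * (cA f - cA g)) = of_int (cB g - cB f)"
      using eq by (simp add: algebra_simps)
    then have "?r = of_int (cB g - cB f) / of_int (2 * (cA f - cA g))"
      using ne by (metis nonzero_eq_divide_eq)
    then have "?r \<in> \<rat>" by simp
    then show False using first_root_irrational[OF assms(1)] by simp
  qed
  have B: "cB f = cB g" using eq A by simp
  have "cC f = cC g"
    using assms(3) A B indef_nonzero(1)[OF assms(1)] by (simp add: disc_def)
  then show ?thesis using A B by (simp add: bqf.expand)
qed

lemma first_root_left_form:
  assumes "indef f" shows "first_root (left_form f) = first_root f - 1"
  using indef_nonzero[OF assms] by (simp add: first_root_def field_simps)

text \<open>With s the square root of the discriminant, (s + B)(s - B) = -4AC. The factor s - B does
  not vanish because s is irrational.\<close>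

lemma first_root_rev_form:
  assumes "indef f" shows "first_root (rev_form f) = - 1 / first_root f"
proof -
  let ?s = "sqrt (of_int (disc f))"
  have s: "?s * ?s = of_int (disc f)" using assms by (simp add: indef_def)
  have nz: "real_of_int (cA f) \<noteq> 0" "real_of_int (cC f) \<noteq> 0" using indef_nonzero[OF assms] by auto
  have "?s \<noteq> of_int (cB f)" using sqrt_disc_irrational[OF assms] by (metis Rats_of_int)
  then have "- of_int (cB f) + ?s \<noteq> 0" by simp
  moreover have "(of_int (cB f) + ?s) * (- of_int (cB f) + ?s) = - (2 * of_int (cC f)) * (2 * of_int (cA f))"
    using s by (simp add: algebra_simps disc_def power2_eq_square)
  ultimately show ?thesis using nz
    by (simp add: first_root_def divide_simps)
qed

lemma first_root_right_form:
  assumes "indef f"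
  shows "1 / first_root (right_form f) = 1 / first_root f - 1"
    and "first_root (right_form f) = first_root f / (1 - first_root f)"
proof -
  let ?r = "first_root f"
  have irr: "?r \<notin> \<rat>" using first_root_irrational[OF assms] .
  have nz: "?r \<noteq> 0" "?r \<noteq> 1" "1 - ?r \<noteq> 0" "?r - 1 \<noteq> 0" using irr by auto
  have "first_root (right_form f) = - 1 / (?r - 1) - 1"
    unfolding left_rev_left_form[symmetric]
    by (simp add: first_root_left_form first_root_rev_form assms)
  then show 2: "first_root (right_form f) = ?r / (1 - ?r)"
    using nz by (simp add: divide_simps) (simp add: algebra_simps)
  show "1 / first_root (right_form f) = 1 / ?r - 1"
    unfolding 2 using nz by (simp add: divide_simps)
qed

text \<open>S and T generate the modular group. No rule for the inverse of T is included, since it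
  arises from S and the right turn, as used in \<open>orbit_translate\<close>.\<close>

inductive_set orbit :: "bqf \<Rightarrow> bqf set" for q where
  base: "q \<in> orbit q"
| left: "f \<in> orbit q \<Longrightarrow> left_form f \<in> orbit q"
| rev: "f \<in> orbit q \<Longrightarrow> rev_form f \<in> orbit q"

lemma orbit_right: "f \<in> orbit q \<Longrightarrow> right_form f \<in> orbit q"
  by (metis left_rev_left_form orbit.left orbit.rev)

lemma orbit_indef: "f \<in> orbit q \<Longrightarrow> indef q \<Longrightarrow> indef f"
  by (induction rule: orbit.induct) auto

lemma orbit_translate:
  assumes "indef q" "f \<in> orbit q"
  shows "\<exists>g\<in>orbit q. first_root g = first_root f - of_int a"
proof -
  have up: "\<exists>g\<in>orbit q. first_root g = first_root f + of_nat n" for n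
  proof (induction n)
    case (Suc n)
    then obtain g where g: "g \<in> orbit q" "first_root g = first_root f + of_nat n" by blast
    \<comment> \<open>This undoes a left turn: conjugating 1/x -> 1/x - 1 by x -> -1/x gives x -> x
      + 1.\<close>
    let ?h = "rev_form (right_form (rev_form g))"
    have i: "indef g" using orbit_indef g assms by blast
    have nz: "first_root g \<noteq> 0" using first_root_irrational[OF i] by auto
    have "1 / first_root (right_form (rev_form g)) = - first_root g - 1"
      using i nz by (simp add: first_root_right_form(1) first_root_rev_form)
    moreover have "first_root ?h = - (1 / first_root (right_form (rev_form g)))"
      using i by (simp add: first_root_rev_form)
    ultimately have "first_root ?h = first_root f + of_nat (Suc n)" using g by simp
    moreover have "?h \<in> orbit q" using g by (intro orbit.rev orbit_right)
    ultimately show ?case by blast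
  qed (use assms in auto)
  have down: "\<exists>g\<in>orbit q. first_root g = first_root f - of_nat n" for n
  proof (induction n)
    case (Suc n)
    then obtain g where g: "g \<in> orbit q" "first_root g = first_root f - of_nat n" by blast
    have "first_root (left_form g) = first_root f - of_nat (Suc n)"
      using g first_root_left_form orbit_indef assms by simp
    then show ?case using orbit.left g by blast
  qed (use assms in auto)
  show ?thesis
  proof (cases "a \<ge> 0")
    case True then show ?thesis using down[of "nat a"] by simp
  next
    case False then show ?thesis using up[of "nat (- a)"] by simp
  qed
qed

section \<open>The slow continued fraction algorithm\<close>

text \<open>The branch is chosen by the root and not by the river, so that the same map also
  describes the way from a form off the river down to it.\<close>

definition next_form :: "bqf \<Rightarrow> bqf" where
  "next_form f = (if first_root f > 1 then left_form f else right_form f)"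

definition form_turn :: "bqf \<Rightarrow> nat" where
  "form_turn f = (if first_root f > 1 then 0 else 1)"

definition pos_root :: "bqf \<Rightarrow> bool" where
  "pos_root f \<longleftrightarrow> indef f \<and> first_root f > 0"

text \<open>Equivalently the first root is positive and the second negative: the product C/A of the
  roots is negative, and for A > 0 the first root is the larger one.\<close>

definition flow_form :: "bqf \<Rightarrow> bool" where
  "flow_form f \<longleftrightarrow> indef f \<and> cA f > 0 \<and> cC f < 0"

lemma disc_next_form [simp]: "disc (next_form f) = disc f"
  by (simp add: next_form_def)

lemma disc_next_iter [simp]: "disc ((next_form ^^ n) f) = disc f"
  by (induction n) auto

lemma indef_next_form [simp]: "indef (next_form f) = indef f"
  by (simp add: next_form_def)

lemma pos_root_next:
  assumes "pos_root f" shows "pos_root (next_form f)"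
proof -
  have i: "indef f" and p: "first_root f > 0" using assms by (auto simp: pos_root_def)
  have "first_root f \<noteq> 1" using first_root_irrational[OF i] by auto
  then show ?thesis using i p
    by (auto simp: pos_root_def next_form_def first_root_left_form first_root_right_form(2))
qed

lemma pos_root_next_iter: "pos_root f \<Longrightarrow> pos_root ((next_form ^^ n) f)"
  by (induction n) (auto intro: pos_root_next)

lemma orbit_next: "f \<in> orbit q \<Longrightarrow> next_form f \<in> orbit q"
  by (simp add: next_form_def orbit.left orbit_right)

lemma orbit_next_iter: "f \<in> orbit q \<Longrightarrow> (next_form ^^ n) f \<in> orbit q"
  by (induction n) (auto intro: orbit_next)

section \<open>Reaching the river, and following it in both directions\<close>

lemma sqrt_disc_bounds:
  assumes "indef f"
  shows "cA f * cC f < 0 \<Longrightarrow> sqrt (of_int (disc f)) > \<bar>of_int (cB f)\<bar>"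
    and "cA f * cC f > 0 \<Longrightarrow> sqrt (of_int (disc f)) < \<bar>of_int (cB f)\<bar>"
proof -
  assume "cA f * cC f < 0"
  then have "(cB f)\<^sup>2 < disc f" by (simp add: disc_def)
  then have "(of_int (cB f))\<^sup>2 < real_of_int (disc f)" by (metis of_int_less_iff of_int_power)
  then show "sqrt (of_int (disc f)) > \<bar>of_int (cB f)\<bar>"
    using real_less_rsqrt by (metis power2_abs)
next
  assume "cA f * cC f > 0"
  then have "(cB f)\<^sup>2 > disc f" by (simp add: disc_def)
  then have "(of_int (cB f))\<^sup>2 > real_of_int (disc f)" by (metis of_int_less_iff of_int_power)
  then show "sqrt (of_int (disc f)) < \<bar>of_int (cB f)\<bar>"
    by (metis real_sqrt_abs real_sqrt_less_iff)
qed

lemma flow_form_pos_root: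
  assumes "flow_form f" shows "pos_root f"
proof -
  have "sqrt (of_int (disc f)) > \<bar>of_int (cB f)\<bar>"
    using assms sqrt_disc_bounds(1)[of f] by (simp add: flow_form_def mult_pos_neg)
  then show ?thesis using assms by (simp add: flow_form_def pos_root_def first_root_def)
qed

text \<open>In terms of the roots, the product C/A and the sum -B/A are positive, so the second root
  is positive too. Roots of opposite sign with the first one positive would force A > 0 > C.\<close>

lemma pos_root_cases:
  assumes "pos_root f" "\<not> flow_form f"
  shows "cA f * cC f > 0" "cA f * cB f < 0"
proof -
  have i: "indef f" and p: "first_root f > 0" using assms by (auto simp: pos_root_def)
  have nz: "cA f \<noteq> 0" "cC f \<noteq> 0" using indef_nonzero[OF i] by auto
  show AC: "cA f * cC f > 0"
  proof (rule ccontr)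
    assume "\<not> cA f * cC f > 0"
    then have n: "cA f * cC f < 0" using nz by (simp add: less_le)
    then have A: "cA f < 0" using assms(2) i by (auto simp: flow_form_def mult_less_0_iff)
    have "sqrt (of_int (disc f)) - of_int (cB f) > 0" using sqrt_disc_bounds(1)[OF i n] by linarith
    then have "first_root f < 0" using A by (simp add: first_root_def divide_neg_pos divide_pos_neg)
    then show False using p by simp
  qed
  have b: "sqrt (of_int (disc f)) < \<bar>of_int (cB f)\<bar>" using sqrt_disc_bounds(2)[OF i AC] .
  have s: "sqrt (of_int (disc f)) > 0" using i by (simp add: indef_def)
  show "cA f * cB f < 0"
  proof (cases "cA f > 0")
    case True
    then have "- of_int (cB f) + sqrt (of_int (disc f)) > 0"
      using p by (simp add: first_root_def zero_less_divide_iff)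
    then have "cB f < 0" using b s by (cases "cB f \<ge> 0") auto
    then show ?thesis using True by (simp add: mult_pos_neg)
  next
    case False
    then have A: "cA f < 0" using nz by simp
    then have "- of_int (cB f) + sqrt (of_int (disc f)) < 0"
      using p by (simp add: first_root_def zero_less_divide_iff)
    then have "cB f > 0" using s by (smt (verit) of_int_0_less_iff)
    then show ?thesis using A by (simp add: mult_neg_pos)
  qed
qed

text \<open>The summand \<open>2 * c\<close> pulls \<open>b\<close> towards 0, and by the third
  assumption it does not carry it across.\<close>

lemma abs_add_less:
  fixes b c :: int
  assumes "a * b < 0" "a * c > 0" "a * (b + 2 * c) < 0"
  shows "\<bar>b + 2 * c\<bar> < \<bar>b\<bar>"
  using assms by (auto simp: mult_less_0_iff zero_less_mult_iff)

text \<open>While both roots of the form are positive and on the same side of 1, the middle coefficient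
  decreases in absolute value, so the two roots are eventually separated.\<close>

lemma eventually_flow_form:
  assumes "pos_root f" shows "\<exists>i. flow_form ((next_form ^^ i) f)"
  using assms
proof (induction "nat \<bar>cB f\<bar>" arbitrary: f rule: less_induct)
  case less
  show ?case
  proof (cases "flow_form f \<or> flow_form (next_form f)")
    case True
    then show ?thesis by (metis funpow_0 funpow_simps_right(2) comp_apply)
  next
    case False
    have n: "pos_root (next_form f)" using less.prems by (rule pos_root_next)
    have f: "cA f * cC f > 0" "cA f * cB f < 0" using pos_root_cases less.prems False by auto
    have g: "cA (next_form f) * cC (next_form f) > 0" "cA (next_form f) * cB (next_form f) < 0"
      using pos_root_cases n False by auto
    have "\<bar>cB (next_form f)\<bar> < \<bar>cB f\<bar>"
    proof (cases "first_root f > 1")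
      case True
      have "\<bar>cB f + 2 * cA f\<bar> < \<bar>cB f\<bar>"
        by (rule abs_add_less[of "cA f"]) (use f g True in \<open>auto simp: next_form_def algebra_simps zero_less_mult_iff\<close>)
      then show ?thesis using True by (simp add: next_form_def add.commute)
    next
      case False
      have "\<bar>cB f + 2 * cC f\<bar> < \<bar>cB f\<bar>"
        by (rule abs_add_less[of "cC f"])
          (use f g False in \<open>auto simp: next_form_def mult_less_0_iff zero_less_mult_iff\<close>)
      then show ?thesis using False by (simp add: next_form_def)
    qed
    then have "nat \<bar>cB (next_form f)\<bar> < nat \<bar>cB f\<bar>" by simp
    then obtain i where "flow_form ((next_form ^^ i) (next_form f))" using less.hyps n by blast
    then show ?thesis by (metis funpow_simps_right(2) comp_apply)
  qed
qed

text \<open>A + B + C is the value at x = 1 of Ax^2 + Bx + C. As A > 0 and the second root is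
  negative, this value is negative exactly when 1 lies to the left of the first root. This ties the
  algorithm on roots to the number in the region ahead.\<close>

lemma flow_form_root_gt_1:
  assumes "flow_form f"
  shows "first_root f > 1 \<longleftrightarrow> cA f + cB f + cC f < 0"
proof -
  have A: "cA f > 0" and C: "cC f < 0" using assms by (auto simp: flow_form_def)
  have "first_root f > 1 \<longleftrightarrow> sqrt (of_int (disc f)) > of_int (2 * cA f + cB f)"
    using A by (simp add: first_root_def field_simps)
  also have "\<dots> \<longleftrightarrow> cA f + cB f + cC f < 0"
  proof (cases "2 * cA f + cB f < 0")
    case True
    have "sqrt (of_int (disc f)) > 0" using assms by (simp add: flow_form_def indef_def)
    moreover have "real_of_int (2 * cA f + cB f) < 0" using True by linarith
    ultimately have "sqrt (of_int (disc f)) > of_int (2 * cA f + cB f)" by linarith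
    then show ?thesis using True A C by auto
  next
    case False
    then have "of_int (2 * cA f + cB f) < sqrt (of_int (disc f)) \<longleftrightarrow>
      sqrt ((of_int (2 * cA f + cB f))\<^sup>2) < sqrt (of_int (disc f))" by simp
    also have "\<dots> \<longleftrightarrow> (2 * cA f + cB f)\<^sup>2 < disc f"
      unfolding real_sqrt_less_iff by (metis of_int_less_iff of_int_power)
    also have "\<dots> \<longleftrightarrow> (4 * cA f) * (cA f + cB f + cC f) < 0"
      by (auto simp: disc_def power2_eq_square algebra_simps)
    also have "\<dots> \<longleftrightarrow> cA f + cB f + cC f < 0" using A by (auto simp: mult_less_0_iff)
    finally show ?thesis .
  qed
  finally show ?thesis .
qed

lemma flow_form_next:
  assumes "flow_form f" shows "flow_form (next_form f)"
proof -
  have "cA (right_form f) \<noteq> 0" using indef_nonzero(1)[of "right_form f"] assms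
    by (simp add: flow_form_def)
  then show ?thesis
    using assms flow_form_root_gt_1[OF assms] by (auto simp: flow_form_def next_form_def)
qed

lemma flow_form_next_iter: "flow_form f \<Longrightarrow> flow_form ((next_form ^^ n) f)"
  by (induction n) (auto intro: flow_form_next)

lemma next_form_inject:
  assumes f: "flow_form f" and g: "flow_form g" and eq: "next_form f = next_form g"
  shows "f = g"
proof -
  \<comment> \<open>A - B + C is the number in the region behind an edge. On the river its sign
    remembers the last turn: negative after a left one, positive after a right one.\<close>
  have sgn: "cA (next_form h) - cB (next_form h) + cC (next_form h) =
      (if first_root h > 1 then cC h else cA h)" for h by (simp add: next_form_def)
  have "first_root f > 1 \<longleftrightarrow> first_root g > 1"
    using sgn[of f] sgn[of g] f g eq by (auto simp: flow_form_def split: if_splits)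
  then show ?thesis using eq
    by (auto intro!: bqf.expand simp: next_form_def left_form_def right_form_def split: if_splits)
qed

lemma next_iter_inject:
  assumes "flow_form f" "flow_form g" "(next_form ^^ n) f = (next_form ^^ n) g"
  shows "f = g"
  using assms(3)
proof (induction n)
  case (Suc n)
  then show ?case using next_form_inject flow_form_next_iter assms(1,2) by simp
qed simp

text \<open>For A > 0 > C both summands of D = B^2 + 4A(-C) are nonnegative, so D bounds all three
  coefficients.\<close>

lemma finite_flow_forms: "finite {f. flow_form f \<and> disc f = D}"
proof (rule finite_subset)
  show "{f. flow_form f \<and> disc f = D} \<subseteq>
    (\<lambda>(a, b, c). BQF a b c) ` ({0..D} \<times> {-D..D} \<times> {-D..0})"
  proof
    fix f assume "f \<in> {f. flow_form f \<and> disc f = D}"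
    then have f: "cA f > 0" "cC f < 0" "(cB f)\<^sup>2 - 4 * cA f * cC f = D"
      by (auto simp: flow_form_def disc_def)
    have "\<bar>cB f\<bar> * 1 \<le> \<bar>cB f\<bar> * \<bar>cB f\<bar>"
    proof (cases "cB f = 0")
      case False
      then have "1 \<le> \<bar>cB f\<bar>" by linarith
      then show ?thesis by (intro mult_left_mono) simp_all
    qed simp
    then have b: "\<bar>cB f\<bar> \<le> (cB f)\<^sup>2" by (simp add: power2_eq_square abs_mult_self_eq)
    have "cA f * 1 \<le> cA f * (- cC f)" using f by (intro mult_left_mono) auto
    moreover have "1 * (- cC f) \<le> cA f * (- cC f)" using f by (intro mult_right_mono) auto
    moreover have "0 \<le> (cB f)\<^sup>2" by simp
    moreover have "D = (cB f)\<^sup>2 + 4 * (cA f * (- cC f))" using f(3) by simp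
    ultimately have "cA f \<le> D" "- cC f \<le> D" "\<bar>cB f\<bar> \<le> D" using b f(1,2) by linarith+
    then show "f \<in> (\<lambda>(a, b, c). BQF a b c) ` ({0..D} \<times> {-D..D} \<times> {-D..0})"
      using f by (intro image_eqI[of _ _ "(cA f, cB f, cC f)"]) auto
  qed
qed auto

text \<open>A left step preserves the distance of two roots and a right step increases it, so two
  periodic forms making the same turns have the same root.\<close>

lemma periodic_turns_root_eq:
  assumes f: "pos_root f" and g: "pos_root g"
    and pf: "(next_form ^^ m) f = f" and pg: "(next_form ^^ m) g = g"
    and turn: "\<And>i. form_turn ((next_form ^^ i) f) = form_turn ((next_form ^^ i) g)"
    and right: "k < m" "form_turn ((next_form ^^ k) f) = 1"
  shows "first_root f = first_root g"
proof (rule ccontr)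
  assume ne: "first_root f \<noteq> first_root g"
  define d where "d i = \<bar>first_root ((next_form ^^ i) f) - first_root ((next_form ^^ i) g)\<bar>" for i
  have step: "d i \<le> d (Suc i) \<and> (d i > 0 \<and> form_turn ((next_form ^^ i) f) = 1 \<longrightarrow> d i < d (Suc i))" for i
  proof -
    let ?f = "(next_form ^^ i) f" and ?g = "(next_form ^^ i) g"
    have pf: "pos_root ?f" and pg: "pos_root ?g" using f g pos_root_next_iter by auto
    then have i: "indef ?f" "indef ?g" by (auto simp: pos_root_def)
    show ?thesis
    proof (cases "first_root ?f > 1")
      case True
      then have "first_root ?g > 1" using turn[of i] by (auto simp: form_turn_def split: if_splits)
      then show ?thesis using True i
        by (simp add: d_def next_form_def first_root_left_form form_turn_def)
    next
      case False
      define x where "x = first_root ?f"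
      define y where "y = first_root ?g"
      have "\<not> first_root ?g > 1" using False turn[of i] by (auto simp: form_turn_def split: if_splits)
      moreover have "x \<noteq> 1" "y \<noteq> 1" unfolding x_def y_def using i first_root_irrational by force+
      ultimately have xy: "0 < x" "x < 1" "0 < y" "y < 1"
        using False pf pg by (auto simp: x_def y_def pos_root_def)
      have "d (Suc i) = \<bar>x / (1 - x) - y / (1 - y)\<bar>"
        using \<open>\<not> first_root ?g > 1\<close> False i
        by (simp add: d_def next_form_def first_root_right_form(2) x_def y_def)
      also have "x / (1 - x) - y / (1 - y) = (x - y) / ((1 - x) * (1 - y))"
        using xy by (simp add: divide_simps) (simp add: algebra_simps)
      also have "\<bar>\<dots>\<bar> = \<bar>x - y\<bar> / ((1 - x) * (1 - y))" using xy by (simp add: abs_mult)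
      finally have d: "d (Suc i) * ((1 - x) * (1 - y)) = d i"
        using xy by (simp add: d_def x_def y_def)
      have c: "(1 - x) * (1 - y) < 1" "(1 - x) * (1 - y) > 0"
        using xy mult_strict_mono[of "1 - x" 1 "1 - y" 1] by auto
      have "0 \<le> d (Suc i)" by (simp add: d_def)
      then have "d (Suc i) * ((1 - x) * (1 - y)) \<le> d (Suc i) * 1"
        using c by (intro mult_left_mono) auto
      moreover have "d (Suc i) * ((1 - x) * (1 - y)) < d (Suc i) * 1" if "d i > 0"
      proof (rule mult_strict_left_mono)
        show "0 < d (Suc i)" using that d \<open>0 \<le> d (Suc i)\<close> by (metis less_le mult_zero_left)
      qed (rule c(1))
      ultimately show ?thesis using d by auto
    qed
  qed
  have mono: "d i \<le> d j" if "i \<le> j" for i j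
    by (rule lift_Suc_mono_le[of d, OF conjunct1[OF step] that])
  have "0 < d 0" using ne by (simp add: d_def)
  also have "d 0 \<le> d k" using mono by simp
  finally have "d k < d (Suc k)" using step[of k] right(2) by blast
  also have "\<dots> \<le> d m" using mono right(1) by simp
  also have "\<dots> = d 0" by (simp add: d_def pf pg)
  also have "\<dots> \<le> d k" using mono by simp
  finally show False by simp
qed

section \<open>Continued fractions as run lengths\<close>

lemma inverse_irrational: "x \<notin> \<rat> \<Longrightarrow> 1 / x \<notin> (\<rat> :: real set)"
  using Rats_divide[of 1 "1 / x"] by auto

lemma cf_rem_irrational: "x \<notin> \<rat> \<Longrightarrow> cf_rem x n \<notin> \<rat>"
proof (induction n)
  case (Suc n)
  then show ?case using inverse_irrational[of "frac (cf_rem x n)"] by simp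
qed simp

lemma frac_irrational_bounds:
  assumes "x \<notin> \<rat>" shows "0 < frac x" "frac x < 1"
  using assms Ints_subset_Rats frac_lt_1 by auto

lemma cf_rem_Suc_gt_1:
  assumes "x \<notin> \<rat>" shows "cf_rem x (Suc n) > 1"
  using frac_irrational_bounds[OF cf_rem_irrational[OF assms, of n]] by simp

lemma cf_coeff_Suc_ge_1: "x \<notin> \<rat> \<Longrightarrow> cf_coeff x (Suc n) \<ge> 1"
  using cf_rem_Suc_gt_1[of x n] unfolding cf_coeff_def by linarith

lemma cf_rem_add: "cf_rem (cf_rem x s) n = cf_rem x (s + n)"
  by (induction n) auto

lemma cf_coeff_add: "cf_coeff (cf_rem x s) n = cf_coeff x (s + n)"
  by (simp add: cf_coeff_def cf_rem_add)

text \<open>With a = \<open>frac x\<close> the product equals 1 - a * floor(1/a). It is at most 1 -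
  a because the floor is at least 1, and at most a because a fractional part is below 1; one of
  these two bounds is at most 1/2.\<close>

lemma frac_mult_frac_inverse_le:
  assumes "x \<notin> \<rat>" shows "frac x * frac (1 / frac x) \<le> 1 / 2"
proof -
  have b: "0 < frac x" "frac x < 1" using frac_irrational_bounds[OF assms] .
  then have "1 / frac x > 1" by simp
  then have "\<lfloor>1 / frac x\<rfloor> \<ge> 1" by (simp add: le_floor_iff)
  then have a: "real_of_int \<lfloor>1 / frac x\<rfloor> \<ge> 1" by linarith
  have "frac x * frac (1 / frac x) = 1 - frac x * of_int \<lfloor>1 / frac x\<rfloor>"
    using b by (simp add: frac_def[of "1 / frac x"] algebra_simps)
  also have "\<dots> \<le> 1 - frac x * 1" using a b by (intro diff_left_mono mult_left_mono) auto
  finally have 1: "frac x * frac (1 / frac x) \<le> 1 - frac x" by simp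
  have 2: "frac x * frac (1 / frac x) \<le> frac x * 1"
    using b frac_lt_1[of "1 / frac x"] by (intro mult_left_mono) auto
  show ?thesis using 1 2 by linarith
qed

text \<open>While the coefficients agree, complete quotients differ by the difference of their
  fractional parts, hence by less than 1. Passing to reciprocals enlarges any nonzero difference,
  eventually beyond 1.\<close>

lemma cf_coeff_inject:
  assumes x: "x \<notin> \<rat>" and y: "y \<notin> \<rat>" and eq: "\<And>n. cf_coeff x n = cf_coeff y n"
  shows "x = y"
proof (rule ccontr)
  assume ne: "x \<noteq> y"
  define d where "d n = \<bar>cf_rem x n - cf_rem y n\<bar>" for n
  have diff: "cf_rem x n - cf_rem y n = frac (cf_rem x n) - frac (cf_rem y n)" for n
    using eq[of n] by (simp add: cf_coeff_def frac_def)
  have d1: "d n < 1" for n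
    unfolding d_def diff using frac_lt_1[of "cf_rem x n"] frac_lt_1[of "cf_rem y n"]
      frac_ge_0[of "cf_rem x n"] frac_ge_0[of "cf_rem y n"] by linarith
  have step: "d (Suc n) * (frac (cf_rem x n) * frac (cf_rem y n)) = d n" for n
  proof -
    let ?a = "frac (cf_rem x n)" and ?b = "frac (cf_rem y n)"
    have b: "0 < ?a" "0 < ?b" using frac_irrational_bounds(1) cf_rem_irrational x y by auto
    have "d (Suc n) = \<bar>1 / ?a - 1 / ?b\<bar>" by (simp add: d_def)
    also have "1 / ?a - 1 / ?b = (?b - ?a) / (?a * ?b)" using b by (simp add: field_simps)
    also have "\<bar>\<dots>\<bar> = \<bar>?a - ?b\<bar> / (?a * ?b)" using b by (simp add: abs_mult abs_minus_commute)
    finally have "d (Suc n) * (?a * ?b) = \<bar>?a - ?b\<bar>" using b by simp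
    then show ?thesis by (simp add: d_def diff)
  qed
  \<comment> \<open>A single step divides by a product of fractional parts that may be close to 1.
    Over two steps each of the two numbers contributes a factor of at most 1/2.\<close>
  have two: "d n * 4 \<le> d (Suc (Suc n))" for n
  proof -
    let ?a = "frac (cf_rem x n)" and ?b = "frac (cf_rem y n)"
    let ?a' = "frac (cf_rem x (Suc n))" and ?b' = "frac (cf_rem y (Suc n))"
    have "d n = d (Suc (Suc n)) * ((?a * ?a') * (?b * ?b'))"
      using step[of n] step[of "Suc n"] by (simp add: mult_ac)
    also have "\<dots> \<le> d (Suc (Suc n)) * (1/2 * (1/2))"
      using frac_mult_frac_inverse_le[OF cf_rem_irrational[OF x, of n]]
        frac_mult_frac_inverse_le[OF cf_rem_irrational[OF y, of n]]
      by (intro mult_left_mono mult_mono) (auto simp: d_def)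
    finally show ?thesis by simp
  qed
  have "d 0 * 4 ^ n \<le> d (2 * n)" for n
  proof (induction n)
    case (Suc n)
    have "d 0 * 4 ^ Suc n = d 0 * 4 ^ n * 4" by simp
    also have "\<dots> \<le> d (2 * n) * 4" using Suc by simp
    also have "\<dots> \<le> d (2 * Suc n)" using two[of "2 * n"] by simp
    finally show ?case .
  qed simp
  then have b: "d 0 * 4 ^ n < 1" for n using d1 le_less_trans by blast
  have d0: "d 0 > 0" using ne by (simp add: d_def)
  obtain n where "1 / d 0 < 4 ^ n" using real_arch_pow[of 4 "1 / d 0"] by auto
  then have "1 < d 0 * 4 ^ n" using d0 by (simp add: field_simps)
  then show False using b[of n] by simp
qed

text \<open>Repetition of coefficients lifts to the complete quotients because these are irrational
  and thus determined by their coefficients.\<close>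

lemma cf_period_rem_eq:
  assumes "x \<notin> \<rat>" "cf_period_from x s p"
  shows "cf_rem x (s + p) = cf_rem x s"
proof (rule cf_coeff_inject)
  fix n
  show "cf_coeff (cf_rem x (s + p)) n = cf_coeff (cf_rem x s) n"
    using assms(2) by (metis add.assoc add.commute cf_coeff_add cf_period_from_def le_add1)
qed (use assms cf_rem_irrational in auto)

lemma cf_period_rem_mult:
  assumes "x \<notin> \<rat>" "cf_period_from x s p"
  shows "cf_rem x (s + p * c) = cf_rem x s"
proof (induction c)
  case (Suc c)
  have "cf_period_from x (s + p * c) p" using assms(2) by (auto simp: cf_period_from_def)
  then have "cf_rem x (s + p * c + p) = cf_rem x s" using cf_period_rem_eq[OF assms(1)] Suc by simp
  then show ?case by (simp add: add_ac)
qed simp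

lemma cf_rem_eq_coeff_eq:
  "cf_rem x i = cf_rem x j \<Longrightarrow> cf_coeff x (i + k) = cf_coeff x (j + k)"
  by (simp flip: cf_coeff_add)

text \<open>Right turns subtract 1 from the reciprocal of the root. Hence at the start of a run with
  odd index it is the reciprocal of the root that equals the complete quotient.\<close>

definition alt_rem :: "real \<Rightarrow> nat \<Rightarrow> real" where
  "alt_rem x J = (if even J then cf_rem x J else 1 / cf_rem x J)"

text \<open>The number of turns made before run \<open>J\<close> begins, counted from the beginning
  of run \<open>K\<close>.\<close>

definition run_start :: "real \<Rightarrow> nat \<Rightarrow> nat \<Rightarrow> nat" where
  "run_start x K J = (\<Sum>j = K..<J. nat (cf_coeff x j))"

lemma run_start_same [simp]: "run_start x K K = 0"
  by (simp add: run_start_def)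

lemma run_start_Suc: "K \<le> J \<Longrightarrow> run_start x K (Suc J) = run_start x K J + nat (cf_coeff x J)"
  by (simp add: run_start_def)

lemma run_start_ge:
  assumes "x \<notin> \<rat>" "K \<ge> 1" "K \<le> J" shows "J - K \<le> run_start x K J"
  using assms(3)
proof (induction rule: dec_induct)
  case (step J)
  have "cf_coeff x J \<ge> 1" using cf_coeff_Suc_ge_1[of x "J - 1"] assms step by simp
  then show ?case using step run_start_Suc[of K J x] by simp
qed simp

lemma run_start_mono: "J \<le> J' \<Longrightarrow> run_start x K J \<le> run_start x K J'"
  unfolding run_start_def by (intro sum_mono2) auto

text \<open>Each turn subtracts 1 from the complete quotient. Before its integral part is used up
  the rest exceeds 1, strictly because it is irrational, and this forces the same turn
  again.\<close>

lemma single_run: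
  assumes f: "pos_root f" and root: "first_root f = alt_rem x J" and x: "x \<notin> \<rat>"
  shows "l \<le> nat (cf_coeff x J) \<Longrightarrow>
      (if even J then first_root ((next_form ^^ l) f) else 1 / first_root ((next_form ^^ l) f)) =
      cf_rem x J - of_nat l" (is "_ \<Longrightarrow> ?P l")
    and "l < nat (cf_coeff x J) \<Longrightarrow> form_turn ((next_form ^^ l) f) = J mod 2"
proof -
  have gt1: "cf_rem x J - of_nat l > 1" if "l < nat (cf_coeff x J)" for l
  proof -
    have "of_nat l + 1 \<le> real_of_int (cf_coeff x J)" using that by linarith
    then have "cf_rem x J \<ge> of_nat l + 1" using of_int_floor_le[of "cf_rem x J"] unfolding cf_coeff_def by linarith
    moreover have "cf_rem x J \<noteq> of_nat l + 1"
      using cf_rem_irrational[OF x, of J] by (metis Rats_1 Rats_add Rats_of_nat)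
    ultimately show ?thesis by linarith
  qed
  have pos: "pos_root ((next_form ^^ l) f)" for l using pos_root_next_iter f by blast
  have turn: "form_turn ((next_form ^^ l) f) = J mod 2" if "l < nat (cf_coeff x J)" "?P l" for l
  proof (cases "even J")
    case True
    then show ?thesis using gt1[OF that(1)] that(2) by (simp add: form_turn_def)
  next
    case False
    have "first_root ((next_form ^^ l) f) > 0" using pos[of l] by (simp add: pos_root_def)
    moreover have "1 / first_root ((next_form ^^ l) f) > 1" using gt1[OF that(1)] that(2) False by simp
    ultimately have "first_root ((next_form ^^ l) f) < 1" by (simp add: divide_simps)
    then show ?thesis using False by (simp add: form_turn_def odd_iff_mod_2_eq_one)
  qed
  have P: "?P l" if "l \<le> nat (cf_coeff x J)" for l
    using that
  proof (induction l)
    case (Suc l)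
    then have IH: "?P l" by simp
    have t: "form_turn ((next_form ^^ l) f) = J mod 2" using turn IH Suc.prems by simp
    have i: "indef ((next_form ^^ l) f)" using pos[of l] by (simp add: pos_root_def)
    show ?case
    proof (cases "even J")
      case True
      then have "first_root ((next_form ^^ l) f) > 1"
        using t by (auto simp: form_turn_def split: if_splits)
      then show ?thesis using IH True i by (simp add: next_form_def first_root_left_form)
    next
      case False
      then have "\<not> first_root ((next_form ^^ l) f) > 1"
        using t by (auto simp: form_turn_def mod2_eq_if split: if_splits)
      then show ?thesis using IH False i by (simp add: next_form_def first_root_right_form(1))
    qed
  qed (use root in \<open>auto simp: alt_rem_def\<close>)
  show "l \<le> nat (cf_coeff x J) \<Longrightarrow> ?P l" by (rule P)
  show "l < nat (cf_coeff x J) \<Longrightarrow> form_turn ((next_form ^^ l) f) = J mod 2"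
    using turn P by simp
qed

lemma alt_rem_Suc:
  assumes f: "pos_root f" and root: "first_root f = alt_rem x J" and x: "x \<notin> \<rat>"
  shows "first_root ((next_form ^^ nat (cf_coeff x J)) f) = alt_rem x (Suc J)"
proof -
  let ?g = "(next_form ^^ nat (cf_coeff x J)) f"
  \<comment> \<open>A coefficient of index 0 may be negative and \<open>nat\<close> would then
    truncate it; the positive root of \<open>f\<close> excludes this.\<close>
  have "cf_rem x J > 0"
    using f root by (auto simp: pos_root_def alt_rem_def split: if_splits)
  then have "cf_coeff x J \<ge> 0" by (simp add: cf_coeff_def)
  then have "(if even J then first_root ?g else 1 / first_root ?g) = frac (cf_rem x J)"
    using single_run(1)[OF assms, of "nat (cf_coeff x J)"] by (simp add: frac_def cf_coeff_def)
  then show ?thesis by (auto simp: alt_rem_def split: if_splits)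
      (metis div_by_1 divide_divide_eq_right mult_1)
qed

lemma runs:
  assumes f: "pos_root f" and root: "first_root f = alt_rem x K" and x: "x \<notin> \<rat>" and "K \<le> J"
  shows root_run_start: "first_root ((next_form ^^ run_start x K J) f) = alt_rem x J"
    and turn_in_run: "\<And>l. l < nat (cf_coeff x J) \<Longrightarrow>
      form_turn ((next_form ^^ (run_start x K J + l)) f) = J mod 2"
    and turns_concat: "map (\<lambda>i. form_turn ((next_form ^^ i) f)) [0..<run_start x K J] =
      concat (map (\<lambda>j. replicate (nat (cf_coeff x j)) (j mod 2)) [K..<J])"
proof -
  have pos: "pos_root ((next_form ^^ n) f)" for n using pos_root_next_iter f by blast
  have R: "first_root ((next_form ^^ run_start x K J) f) = alt_rem x J" if "K \<le> J" for J
    using that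
  proof (induction rule: dec_induct)
    case (step J)
    have "run_start x K (Suc J) = nat (cf_coeff x J) + run_start x K J"
      by (simp add: run_start_Suc step.hyps)
    then show ?case using alt_rem_Suc[OF pos step.IH x] by (simp only: funpow_add comp_apply)
  qed (use root in simp)
  show "first_root ((next_form ^^ run_start x K J) f) = alt_rem x J" using R assms(4) .
  have T: "form_turn ((next_form ^^ (run_start x K J + l)) f) = J mod 2"
    if "K \<le> J" "l < nat (cf_coeff x J)" for l J
    using single_run(2)[OF pos R[OF that(1)] x that(2)]
    by (simp only: funpow_add comp_apply add.commute[of _ l])
  then show "\<And>l. l < nat (cf_coeff x J) \<Longrightarrow>
      form_turn ((next_form ^^ (run_start x K J + l)) f) = J mod 2" using assms(4) by blast
  show "map (\<lambda>i. form_turn ((next_form ^^ i) f)) [0..<run_start x K J] =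
      concat (map (\<lambda>j. replicate (nat (cf_coeff x j)) (j mod 2)) [K..<J])"
    using assms(4)
  proof (induction rule: dec_induct)
    case (step J)
    have "map (\<lambda>i. form_turn ((next_form ^^ i) f))
        [run_start x K J..<run_start x K J + nat (cf_coeff x J)] =
      replicate (nat (cf_coeff x J)) (J mod 2)"
      by (rule nth_equalityI) (auto simp: T step.hyps)
    moreover have "run_start x K (Suc J) = run_start x K J + nat (cf_coeff x J)"
      by (simp add: run_start_Suc step.hyps)
    moreover have "[K..<Suc J] = [K..<J] @ [J]" using step.hyps by simp
    ultimately show ?case using step.IH by (simp only: upt_add_eq_append[OF le0] map_append
      concat_append list.map concat.simps append_Nil2)
  qed simp
qed

text \<open>From index 1 on no run is empty, so the run starts are unbounded and there is a last one
  not exceeding \<open>i\<close>.\<close>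

lemma run_index:
  assumes "x \<notin> \<rat>" "K \<ge> 1"
  obtains J l where "K \<le> J" "l < nat (cf_coeff x J)" "i = run_start x K J + l"
proof -
  define J where "J = (GREATEST J. K \<le> J \<and> run_start x K J \<le> i)"
  have b: "J \<le> i + K" if "K \<le> J \<and> run_start x K J \<le> i" for J
    using run_start_ge[OF assms, of J] that by linarith
  have J: "K \<le> J \<and> run_start x K J \<le> i"
    unfolding J_def by (rule GreatestI_nat[where k = K]) (use b in auto)
  have "\<not> run_start x K (Suc J) \<le> i"
  proof
    assume "run_start x K (Suc J) \<le> i"
    then have "Suc J \<le> J" unfolding J_def
      by (intro Greatest_le_nat[where b = "i + K"]) (use b J in \<open>auto simp: J_def\<close>)
    then show False by simp
  qed
  then have "i - run_start x K J < nat (cf_coeff x J)" using J run_start_Suc[of K J x] by auto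
  then show thesis using that[of J "i - run_start x K J"] J by simp
qed

section \<open>The river sequence of a form\<close>

text \<open>The root of \<open>q\<close> may have any sign. Subtracting its integral part gives a
  form in the orbit with root in (0, 1), that is, one standing at the beginning of run 1. From there
  the algorithm reaches the river and stays on it.\<close>

lemma eventually_flow_alt_rem:
  assumes q: "indef q"
  obtains J\<^sub>0 where "J\<^sub>0 \<ge> 1" "\<And>J. J \<ge> J\<^sub>0 \<Longrightarrow>
    \<exists>f\<in>orbit q. flow_form f \<and> first_root f = alt_rem (first_root q) J"
proof -
  let ?x = "first_root q"
  have x: "?x \<notin> \<rat>" using first_root_irrational q .
  obtain f where f: "f \<in> orbit q" "first_root f = ?x - of_int \<lfloor>?x\<rfloor>"
    using orbit_translate[OF q orbit.base, of "\<lfloor>?x\<rfloor>"] by blast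
  have root: "first_root f = alt_rem ?x 1" using f by (simp add: alt_rem_def frac_def)
  have pos: "pos_root f" using f orbit_indef[OF f(1) q] frac_irrational_bounds[OF x]
    by (simp add: pos_root_def frac_def)
  obtain i where i: "flow_form ((next_form ^^ i) f)" using eventually_flow_form pos by blast
  show thesis
  proof (rule that[of "Suc i"])
    fix J assume J: "Suc i \<le> J"
    let ?g = "(next_form ^^ run_start ?x 1 J) f"
    have "i \<le> run_start ?x 1 J" using run_start_ge[OF x, of 1 J] J by simp
    then have "?g = (next_form ^^ (run_start ?x 1 J - i)) ((next_form ^^ i) f)"
      by (metis add.commute comp_apply funpow_add le_add_diff_inverse)
    then have "flow_form ?g" using flow_form_next_iter i by simp
    moreover have "first_root ?g = alt_rem ?x J" using root_run_start[OF pos root x] J by simp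
    ultimately show "\<exists>f\<in>orbit q. flow_form f \<and> first_root f = alt_rem ?x J"
      using orbit_next_iter f(1) by blast
  qed simp
qed

lemma disc_orbit: "f \<in> orbit q \<Longrightarrow> disc f = disc q"
  by (induction rule: orbit.induct) auto

text \<open>Lagrange's theorem by the pigeonhole principle: the late complete quotients or their
  reciprocals are first roots of flow forms of one discriminant, of which there are finitely
  many.\<close>

lemma cf_eventually_periodic:
  assumes q: "indef q" shows "\<exists>s p. cf_period_from (first_root q) s p"
proof -
  let ?x = "first_root q"
  obtain J\<^sub>0 where "\<And>J. J \<ge> J\<^sub>0 \<Longrightarrow> \<exists>f\<in>orbit q. flow_form f \<and> first_root f = alt_rem ?x J"
    using eventually_flow_alt_rem[OF q] by metis
  \<comment> \<open>Only indices of one parity are used, so that equality of two values of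
    \<open>alt_rem\<close> gives equality of complete quotients.\<close>
  then have "\<forall>n. \<exists>f. f \<in> orbit q \<and> flow_form f \<and> first_root f = alt_rem ?x (J\<^sub>0 + 2 * n)"
    by (metis le_add1)
  then obtain F where F: "\<And>n. F n \<in> orbit q \<and> flow_form (F n) \<and> first_root (F n) = alt_rem ?x (J\<^sub>0 + 2 * n)"
    by metis
  have "range F \<subseteq> {f. flow_form f \<and> disc f = disc q}" using F disc_orbit by auto
  then have "finite (range F)" using finite_flow_forms finite_subset by blast
  then have "\<not> inj F" using finite_imageD infinite_UNIV_nat by blast
  then obtain i j where ij: "i < j" "F i = F j" by (metis injI linorder_neqE_nat)
  then have "alt_rem ?x (J\<^sub>0 + 2 * i) = alt_rem ?x (J\<^sub>0 + 2 * j)" using F by metis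
  then have "cf_rem ?x (J\<^sub>0 + 2 * i) = cf_rem ?x (J\<^sub>0 + 2 * j)" by (auto simp: alt_rem_def split: if_splits)
  note eq = cf_rem_eq_coeff_eq[OF this]
  have "cf_period_from ?x (J\<^sub>0 + 2 * i) (2 * j - 2 * i)"
    unfolding cf_period_from_def
  proof (intro conjI allI impI)
    fix n assume "J\<^sub>0 + 2 * i \<le> n"
    then show "cf_coeff ?x (n + (2 * j - 2 * i)) = cf_coeff ?x n"
      using eq[of "n - (J\<^sub>0 + 2 * i)"] ij(1) by (simp add: add.commute)
  qed (use ij in simp)
  then show ?thesis by blast
qed

section \<open>The continued fraction rule and the least period of turns\<close>

lemma is_arg_min_Least: "P (n::nat) \<Longrightarrow> is_arg_min id P (LEAST n. P n)"
  unfolding is_arg_min_def id_apply using LeastI[of P n] not_less_Least[of _ P] by blast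

lemma is_arg_min_nat_unique: "is_arg_min id P (a::nat) \<Longrightarrow> is_arg_min id P b \<Longrightarrow> a = b"
  unfolding is_arg_min_def id_apply by (meson linorder_neqE_nat)

lemma cf_river_sequence_exists:
  assumes "indef q" shows "\<exists>r. cf_river_sequence q r"
proof -
  let ?x = "first_root q"
  obtain s where s: "is_arg_min id (\<lambda>s. \<exists>p. cf_period_from ?x s p) s"
    using cf_eventually_periodic[OF assms]
      is_arg_min_Least[of "\<lambda>s. \<exists>p. cf_period_from ?x s p"] by metis
  then obtain p where p: "cf_period_from ?x s p" by (auto simp: is_arg_min_def)
  have "cf_period_from ?x s (2 * p)"
    unfolding cf_period_from_def
  proof (intro conjI allI impI)
    fix n assume "s \<le> n"
    then have "cf_coeff ?x (n + p + p) = cf_coeff ?x n" using p by (simp add: cf_period_from_def)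
    then show "cf_coeff ?x (n + 2 * p) = cf_coeff ?x n" by (simp add: mult_2 add.assoc)
  qed (use p in \<open>simp add: cf_period_from_def\<close>)
  then obtain p' where "is_arg_min id (\<lambda>p. even p \<and> cf_period_from ?x s p) p'"
    using is_arg_min_Least[of "\<lambda>p. even p \<and> cf_period_from ?x s p" "2 * p"] by auto
  then show ?thesis using s unfolding cf_river_sequence_def by blast
qed

lemma cf_river_sequence_unique:
  assumes "cf_river_sequence q r" "cf_river_sequence q r'" shows "r = r'"
proof -
  let ?x = "first_root q"
  obtain s p where sp: "is_arg_min id (\<lambda>s. \<exists>p. cf_period_from ?x s p) s"
    "is_arg_min id (\<lambda>p. even p \<and> cf_period_from ?x s p) p"
    "r = concat (map (\<lambda>j. replicate (nat (cf_coeff ?x j)) (j mod 2)) [s..<s + p])"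
    using assms(1) unfolding cf_river_sequence_def by blast
  obtain s' p' where sp': "is_arg_min id (\<lambda>s. \<exists>p. cf_period_from ?x s p) s'"
    "is_arg_min id (\<lambda>p. even p \<and> cf_period_from ?x s' p) p'"
    "r' = concat (map (\<lambda>j. replicate (nat (cf_coeff ?x j)) (j mod 2)) [s'..<s' + p'])"
    using assms(2) unfolding cf_river_sequence_def by blast
  have "s' = s" using is_arg_min_nat_unique[OF sp'(1) sp(1)] .
  moreover have "p' = p" using is_arg_min_nat_unique[OF sp'(2)] sp(2) \<open>s' = s\<close> by blast
  ultimately show ?thesis using sp(3) sp'(3) by simp
qed

definition least_period :: "(nat \<Rightarrow> nat) \<Rightarrow> nat \<Rightarrow> bool" where
  "least_period u m \<longleftrightarrow> m > 0 \<and> (\<forall>i. u (i + m) = u i) \<and>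
     (\<forall>n>0. (\<forall>i. u (i + n) = u i) \<longrightarrow> m \<le> n)"

text \<open>The point is minimality of the period. A period \<open>P\<close> of the turns ends
  between two runs, and the form reached there makes the same turns as \<open>f\<close>, so the two
  have the same root. Then the runs in between form an even period of the continued fraction, which
  cannot be shorter than \<open>p\<close>.\<close>

lemma cf_river_sequence_flow:
  assumes q: "indef q" and r: "cf_river_sequence q r"
  obtains f where "f \<in> orbit q" "flow_form f" "(next_form ^^ length r) f = f"
    "\<And>i. form_turn ((next_form ^^ i) f) = r ! (i mod length r)"
    "least_period (\<lambda>i. form_turn ((next_form ^^ i) f)) (length r)"
proof -
  let ?x = "first_root q"
  have x: "?x \<notin> \<rat>" using first_root_irrational q .
  obtain s p where sp: "is_arg_min id (\<lambda>p. even p \<and> cf_period_from ?x s p) p"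
    and r: "r = concat (map (\<lambda>j. replicate (nat (cf_coeff ?x j)) (j mod 2)) [s..<s + p])"
    using r unfolding cf_river_sequence_def by blast
  have p: "even p" "cf_period_from ?x s p"
    and least: "\<And>p'. even p' \<Longrightarrow> cf_period_from ?x s p' \<Longrightarrow> p \<le> p'"
    using sp by (auto simp: is_arg_min_def not_less)
  have p0: "p > 0" using p(2) by (simp add: cf_period_from_def)
  obtain J\<^sub>0 where J0: "J\<^sub>0 \<ge> 1" "\<And>J. J \<ge> J\<^sub>0 \<Longrightarrow>
    \<exists>f\<in>orbit q. flow_form f \<and> first_root f = alt_rem (first_root q) J"
    using eventually_flow_alt_rem[OF q] by metis
  \<comment> \<open>Whole periods are added to \<open>s\<close> until the river is reached; as
    \<open>p\<close> is even, the letters of the runs do not change.\<close>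
  define K where "K = s + p * J\<^sub>0"
  have "J\<^sub>0 * 1 \<le> J\<^sub>0 * p" using p0 by (intro mult_le_mono2) simp
  then have "J\<^sub>0 \<le> K" unfolding K_def by (metis mult.commute mult_1 trans_le_add2)
  then obtain f where f: "f \<in> orbit q" "flow_form f" "first_root f = alt_rem ?x K" using J0 by blast
  have K1: "K \<ge> 1" using \<open>J\<^sub>0 \<le> K\<close> J0(1) by simp
  have pos: "pos_root f" using f(2) flow_form_pos_root by blast
  have posn: "pos_root ((next_form ^^ n) f)" for n using pos pos_root_next_iter by blast
  have ind: "indef ((next_form ^^ n) f)" for n using posn by (simp add: pos_root_def)
  have K_even: "even K = even s" "K mod 2 = s mod 2" using p(1) by (auto simp: K_def mod2_eq_if)
  have coeff: "cf_coeff ?x (K + n) = cf_coeff ?x (s + n)" for n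
    using cf_rem_eq_coeff_eq[OF cf_period_rem_mult[OF x p(2)]] by (simp add: K_def)
  have remKp: "cf_rem ?x (K + p) = cf_rem ?x K"
    using cf_period_rem_mult[OF x p(2), of "Suc J\<^sub>0"] cf_period_rem_mult[OF x p(2), of J\<^sub>0]
    by (simp add: K_def add_ac)
  define u where "u i = form_turn ((next_form ^^ i) f)" for i
  define m where "m = run_start ?x K (K + p)"
  have "[K..<K + p] = map (\<lambda>i. i + p * J\<^sub>0) [s..<s + p]"
    by (rule nth_equalityI) (auto simp: K_def)
  then have "concat (map (\<lambda>j. replicate (nat (cf_coeff ?x j)) (j mod 2)) [K..<K + p]) =
     concat (map (\<lambda>j. replicate (nat (cf_coeff ?x (j + p * J\<^sub>0))) ((j + p * J\<^sub>0) mod 2)) [s..<s + p])"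
    by (simp add: comp_def)
  also have "\<dots> = r"
    unfolding r
  proof (intro arg_cong[of _ _ concat] map_cong refl)
    fix j assume "j \<in> set [s..<s + p]"
    then have "cf_coeff ?x (j + p * J\<^sub>0) = cf_coeff ?x j"
      using coeff[of "j - s"] by (simp add: K_def add_ac)
    moreover have "(j + p * J\<^sub>0) mod 2 = j mod 2" using p(1) by (simp add: mod2_eq_if)
    ultimately show "replicate (nat (cf_coeff ?x (j + p * J\<^sub>0))) ((j + p * J\<^sub>0) mod 2) =
      replicate (nat (cf_coeff ?x j)) (j mod 2)" by simp
  qed
  finally have ru: "r = map u [0..<m]"
    using turns_concat[OF pos f(3) x, of "K + p"] by (simp add: u_def[abs_def] m_def)
  have len: "length r = m" by (simp add: ru)
  have "p \<le> m" using run_start_ge[OF x K1, of "K + p"] by (simp add: m_def)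
  then have m0: "m > 0" using p0 by simp
  \<comment> \<open>By evenness of \<open>p\<close>, \<open>alt_rem\<close> takes the same branch at
    \<open>K + p\<close> as at \<open>K\<close>.\<close>
  have root_m: "first_root ((next_form ^^ m) f) = first_root f"
    using root_run_start[OF pos f(3) x, of "K + p"] remKp p(1) f(3) by (simp add: m_def alt_rem_def)
  have per: "(next_form ^^ m) f = f"
    using first_root_inject[OF ind[of m] ind[of 0]] root_m by simp
  have per': "(next_form ^^ (m * k)) f = f" for k
  proof (induction k)
    case (Suc k)
    have "(next_form ^^ (m * Suc k)) f = (next_form ^^ m) ((next_form ^^ (m * k)) f)"
      by (simp add: funpow_add)
    then show ?case using Suc per by simp
  qed simp
  have um: "u (i + m * k) = u i" for i k by (simp add: u_def funpow_add per')
  have u_mod: "u i = r ! (i mod m)" for i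
    using um[of "i mod m" "i div m"] m0 by (simp add: ru)
  have coeff_pos: "nat (cf_coeff ?x J) > 0" if "J \<ge> 1" for J
    using cf_coeff_Suc_ge_1[OF x, of "J - 1"] that by simp
  have u0: "u 0 = K mod 2" using turn_in_run[OF pos f(3) x, of K 0] coeff_pos[OF K1] by (simp add: u_def)
  have last_run: "u (run_start ?x K (Suc J) - 1) = J mod 2" if "K \<le> J" for J
  proof -
    have "nat (cf_coeff ?x J) > 0" using coeff_pos K1 that by simp
    then have "run_start ?x K (Suc J) - 1 = run_start ?x K J + (nat (cf_coeff ?x J) - 1)"
      using run_start_Suc[OF that, of ?x] by simp
    then show ?thesis using turn_in_run[OF pos f(3) x that, of "nat (cf_coeff ?x J) - 1"]
        \<open>nat (cf_coeff ?x J) > 0\<close> by (simp add: u_def)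
  qed
  \<comment> \<open>The period consists of an even number of nonempty runs with alternating letters,
    so the last run has the other letter than the first.\<close>
  have ulast: "u (m - 1) \<noteq> u 0"
  proof -
    have "odd (p - 1)" using p0 p(1) by simp
    then have "even (K + (p - 1)) \<longleftrightarrow> odd K" by simp
    moreover have "K + p - 1 = K + (p - 1)" using p0 by simp
    ultimately have "(K + p - 1) mod 2 \<noteq> K mod 2" by (simp only: mod2_eq_if split: if_split) simp
    then show ?thesis using last_run[of "K + p - 1"] p0 u0 by (simp add: m_def)
  qed
  have min: "m \<le> P" if P: "P > 0" "\<And>i. u (i + P) = u i" for P
  proof -
    have uP: "u (i + P * k) = u i" for i k
    proof (induction k)
      case (Suc k)
      then show ?case using P(2)[of "i + P * k"] by (simp add: add_ac)
    qed simp
    \<comment> \<open>The index mP - 1 is congruent to -1 modulo both periods, so the change of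
      letter at the end of \<open>m\<close> turns also occurs at the end of \<open>P\<close>
      turns.\<close>
    have "u (P - 1) = u ((m - 1) + m * (P - 1))"
    proof -
      have "(P - 1) + P * (m - 1) = (m - 1) + m * (P - 1)"
        using P(1) m0 by (cases P; cases m) (auto simp: algebra_simps)
      then show ?thesis using uP[of "P - 1" "m - 1"] by simp
    qed
    then have ne: "u (P - 1) \<noteq> u P" using um[of "m - 1" "P - 1"] ulast P(2)[of 0] by simp
    obtain J l where J: "K \<le> J" "l < nat (cf_coeff ?x J)" "P = run_start ?x K J + l"
      by (rule run_index[OF x K1])
    have uPJ: "u P = J mod 2" using turn_in_run[OF pos f(3) x J(1,2)] J(3) by (simp add: u_def)
    \<comment> \<open>The letter changes between \<open>P - 1\<close> and \<open>P\<close>, so a new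
      run begins at \<open>P\<close>.\<close>
    have "l = 0"
    proof (rule ccontr)
      assume "l \<noteq> 0"
      then have "u (P - 1) = J mod 2"
        using turn_in_run[OF pos f(3) x J(1), of "l - 1"] J(2,3) by (simp add: u_def)
      then show False using ne uPJ by simp
    qed
    then have PJ: "P = run_start ?x K J" using J by simp
    have KJ: "K < J" using J(1) P(1) PJ by (cases "K = J") auto
    have par: "even J = even K" using uPJ u0 P(2)[of 0]
      by (simp only: even_iff_mod_2_eq_zero add_0)
    let ?g = "(next_form ^^ P) f"
    \<comment> \<open>Only right turns expand distances strictly. One exists because both letters
      occur in the period.\<close>
    obtain k where k: "k < m" "u k = 1"
    proof -
      have "u (m - 1) = 1 \<or> u 0 = 1" using ulast by (auto simp: u_def form_turn_def)
      then show thesis using that m0 by (metis diff_less zero_less_one)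
    qed
    have "first_root f = first_root ?g"
    proof (rule periodic_turns_root_eq[OF pos posn per])
      show "(next_form ^^ m) ?g = ?g" by (metis per comp_apply funpow_add add.commute)
      show "form_turn ((next_form ^^ i) f) = form_turn ((next_form ^^ i) ?g)" for i
        using P(2)[of i] by (simp add: u_def funpow_add)
    qed (use k in \<open>auto simp: u_def\<close>)
    then have "alt_rem ?x J = alt_rem ?x K"
      using root_run_start[OF pos f(3) x J(1)] PJ f(3) by simp
    then have rem: "cf_rem ?x J = cf_rem ?x K" using par by (auto simp: alt_rem_def split: if_splits)
    have "cf_coeff ?x (n + (J - K)) = cf_coeff ?x n" if "n \<ge> s" for n
    proof -
      have "cf_coeff ?x (n + (J - K)) = cf_coeff ?x (K + (n - s) + (J - K))"
        using coeff[of "n - s + (J - K)"] that by (simp add: add_ac)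
      also have "\<dots> = cf_coeff ?x (J + (n - s))" using KJ by (simp add: add_ac)
      also have "\<dots> = cf_coeff ?x (K + (n - s))" using cf_rem_eq_coeff_eq[OF rem] .
      also have "\<dots> = cf_coeff ?x n" using coeff[of "n - s"] that by simp
      finally show ?thesis .
    qed
    then have "cf_period_from ?x s (J - K)" using KJ by (simp add: cf_period_from_def)
    moreover have "even (J - K)" using par KJ by simp
    ultimately have "p \<le> J - K" using least by blast
    then have "K + p \<le> J" using KJ by simp
    then show ?thesis unfolding PJ m_def by (rule run_start_mono)
  qed
  show thesis
  proof (rule that[OF f(1,2)])
    show "(next_form ^^ length r) f = f" by (simp add: len per)
    show "form_turn ((next_form ^^ i) f) = r ! (i mod length r)" for i
      using u_mod[of i] by (simp add: u_def len)
    show "least_period (\<lambda>i. form_turn ((next_form ^^ i) f)) (length r)"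
      using m0 um[of _ 1] min by (auto simp: least_period_def len u_def)
  qed
qed

section \<open>Walks in the cubic plane tree\<close>

locale plane_tree =
  fixes G :: "('v, 'x) plane_graph_scheme"
  assumes tree: "cubic_plane_tree G"
begin

lemma arcs_sym: "(u, v) \<in> arcs G \<longleftrightarrow> (v, u) \<in> arcs G"
  using tree by (auto simp: cubic_plane_tree_def sym_def)

lemma arc_neq: "(u, v) \<in> arcs G \<Longrightarrow> u \<noteq> v"
  using tree by (auto simp: cubic_plane_tree_def irrefl_def)

lemma simple_path_unique: "simple_path G u v xs \<Longrightarrow> simple_path G u v ys \<Longrightarrow> xs = ys"
  using tree unfolding cubic_plane_tree_def by blast

lemma simple_path_exists: "\<exists>xs. simple_path G u v xs"
  using tree unfolding cubic_plane_tree_def by blast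

text \<open>A permutation of three points without fixed points is a 3-cycle: if it exchanged two of
  them, the third would have no image left but itself.\<close>

lemma nbrs_cw:
  assumes "u \<in> nbrs G v"
  shows "nbrs G v = {u, cw G v u, cw G v (cw G v u)}"
    and "distinct [u, cw G v u, cw G v (cw G v u)]"
    and "cw G v (cw G v (cw G v u)) = u"
proof -
  let ?f = "cw G v" and ?N = "nbrs G v"
  have bij: "bij_betw ?f ?N ?N" and nofix: "\<And>w. w \<in> ?N \<Longrightarrow> ?f w \<noteq> w" and card: "card ?N = 3"
    using tree by (auto simp: cubic_plane_tree_def)
  have closed: "\<And>w. w \<in> ?N \<Longrightarrow> ?f w \<in> ?N" using bij by (auto simp: bij_betw_def)
  have inj: "\<And>w w'. w \<in> ?N \<Longrightarrow> w' \<in> ?N \<Longrightarrow> ?f w = ?f w' \<Longrightarrow> w = w'"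
    using bij by (auto simp: bij_betw_def inj_on_def)
  have fin: "finite ?N" using card card_ge_0_finite by force
  have ne: "?f (?f u) \<noteq> u"
  proof
    assume 2: "?f (?f u) = u"
    have "card {u, ?f u} \<le> 2" by (simp add: card_insert_if)
    then have "\<not> ?N \<subseteq> {u, ?f u}" using card card_mono[of "{u, ?f u}" ?N] by auto
    then obtain w where w: "w \<in> ?N" "w \<noteq> u" "w \<noteq> ?f u" by blast
    have fw: "?f w \<noteq> u" "?f w \<noteq> ?f u" "?f w \<noteq> w"
      using inj[of w "?f u"] inj[of w u] w 2 assms closed nofix by auto
    have "distinct [u, ?f u, w, ?f w]" using w fw nofix[OF assms] by (metis distinct_length_2_or_more distinct_singleton)
    then have "card (set [u, ?f u, w, ?f w]) = 4" by (simp only: distinct_card) simp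
    moreover have "set [u, ?f u, w, ?f w] \<subseteq> ?N" using assms w closed by auto
    then have "card (set [u, ?f u, w, ?f w]) \<le> card ?N" by (rule card_mono[OF fin])
    ultimately show False using card by linarith
  qed
  show dist: "distinct [u, ?f u, ?f (?f u)]" using ne nofix[OF assms] nofix[OF closed[OF assms]]
    by (metis distinct_length_2_or_more distinct_singleton)
  have "card (set [u, ?f u, ?f (?f u)]) = 3" using dist by (simp only: distinct_card) simp
  then have "card {u, ?f u, ?f (?f u)} = 3" by simp
  moreover have "{u, ?f u, ?f (?f u)} \<subseteq> ?N" using assms closed by simp
  ultimately show N: "?N = {u, ?f u, ?f (?f u)}" using card card_subset_eq[OF fin, of "{u, ?f u, ?f (?f u)}"] by simp
  have "?f (?f (?f u)) \<in> ?N" using assms closed by blast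
  moreover have "?f (?f (?f u)) \<noteq> ?f (?f u)" using nofix assms closed by blast
  moreover have "?f (?f (?f u)) \<noteq> ?f u" using inj[of "?f (?f u)" u] assms closed ne by blast
  ultimately show "?f (?f (?f u)) = u" using N by blast
qed

lemma arc_nbr: "e \<in> arcs G \<Longrightarrow> fst e \<in> nbrs G (snd e)"
  using arcs_sym[of "fst e" "snd e"] by (simp add: nbrs_def)

lemma out_arcs:
  assumes "e \<in> arcs G"
  shows "(snd e, w) \<in> arcs G \<longleftrightarrow> (snd e, w) \<in> {rev_arc e, left_arc G e, right_arc G e}"
proof -
  have "(snd e, w) \<in> arcs G \<longleftrightarrow> w \<in> nbrs G (snd e)" by (simp add: nbrs_def)
  also have "\<dots> \<longleftrightarrow> w \<in> {fst e, cw G (snd e) (fst e), cw G (snd e) (cw G (snd e) (fst e))}"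
    using nbrs_cw(1)[OF arc_nbr[OF assms]] by simp
  also have "\<dots> \<longleftrightarrow> (snd e, w) \<in> {rev_arc e, left_arc G e, right_arc G e}"
    by (cases e) (auto simp: left_arc_def right_arc_def)
  finally show ?thesis .
qed

lemma arcs_closed:
  assumes "e \<in> arcs G"
  shows "rev_arc e \<in> arcs G" "left_arc G e \<in> arcs G" "right_arc G e \<in> arcs G"
proof -
  show "rev_arc e \<in> arcs G" using assms arcs_sym by (cases e) auto
  show "left_arc G e \<in> arcs G" "right_arc G e \<in> arcs G"
    using out_arcs[OF assms] by (auto simp: left_arc_def right_arc_def)
qed

lemma arcs_neq:
  assumes "e \<in> arcs G"
  shows "snd (left_arc G e) \<noteq> snd (right_arc G e)" "snd (left_arc G e) \<noteq> fst e"
    "snd (right_arc G e) \<noteq> fst e"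
  using nbrs_cw(2)[OF arc_nbr[OF assms]] by (auto simp: left_arc_def right_arc_def)

lemma fst_left_arc [simp]: "fst (left_arc G e) = snd e" by (simp add: left_arc_def)
lemma fst_right_arc [simp]: "fst (right_arc G e) = snd e" by (simp add: right_arc_def)

lemma turn_relations:
  assumes "e \<in> arcs G"
  shows "left_arc G (rev_arc (left_arc G e)) = right_arc G e"
    "right_arc G (rev_arc (left_arc G e)) = rev_arc e"
    "left_arc G (rev_arc (right_arc G e)) = rev_arc e"
    "right_arc G (rev_arc (right_arc G e)) = left_arc G e"
  using nbrs_cw(3)[OF arc_nbr[OF assms]] by (cases e; auto simp: left_arc_def right_arc_def)+

section \<open>Words of turns as coordinates of the tree\<close>

definition turn_arc :: "bool \<Rightarrow> 'v \<times> 'v \<Rightarrow> 'v \<times> 'v" where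
  "turn_arc b e = (if b then right_arc G e else left_arc G e)"

primrec walk :: "bool list \<Rightarrow> 'v \<times> 'v \<Rightarrow> 'v \<times> 'v" where
  "walk [] e = e"
| "walk (b # w) e = walk w (turn_arc b e)"

primrec walk_verts :: "bool list \<Rightarrow> 'v \<times> 'v \<Rightarrow> 'v list" where
  "walk_verts [] e = [fst e, snd e]"
| "walk_verts (b # w) e = fst e # walk_verts w (turn_arc b e)"

lemma fst_turn_arc [simp]: "fst (turn_arc b e) = snd e" by (simp add: turn_arc_def)

lemma turn_arc_in: "e \<in> arcs G \<Longrightarrow> turn_arc b e \<in> arcs G"
  by (simp add: turn_arc_def arcs_closed)

lemma turn_arc_neq: "e \<in> arcs G \<Longrightarrow> snd (turn_arc b e) \<noteq> fst e"
  by (simp add: turn_arc_def arcs_neq)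

lemma turn_arc_inject:
  assumes "e \<in> arcs G" "snd (turn_arc b e) = snd (turn_arc b' e)" shows "b = b'"
  using arcs_neq(1)[OF assms(1)] assms(2) by (auto simp: turn_arc_def split: if_splits)

lemma walk_in: "e \<in> arcs G \<Longrightarrow> walk w e \<in> arcs G"
  by (induction w arbitrary: e) (auto simp: turn_arc_in)

lemma walk_append: "walk (w @ w') e = walk w' (walk w e)"
  by (induction w arbitrary: e) auto

lemma hd_walk_verts [simp]: "hd (walk_verts w e) = fst e" by (cases w) auto
lemma walk_verts_ne [simp]: "walk_verts w e \<noteq> []" by (cases w) auto
lemma last_walk_verts: "last (walk_verts w e) = snd (walk w e)"
  by (induction w arbitrary: e) auto

lemma length_walk_verts: "length (walk_verts w e) = length w + 2"
  by (induction w arbitrary: e) auto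

lemma walk_verts_Cons: "\<exists>xs. walk_verts w e = fst e # snd e # xs"
proof (cases w)
  case (Cons b v)
  then show ?thesis by (cases v) auto
qed auto

lemma walk_verts_successively:
  "e \<in> arcs G \<Longrightarrow> successively (\<lambda>x y. (x, y) \<in> arcs G) (walk_verts w e)"
  by (induction w arbitrary: e) (auto simp: successively_Cons turn_arc_in)

text \<open>If the walk came back to the tail of \<open>e\<close>, the part after the first step
  would be a second simple path from the head of \<open>e\<close> to its tail. By uniqueness it
  would be the edge itself, but a turn never goes back.\<close>

lemma walk_verts_distinct: "e \<in> arcs G \<Longrightarrow> distinct (walk_verts w e)"
proof (induction w arbitrary: e)
  case Nil
  then show ?case using arc_neq by (cases e) auto
next
  case (Cons b w)
  let ?e = "turn_arc b e"
  have e: "?e \<in> arcs G" using Cons.prems turn_arc_in by blast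
  have d: "distinct (walk_verts w ?e)" using Cons.IH e by blast
  have "fst e \<notin> set (walk_verts w ?e)"
  proof
    assume "fst e \<in> set (walk_verts w ?e)"
    then obtain ys zs where yz: "walk_verts w ?e = ys @ fst e # zs" using split_list by metis
    obtain xs where xs: "walk_verts w ?e = snd e # snd ?e # xs"
      using walk_verts_Cons[of w ?e] by auto
    have ne: "snd e \<noteq> fst e" using Cons.prems arc_neq by (metis prod.collapse)
    then obtain ys' where ys: "ys = snd e # ys'" using yz xs by (cases ys) auto
    have "simple_path G (snd e) (fst e) (ys @ [fst e])"
    proof -
      have "walk_verts w ?e = (ys @ [fst e]) @ zs" using yz by simp
      then have "successively (\<lambda>x y. (x, y) \<in> arcs G) (ys @ [fst e])"
        using walk_verts_successively[OF e, of w] by (metis successively_append_iff)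
      then show ?thesis using d yz ys unfolding simple_path_def by auto
    qed
    moreover have "simple_path G (snd e) (fst e) [snd e, fst e]"
      using ne Cons.prems arcs_sym by (auto simp: simple_path_def)
    ultimately have "ys @ [fst e] = [snd e, fst e]" using simple_path_unique by blast
    then have "snd ?e = fst e" using yz xs by auto
    then show False using turn_arc_neq Cons.prems by blast
  qed
  then show ?case using d by simp
qed

lemma walk_verts_path:
  "e \<in> arcs G \<Longrightarrow> simple_path G (fst e) (snd (walk w e)) (walk_verts w e)"
  by (simp add: simple_path_def walk_verts_distinct walk_verts_successively last_walk_verts)

lemma walk_verts_inject:
  assumes "e \<in> arcs G" "walk_verts w e = walk_verts w' e" shows "w = w'"
  using assms
proof (induction w arbitrary: e w')
  case Nil
  then have "length (walk_verts w' e) = 2" by (metis length_Cons list.size(3) numeral_2_eq_2 walk_verts.simps(1))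
  then show ?case using length_walk_verts[of w' e] by simp
next
  case (Cons b w)
  show ?case
  proof (cases w')
    case Nil
    then have "length (walk_verts (b # w) e) = 2" using Cons.prems(2) by simp
    then show ?thesis using length_walk_verts[of "b # w" e] by simp
  next
    case (Cons b' v)
    then have eq: "walk_verts w (turn_arc b e) = walk_verts v (turn_arc b' e)"
      using Cons.prems(2) by simp
    obtain xs where xs: "walk_verts w (turn_arc b e) = snd e # snd (turn_arc b e) # xs"
      using walk_verts_Cons[of w "turn_arc b e"] by auto
    obtain ys where ys: "walk_verts v (turn_arc b' e) = snd e # snd (turn_arc b' e) # ys"
      using walk_verts_Cons[of v "turn_arc b' e"] by auto
    have "snd (turn_arc b e) = snd (turn_arc b' e)" using eq xs ys by simp
    then have "b = b'" using turn_arc_inject Cons.prems(1) by blast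
    then show ?thesis using Cons.IH[OF turn_arc_in[OF Cons.prems(1)]] eq Cons by auto
  qed
qed

lemma walk_head_inject:
  assumes "e \<in> arcs G" "snd (walk w e) = snd (walk w' e)" shows "w = w'"
  using walk_verts_inject simple_path_unique walk_verts_path assms by metis

text \<open>A walk starting with the reversal of \<open>e\<close> continues from the tail of
  \<open>e\<close> without meeting the head of \<open>e\<close> again, whereas the forward walk runs
  through it. A common end would give two simple paths.\<close>

lemma walk_head_opposite:
  assumes e: "e \<in> arcs G" shows "snd (walk w e) \<noteq> snd (walk w' (rev_arc e))"
proof
  assume eq: "snd (walk w e) = snd (walk w' (rev_arc e))"
  have r: "rev_arc e \<in> arcs G" using e arcs_closed by blast
  obtain xs where xs: "walk_verts w' (rev_arc e) = snd e # fst e # xs"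
    using walk_verts_Cons[of w' "rev_arc e"] by auto
  have "simple_path G (fst e) (snd (walk w e)) (fst e # xs)"
    using walk_verts_path[OF r, of w'] unfolding xs eq simple_path_def
    by (auto simp: successively_Cons)
  then have "fst e # xs = walk_verts w e" using walk_verts_path[OF e] simple_path_unique by blast
  then have "snd e \<in> set (fst e # xs)" using walk_verts_Cons[of w e] by auto
  moreover have "distinct (walk_verts w' (rev_arc e))" using walk_verts_distinct r by blast
  ultimately show False by (simp add: xs)
qed

text \<open>Removing \<open>e\<close> splits the tree in two. The Boolean names the side and the
  word the way within it, so heads of side walks give each vertex exactly one coordinate, as
  \<open>bij_side_walk\<close> shows.\<close>

definition side_walk :: "'v \<times> 'v \<Rightarrow> bool \<times> bool list \<Rightarrow> 'v \<times> 'v" where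
  "side_walk e = (\<lambda>(s, w). walk w (if s then e else rev_arc e))"

lemma side_walk_in: "e \<in> arcs G \<Longrightarrow> side_walk e p \<in> arcs G"
  by (cases p) (simp add: side_walk_def walk_in arcs_closed)

lemma fst_side_walk:
  assumes "e \<in> arcs G" shows "\<exists>p. fst (side_walk e (s, w)) = snd (side_walk e p)"
proof (cases w rule: rev_cases)
  case Nil
  then have "fst (side_walk e (s, w)) = snd (side_walk e (\<not> s, []))" by (simp add: side_walk_def)
  then show ?thesis by blast
next
  case (snoc v b)
  then have "fst (side_walk e (s, w)) = snd (side_walk e (s, v))"
    by (simp add: side_walk_def walk_append)
  then show ?thesis by blast
qed

lemma snd_turn_side_walk: "snd (turn_arc b (side_walk e (s, w))) = snd (side_walk e (s, w @ [b]))"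
  by (simp add: side_walk_def walk_append)

text \<open>Surjectivity: the set of heads contains the head of \<open>e\<close> and is closed under
  passing to neighbours, and every vertex is joined to the head of \<open>e\<close> by a
  path.\<close>

lemma bij_side_walk:
  assumes e: "e \<in> arcs G" shows "bij (\<lambda>p. snd (side_walk e p))"
proof (rule bijI)
  show "inj (\<lambda>p. snd (side_walk e p))"
  proof (rule injI)
    fix p q assume eq: "snd (side_walk e p) = snd (side_walk e q)"
    obtain s w t v where pq: "p = (s, w)" "q = (t, v)" by (cases p; cases q)
    have r: "rev_arc e \<in> arcs G" using e arcs_closed by blast
    have "s = t" using eq walk_head_opposite[OF e, of w v] walk_head_opposite[OF e, of v w]
      by (auto simp: pq side_walk_def split: if_splits)
    then show "p = q" using eq walk_head_inject[OF e] walk_head_inject[OF r]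
      by (auto simp: pq side_walk_def split: if_splits)
  qed
  have step: "v \<in> range (\<lambda>p. snd (side_walk e p))"
    if uv: "(u, v) \<in> arcs G" and u: "u \<in> range (\<lambda>p. snd (side_walk e p))" for u v
  proof -
    obtain s w where sw: "u = snd (side_walk e (s, w))" using u by auto
    let ?a = "side_walk e (s, w)"
    have "(snd ?a, v) \<in> {rev_arc ?a, left_arc G ?a, right_arc G ?a}"
      using out_arcs[OF side_walk_in[OF e]] uv sw by blast
    then have "v = fst ?a \<or> v = snd (turn_arc False ?a) \<or> v = snd (turn_arc True ?a)"
      by (auto simp: prod.swap_def turn_arc_def left_arc_def right_arc_def)
    then show ?thesis
      unfolding snd_turn_side_walk using fst_side_walk[OF e, of s w] by (metis rangeI)
  qed
  have "v \<in> range (\<lambda>p. snd (side_walk e p))" for v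
  proof -
    have reach: "set xs \<subseteq> range (\<lambda>p. snd (side_walk e p))"
      if "successively (\<lambda>x y. (x, y) \<in> arcs G) xs" "xs \<noteq> []"
        "hd xs \<in> range (\<lambda>p. snd (side_walk e p))" for xs
      using that
    proof (induction xs)
      case (Cons x xs)
      show ?case
      proof (cases xs)
        case (Cons y ys)
        then have "y \<in> range (\<lambda>p. snd (side_walk e p))" using Cons.prems step[of x y] by simp
        then show ?thesis using Cons.IH Cons.prems Cons by auto
      qed (use Cons.prems in auto)
    qed simp
    obtain xs where xs: "simple_path G (snd e) v xs" using simple_path_exists by blast
    have "snd e = snd (side_walk e (True, []))" by (simp add: side_walk_def)
    then have "hd xs \<in> range (\<lambda>p. snd (side_walk e p))" using xs by (metis rangeI simple_path_def)
    then show ?thesis using reach[of xs] xs last_in_set unfolding simple_path_def by blast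
  qed
  then show "surj (\<lambda>p. snd (side_walk e p))" by blast
qed

text \<open>Apart from \<open>e\<close> and its reversal, side walks point away from
  \<open>e\<close>; an arc pointing towards it is met only in reverse.\<close>

lemma arc_side_walk:
  assumes e: "e \<in> arcs G" and a: "a \<in> arcs G"
  shows "\<exists>p. a = side_walk e p \<or> a = rev_arc (side_walk e p)"
proof -
  obtain s w where sw: "fst a = snd (side_walk e (s, w))"
    using bij_side_walk[OF e] by (metis (no_types, lifting) bij_pointE surj_pair)
  let ?b = "side_walk e (s, w)"
  have "a = (snd ?b, snd a)" using sw by (metis prod.collapse)
  then have "(snd ?b, snd a) \<in> arcs G" using a by simp
  then have "a \<in> {rev_arc ?b, left_arc G ?b, right_arc G ?b}"
    using out_arcs[OF side_walk_in[OF e], of "(s, w)" "snd a"] \<open>a = (snd ?b, snd a)\<close> by simp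
  moreover have "left_arc G ?b = side_walk e (s, w @ [False])" "right_arc G ?b = side_walk e (s, w @ [True])"
    by (simp_all add: side_walk_def walk_append turn_arc_def)
  ultimately show ?thesis by blast
qed

lemma walk_inject:
  assumes "e \<in> arcs G" "walk w e = walk w' e" shows "w = w'"
  using assms walk_head_inject by metis

text \<open>Otherwise each of the two words would be the other one with a letter appended.\<close>

lemma walk_not_rev:
  assumes e: "e \<in> arcs G" shows "walk w e \<noteq> rev_arc (walk w' e)"
proof
  assume eq: "walk w e = rev_arc (walk w' e)"
  have 1: "\<exists>b. v = v' @ [b]" if "fst (walk v e) = snd (walk v' e)" for v v'
  proof (cases v rule: rev_cases)
    case Nil
    then show ?thesis using that walk_head_opposite[OF e, of v' "[]"] by simp
  next
    case (snoc x b)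
    then have "x = v'" using that walk_head_inject[OF e] by (simp add: walk_append)
    then show ?thesis using snoc by blast
  qed
  have "\<exists>b. w = w' @ [b]" "\<exists>b. w' = w @ [b]" using 1 eq by auto
  then show False by auto
qed

lemma walk_opposite:
  assumes e: "e \<in> arcs G"
    and eq: "walk w e = walk w' (rev_arc e) \<or> walk w e = rev_arc (walk w' (rev_arc e))"
  shows "w = [] \<and> w' = []"
proof -
  have r: "walk w e = rev_arc (walk w' (rev_arc e))" using eq walk_head_opposite[OF e] by metis
  have w': "w' = []"
  proof (cases w' rule: rev_cases)
    case (snoc v b)
    then have "snd (walk w e) = snd (walk v (rev_arc e))" using r by (simp add: walk_append)
    then show ?thesis using walk_head_opposite[OF e] by blast
  qed simp
  then have "snd (walk w e) = snd (walk [] e)" using r by simp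
  then have "w = []" using walk_head_inject[OF e] by blast
  then show ?thesis using w' by simp
qed

text \<open>Retracing a left turn is a right turn, and conversely.\<close>

lemma rev_turn_arc: "e \<in> arcs G \<Longrightarrow> turn_arc (\<not> b) (rev_arc (turn_arc b e)) = rev_arc e"
  by (simp add: turn_arc_def turn_relations)

lemma rev_walk: "e \<in> arcs G \<Longrightarrow> \<exists>w'. rev_arc e = walk w' (rev_arc (walk w e))"
proof (induction w arbitrary: e)
  case Nil
  have "rev_arc e = walk [] (rev_arc (walk [] e))" by simp
  then show ?case by blast
next
  case (Cons b w)
  obtain w' where "rev_arc (turn_arc b e) = walk w' (rev_arc (walk w (turn_arc b e)))"
    using Cons turn_arc_in by blast
  then have "rev_arc e = walk (w' @ [\<not> b]) (rev_arc (walk (b # w) e))"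
    using rev_turn_arc[OF Cons.prems, of b] by (simp add: walk_append)
  then show ?case by blast
qed

end

section \<open>Isomorphisms of cubic plane trees\<close>

abbreviation arc_map :: "('v \<Rightarrow> 'w) \<Rightarrow> 'v \<times> 'v \<Rightarrow> 'w \<times> 'w" where
  "arc_map \<phi> \<equiv> map_prod \<phi> \<phi>"

lemma arc_map_rev [simp]: "arc_map \<phi> (rev_arc e) = rev_arc (arc_map \<phi> e)"
  by (cases e) simp

locale two_trees = G: plane_tree G + H: plane_tree H
  for G :: "('v, 'x) plane_graph_scheme" and H :: "('w, 'y) plane_graph_scheme"
begin

lemma plane_iso_arcs: "plane_iso G H \<phi> \<Longrightarrow> arc_map \<phi> e \<in> arcs H \<longleftrightarrow> e \<in> arcs G"
  by (cases e) (auto simp: plane_iso_def)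

lemma plane_iso_inj: "plane_iso G H \<phi> \<Longrightarrow> arc_map \<phi> e = arc_map \<phi> e' \<longleftrightarrow> e = e'"
  by (cases e; cases e') (auto simp: plane_iso_def bij_def inj_def)

lemma plane_iso_turns:
  assumes "plane_iso G H \<phi>" "e \<in> arcs G"
  shows "arc_map \<phi> (left_arc G e) = left_arc H (arc_map \<phi> e)"
    and "arc_map \<phi> (right_arc G e) = right_arc H (arc_map \<phi> e)"
proof -
  have 1: "fst e \<in> nbrs G (snd e)" using G.arc_nbr assms(2) by blast
  then have 2: "cw G (snd e) (fst e) \<in> nbrs G (snd e)" using G.nbrs_cw(1) by blast
  have c: "\<And>u v. u \<in> nbrs G v \<Longrightarrow> \<phi> (cw G v u) = cw H (\<phi> v) (\<phi> u)"
    using assms(1) by (auto simp: plane_iso_def)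
  show "arc_map \<phi> (left_arc G e) = left_arc H (arc_map \<phi> e)"
    using c[OF 1] by (simp add: left_arc_def)
  show "arc_map \<phi> (right_arc G e) = right_arc H (arc_map \<phi> e)"
    using c[OF 1] c[OF 2] by (simp add: right_arc_def)
qed

lemma plane_iso_turn_arc:
  "plane_iso G H \<phi> \<Longrightarrow> e \<in> arcs G \<Longrightarrow> arc_map \<phi> (G.turn_arc b e) = H.turn_arc b (arc_map \<phi> e)"
  by (simp add: G.turn_arc_def H.turn_arc_def plane_iso_turns)

lemma plane_iso_walk:
  "plane_iso G H \<phi> \<Longrightarrow> e \<in> arcs G \<Longrightarrow> arc_map \<phi> (G.walk w e) = H.walk w (arc_map \<phi> e)"
  by (induction w arbitrary: e) (auto simp: plane_iso_turn_arc G.turn_arc_in)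

lemma plane_iso_side_walk:
  assumes "plane_iso G H \<phi>" "e \<in> arcs G"
  shows "arc_map \<phi> (G.side_walk e p) = H.side_walk (arc_map \<phi> e) p"
  using assms plane_iso_walk G.arcs_closed
  by (cases p) (auto simp: G.side_walk_def H.side_walk_def)

text \<open>One incoming arc per vertex is enough: its reversal and its two turns are all arcs
  leaving the vertex, and they fix the cyclic order there.\<close>

lemma plane_isoI:
  assumes bij: "bij \<phi>" and heads: "\<And>v. \<exists>a\<in>A. snd a = v"
    and A: "\<And>a. a \<in> A \<Longrightarrow> a \<in> arcs G" "\<And>a. a \<in> A \<Longrightarrow> arc_map \<phi> a \<in> arcs H"
    and turns: "\<And>a. a \<in> A \<Longrightarrow> arc_map \<phi> (left_arc G a) = left_arc H (arc_map \<phi> a)"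
      "\<And>a. a \<in> A \<Longrightarrow> arc_map \<phi> (right_arc G a) = right_arc H (arc_map \<phi> a)"
  shows "plane_iso G H \<phi>"
  unfolding plane_iso_def
proof (intro conjI allI ballI)
  have inj: "arc_map \<phi> e = arc_map \<phi> e' \<longleftrightarrow> e = e'" for e e'
    using bij by (cases e; cases e') (auto simp: bij_def inj_def)
  show "bij \<phi>" by fact
  fix u v
  obtain a where a: "a \<in> A" "snd a = u" using heads by blast
  have "(u, v) \<in> arcs G \<longleftrightarrow> (u, v) \<in> {rev_arc a, left_arc G a, right_arc G a}"
    using G.out_arcs[OF A(1)[OF a(1)], of v] a(2) by simp
  also have "\<dots> \<longleftrightarrow> arc_map \<phi> (u, v) \<in> {arc_map \<phi> (rev_arc a), arc_map \<phi> (left_arc G a), arc_map \<phi> (right_arc G a)}"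
    by (simp only: inj insert_iff empty_iff)
  also have "\<dots> \<longleftrightarrow> (\<phi> u, \<phi> v) \<in> {rev_arc (arc_map \<phi> a), left_arc H (arc_map \<phi> a), right_arc H (arc_map \<phi> a)}"
    using turns[OF a(1)] by simp
  also have "\<dots> \<longleftrightarrow> (\<phi> u, \<phi> v) \<in> arcs H"
    using H.out_arcs[OF A(2)[OF a(1)], of "\<phi> v"] a(2) by simp
  finally show "(u, v) \<in> arcs G \<longleftrightarrow> (\<phi> u, \<phi> v) \<in> arcs H" .
next
  fix v u assume u: "u \<in> nbrs G v"
  obtain a where a: "a \<in> A" "snd a = v" using heads by blast
  let ?c = "cw G v" and ?d = "cw H (\<phi> v)" and ?u = "fst a"
  have 1: "\<phi> (?c ?u) = ?d (\<phi> ?u)" using turns(1)[OF a(1)] a(2) by (simp add: left_arc_def)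
  have 2: "\<phi> (?c (?c ?u)) = ?d (?d (\<phi> ?u))" using turns(2)[OF a(1)] a(2) by (simp add: right_arc_def)
  have n: "?u \<in> nbrs G v" using G.arc_nbr A(1) a by blast
  have n': "\<phi> ?u \<in> nbrs H (\<phi> v)" using H.arc_nbr[OF A(2)[OF a(1)]] a(2) by simp
  have "u \<in> {?u, ?c ?u, ?c (?c ?u)}" using G.nbrs_cw(1)[OF n] u by blast
  then show "\<phi> (cw G v u) = cw H (\<phi> v) (\<phi> u)"
    using 1 2 G.nbrs_cw(3)[OF n] H.nbrs_cw(3)[OF n'] by auto
qed

text \<open>Vertices with the same coordinates with respect to \<open>e\<close> and
  \<open>e'\<close> are matched. Appending a letter to the word is the same operation on both sides,
  so turns are respected.\<close>

lemma plane_iso_exists: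
  assumes e: "e \<in> arcs G" and e': "e' \<in> arcs H"
  shows "\<exists>\<phi>. plane_iso G H \<phi> \<and> arc_map \<phi> e = e'"
proof -
  let ?g = "\<lambda>p. snd (G.side_walk e p)" and ?h = "\<lambda>p. snd (H.side_walk e' p)"
  have bg: "bij ?g" and bh: "bij ?h" using G.bij_side_walk H.bij_side_walk e e' by auto
  define \<phi> where "\<phi> = ?h \<circ> inv ?g"
  have \<phi>: "\<phi> (snd (G.side_walk e p)) = snd (H.side_walk e' p)" for p
    using inv_f_f[OF bij_is_inj[OF bg], of p] by (simp add: \<phi>_def)
  have map: "arc_map \<phi> (G.side_walk e (s, w)) = H.side_walk e' (s, w)" for s w
  proof (cases w rule: rev_cases)
    case Nil
    \<comment> \<open>For the empty word the tail lies on the other side of \<open>e\<close>, where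
      it is the head of the empty walk.\<close>
    have "fst (G.side_walk e (s, w)) = snd (G.side_walk e (\<not> s, []))"
      "fst (H.side_walk e' (s, w)) = snd (H.side_walk e' (\<not> s, []))"
      by (simp_all add: Nil G.side_walk_def H.side_walk_def)
    then show ?thesis by (intro prod_eqI) (simp_all add: \<phi>)
  next
    case (snoc v b)
    have "fst (G.side_walk e (s, w)) = snd (G.side_walk e (s, v))"
      "fst (H.side_walk e' (s, w)) = snd (H.side_walk e' (s, v))"
      by (simp_all add: snoc G.side_walk_def H.side_walk_def G.walk_append H.walk_append)
    then show ?thesis by (intro prod_eqI) (simp_all add: \<phi>)
  qed
  have "plane_iso G H \<phi>"
  proof (rule plane_isoI[where A = "range (G.side_walk e)"])
    show "bij \<phi>" unfolding \<phi>_def using bg bh bij_comp bij_imp_bij_inv by blast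
    show "\<exists>a\<in>range (G.side_walk e). snd a = v" for v using bg by (metis bij_pointE rangeI)
    fix a assume "a \<in> range (G.side_walk e)"
    then obtain s w where a: "a = G.side_walk e (s, w)" by auto
    show "a \<in> arcs G" using a e G.side_walk_in by blast
    show "arc_map \<phi> a \<in> arcs H" unfolding a map using e' H.side_walk_in by blast
    have step: "G.turn_arc b a = G.side_walk e (s, w @ [b])"
      "H.turn_arc b (arc_map \<phi> a) = H.side_walk e' (s, w @ [b])" for b
      unfolding a map by (simp_all add: G.side_walk_def H.side_walk_def G.walk_append H.walk_append)
    show "arc_map \<phi> (left_arc G a) = left_arc H (arc_map \<phi> a)"
      using step[of False] map[of s "w @ [False]"] by (simp add: G.turn_arc_def H.turn_arc_def)
    show "arc_map \<phi> (right_arc G a) = right_arc H (arc_map \<phi> a)"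
      using step[of True] map[of s "w @ [True]"] by (simp add: G.turn_arc_def H.turn_arc_def)
  qed
  moreover have "arc_map \<phi> e = e'" using map[of True "[]"] by (simp add: G.side_walk_def H.side_walk_def)
  ultimately show ?thesis by blast
qed

lemma plane_iso_unique:
  assumes "plane_iso G H \<phi>" "plane_iso G H \<psi>" "e \<in> arcs G" "arc_map \<phi> e = arc_map \<psi> e"
  shows "\<phi> = \<psi>"
proof
  fix v
  obtain p where v: "v = snd (G.side_walk e p)"
    using G.bij_side_walk[OF assms(3)] by (metis bij_pointE)
  have "arc_map \<phi> (G.side_walk e p) = arc_map \<psi> (G.side_walk e p)"
    using plane_iso_side_walk assms by metis
  then show "\<phi> v = \<psi> v" unfolding v by (metis snd_map_prod)
qed

end

lemma plane_iso_comp: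
  assumes "plane_iso G H \<phi>" "plane_iso H K \<psi>" shows "plane_iso G K (\<psi> \<circ> \<phi>)"
  unfolding plane_iso_def
proof (intro conjI allI ballI)
  show "bij (\<psi> \<circ> \<phi>)" using assms by (simp add: plane_iso_def bij_comp)
  show "(u, v) \<in> arcs G \<longleftrightarrow> ((\<psi> \<circ> \<phi>) u, (\<psi> \<circ> \<phi>) v) \<in> arcs K" for u v
    using assms by (simp add: plane_iso_def)
  fix v u assume u: "u \<in> nbrs G v"
  then have "\<phi> u \<in> nbrs H (\<phi> v)" using assms(1) by (simp add: plane_iso_def nbrs_def)
  then show "(\<psi> \<circ> \<phi>) (cw G v u) = cw K ((\<psi> \<circ> \<phi>) v) ((\<psi> \<circ> \<phi>) u)"
    using assms u by (simp add: plane_iso_def)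
qed

lemma plane_iso_inv:
  assumes "plane_iso G H \<phi>" shows "plane_iso H G (inv \<phi>)"
  unfolding plane_iso_def
proof (intro conjI allI ballI)
  have bij: "bij \<phi>" using assms by (simp add: plane_iso_def)
  have f: "\<phi> (inv \<phi> v) = v" for v using bij by (simp add: bij_is_surj surj_f_inv_f)
  show "bij (inv \<phi>)" using bij bij_imp_bij_inv by blast
  show "(u, v) \<in> arcs H \<longleftrightarrow> (inv \<phi> u, inv \<phi> v) \<in> arcs G" for u v
    using assms f[of u] f[of v] unfolding plane_iso_def by metis
  fix v u assume u: "u \<in> nbrs H v"
  then have "inv \<phi> u \<in> nbrs G (inv \<phi> v)"
    using assms f[of u] f[of v] unfolding plane_iso_def nbrs_def by (metis mem_Collect_eq)
  then have "\<phi> (cw G (inv \<phi> v) (inv \<phi> u)) = cw H v u"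
    using assms f[of u] f[of v] unfolding plane_iso_def by metis
  then show "inv \<phi> (cw H v u) = cw G (inv \<phi> v) (inv \<phi> u)"
    using bij by (metis bij_is_inj inv_f_f)
qed

section \<open>The river\<close>

text \<open>This is not definiteness of the quadratic form but the condition of Conway's climbing
  lemma: three coefficients of one sign. Both turns preserve it, so a walk that has left the river
  never meets it again.\<close>

definition definite :: "bqf \<Rightarrow> bool" where
  "definite f \<longleftrightarrow> cA f > 0 \<and> cB f > 0 \<and> cC f > 0 \<or> cA f < 0 \<and> cB f < 0 \<and> cC f < 0"

lemma definite_moves: "definite f \<Longrightarrow> definite (left_form f)" "definite f \<Longrightarrow> definite (right_form f)"
  by (auto simp: definite_def)

locale river_tree = plane_tree T for T :: "'v topograph" +
  fixes q :: bqf and r :: "nat list"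
  assumes q_indef: "indef q" and topo: "topograph_of T q" and seq: "cf_river_sequence q r"
begin

abbreviation ds :: "'v \<times> 'v \<Rightarrow> 'v \<times> 'v" where
  "ds \<equiv> downstream T"

lemma form_turns:
  assumes "e \<in> arcs T"
  shows form_left: "form T (left_arc T e) = left_form (form T e)"
    and form_rev: "form T (rev_arc e) = rev_form (form T e)"
    and form_right: "form T (right_arc T e) = right_form (form T e)"
proof -
  have l: "form T (left_arc T e) = left_form (form T e)" if "e \<in> arcs T" for e
    using topo that by (simp add: topograph_of_def act_T_mat)
  have v: "form T (rev_arc e) = rev_form (form T e)" if "e \<in> arcs T" for e
    using topo that by (simp add: topograph_of_def act_S_mat)
  show "form T (left_arc T e) = left_form (form T e)" "form T (rev_arc e) = rev_form (form T e)"
    using l v assms by auto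
  have "form T (left_arc T (rev_arc (left_arc T e))) = right_form (form T e)"
    using assms by (simp add: l v arcs_closed left_rev_left_form)
  then show "form T (right_arc T e) = right_form (form T e)" by (simp add: turn_relations assms)
qed

lemma orbit_realized: "f \<in> orbit q \<Longrightarrow> \<exists>e\<in>arcs T. form T e = f"
proof (induction rule: orbit.induct)
  case base
  then show ?case using topo by (auto simp: topograph_of_def)
qed (metis arcs_closed form_left form_rev)+

lemma form_walk_invariant:
  assumes "e \<in> arcs T" "P (form T e)"
    and "\<And>f. P f \<Longrightarrow> P (left_form f)" "\<And>f. P f \<Longrightarrow> P (right_form f)"
  shows "P (form T (walk w e))"
  using assms(1,2)
proof (induction w arbitrary: e)
  case (Cons b w)
  show ?case using Cons.IH[of "turn_arc b e"] Cons.prems assms(3,4)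
    by (simp add: turn_arc_def arcs_closed form_turns split: if_splits)
qed simp

lemma form_indef:
  assumes "e \<in> arcs T" shows "indef (form T e)"
proof -
  obtain e\<^sub>0 where e0: "e\<^sub>0 \<in> arcs T" "form T e\<^sub>0 = q" using topo by (auto simp: topograph_of_def)
  have "indef (form T (side_walk e\<^sub>0 p))" for p
    using e0 q_indef form_walk_invariant[where P = indef] arcs_closed
    by (cases p) (auto simp: side_walk_def form_rev)
  then show ?thesis using arc_side_walk[OF e0(1) assms] side_walk_in[OF e0(1)]
    by (auto simp: form_rev)
qed

lemma flow_iff: "e \<in> flow T \<longleftrightarrow> e \<in> arcs T \<and> flow_form (form T e)"
  using form_indef[of e] by (auto simp: flow_def river_def flow_form_def mult_less_0_iff)

lemma flow_arcs: "e \<in> flow T \<Longrightarrow> e \<in> arcs T"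
  by (simp add: flow_iff)

lemma rev_flow_iff: "rev_arc e \<in> flow T \<longleftrightarrow> e \<in> arcs T \<and> cA (form T e) < 0 \<and> cC (form T e) > 0"
proof -
  have "rev_arc e \<in> arcs T \<longleftrightarrow> e \<in> arcs T" using arcs_closed(1)[of e] arcs_closed(1)[of "rev_arc e"] by auto
  then show ?thesis using form_indef[of e] by (auto simp: flow_iff flow_form_def form_rev)
qed

lemma river_iff: "e \<in> river T \<longleftrightarrow> e \<in> flow T \<or> rev_arc e \<in> flow T"
  unfolding rev_flow_iff unfolding flow_iff using form_indef[of e]
  by (auto simp: river_def flow_form_def mult_less_0_iff)

lemma flow_not_rev: "e \<in> flow T \<Longrightarrow> rev_arc e \<notin> flow T"
  using rev_flow_iff[of e] flow_iff[of e] by (auto simp: flow_form_def)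

lemma form_nonzero: "e \<in> arcs T \<Longrightarrow> cA (form T e) \<noteq> 0" "e \<in> arcs T \<Longrightarrow> cC (form T e) \<noteq> 0"
  using form_indef indef_nonzero by blast+

text \<open>Ahead of the edge lies the region with number A + B + C, between the positive region A
  and the negative region C. Its sign decides which of the two branches separates different signs;
  on the other branch all coefficients have one sign.\<close>

lemma flow_step:
  assumes e: "e \<in> flow T"
  shows river_turn_form: "river_turn T e = form_turn (form T e)"
    and form_ds: "form T (ds e) = next_form (form T e)"
    and ds_flow: "ds e \<in> flow T"
    and ds_turn: "ds e = turn_arc (river_turn T e = 1) e"
    and left_off_river: "left_arc T e \<in> river T \<or> left_arc T e \<in> flow T \<longleftrightarrow> river_turn T e = 0"
    and right_off_river: "right_arc T e \<in> river T \<or> right_arc T e \<in> flow T \<longleftrightarrow> river_turn T e \<noteq> 0"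
    and off_river_definite: "turn_arc b e \<noteq> ds e \<Longrightarrow> definite (form T (turn_arc b e))"
proof -
  let ?f = "form T e"
  have a: "e \<in> arcs T" and f: "flow_form ?f" using e by (auto simp: flow_iff)
  have f': "cA ?f > 0" "cC ?f < 0" using f by (auto simp: flow_form_def)
  have root: "first_root ?f > 1 \<longleftrightarrow> cA ?f + cB ?f + cC ?f < 0" using flow_form_root_gt_1[OF f] .
  have nz: "cA ?f + cB ?f + cC ?f \<noteq> 0"
    using form_nonzero(2)[of "left_arc T e"] a by (simp add: arcs_closed form_left)
  have L: "left_arc T e \<in> flow T \<longleftrightarrow> first_root ?f > 1"
    using a f by (auto simp: flow_iff arcs_closed form_left root flow_form_def)
  have R: "right_arc T e \<in> flow T \<longleftrightarrow> \<not> first_root ?f > 1"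
    using a f nz by (auto simp: flow_iff arcs_closed form_right root flow_form_def)
  have L': "rev_arc (left_arc T e) \<notin> flow T" and R': "rev_arc (right_arc T e) \<notin> flow T"
    using a f' unfolding rev_flow_iff by (auto simp: form_left form_right)
  show t: "river_turn T e = form_turn ?f" using L by (simp add: river_turn_def form_turn_def)
  show "form T (ds e) = next_form ?f"
    using L a by (simp add: downstream_def next_form_def form_left form_right)
  show "ds e \<in> flow T" using L R by (simp add: downstream_def)
  show d: "ds e = turn_arc (river_turn T e = 1) e"
    using L t by (simp add: downstream_def turn_arc_def form_turn_def)
  show "left_arc T e \<in> river T \<or> left_arc T e \<in> flow T \<longleftrightarrow> river_turn T e = 0"
    using L L' t by (auto simp: river_iff form_turn_def)
  show "right_arc T e \<in> river T \<or> right_arc T e \<in> flow T \<longleftrightarrow> river_turn T e \<noteq> 0"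
    using R R' t by (auto simp: river_iff form_turn_def)
  show "definite (form T (turn_arc b e))" if "turn_arc b e \<noteq> ds e"
    using that f' a nz root unfolding d t
    by (cases b) (auto simp: turn_arc_def form_turn_def definite_def form_left form_right split: if_splits)
qed

lemma river_turn_cases: "river_turn T e = 0 \<or> river_turn T e = 1"
  by (simp add: river_turn_def)

lemma ds_iter_flow: "e \<in> flow T \<Longrightarrow> (ds ^^ n) e \<in> flow T"
  by (induction n) (auto intro: ds_flow)

lemma form_ds_iter: "e \<in> flow T \<Longrightarrow> form T ((ds ^^ n) e) = (next_form ^^ n) (form T e)"
  by (induction n) (auto simp: form_ds ds_iter_flow)

lemma turn_ds_iter: "e \<in> flow T \<Longrightarrow> river_turn T ((ds ^^ n) e) = form_turn ((next_form ^^ n) (form T e))"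
  by (simp add: river_turn_form ds_iter_flow form_ds_iter)

lemma ds_left: "river_turn T e = 0 \<Longrightarrow> ds e = left_arc T e"
  by (auto simp: river_turn_def downstream_def split: if_splits)

lemma ds_right: "river_turn T e = 1 \<Longrightarrow> ds e = right_arc T e"
  by (auto simp: river_turn_def downstream_def split: if_splits)

lemma fst_ds [simp]: "fst (ds e) = snd e"
  by (simp add: downstream_def)

lemma flow_next_unique:
  assumes a: "a \<in> flow T" and b: "b \<in> flow T" and eq: "fst b = snd a"
  shows "b = ds a"
proof -
  have "b = (snd a, snd b)" using eq by (metis prod.collapse)
  then have "b \<in> {rev_arc a, left_arc T a, right_arc T a}"
    using out_arcs[OF flow_arcs[OF a], of "snd b"] flow_arcs[OF b] by auto
  then consider "b = rev_arc a" | "b = left_arc T a" | "b = right_arc T a" by blast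
  then show ?thesis
  proof cases
    case 1
    then show ?thesis using flow_not_rev[OF a] b by simp
  next
    case 2
    then show ?thesis using left_off_river[OF a] b ds_left by simp
  next
    case 3
    then show ?thesis using right_off_river[OF a] b ds_right river_turn_cases[of a] by simp
  qed
qed

text \<open>The reversal of \<open>b\<close> would otherwise be a branch at the head of
  \<open>a\<close>, but the left branch keeps the positive A and the right one the negative C, while
  a reversed flow arc has A < 0 < C.\<close>

lemma flow_prev_unique:
  assumes a: "a \<in> flow T" and b: "b \<in> flow T" and eq: "snd a = snd b"
  shows "a = b"
proof -
  have r: "rev_arc b \<in> arcs T" using flow_arcs b arcs_closed by blast
  have "rev_arc b = (snd a, fst b)" using eq by (metis prod.swap_def)
  then have "rev_arc b \<in> {rev_arc a, left_arc T a, right_arc T a}"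
    using out_arcs[OF flow_arcs[OF a], of "fst b"] r by simp
  moreover have "cA (form T (rev_arc b)) < 0 \<and> cC (form T (rev_arc b)) > 0"
    using b rev_flow_iff[of "rev_arc b"] by simp
  moreover have "cA (form T (left_arc T a)) > 0" "cC (form T (right_arc T a)) < 0"
    using a by (auto simp: flow_iff flow_form_def form_left form_right)
  ultimately have "rev_arc b = rev_arc a" by auto
  then show ?thesis by (metis prod.swap_def prod.collapse prod.inject)
qed

lemma ds_inject: "a \<in> flow T \<Longrightarrow> b \<in> flow T \<Longrightarrow> ds a = ds b \<Longrightarrow> a = b"
  using flow_prev_unique fst_ds by metis

lemma ds_iter_inject:
  assumes "a \<in> flow T" "b \<in> flow T" "(ds ^^ n) a = (ds ^^ n) b" shows "a = b"
  using assms(3)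
proof (induction n)
  case (Suc n)
  then show ?case using ds_inject[OF ds_iter_flow[OF assms(1)] ds_iter_flow[OF assms(2)], of n n] by simp
qed simp

text \<open>The mirror image of the situation ahead: the sign of the number A - B + C in the region
  behind the edge tells from which branch the river comes.\<close>

lemma upstream_exists:
  assumes e: "e \<in> flow T"
  obtains a b where "a \<in> flow T" "ds a = e" "turn_arc b (rev_arc e) = rev_arc a"
    "definite (form T (turn_arc (\<not> b) (rev_arc e)))"
proof -
  let ?f = "form T e"
  have ar: "e \<in> arcs T" "rev_arc e \<in> arcs T" using flow_arcs e arcs_closed by auto
  have f': "cA ?f > 0" "cC ?f < 0" using e by (auto simp: flow_iff flow_form_def)
  have nz: "cA ?f - cB ?f + cC ?f \<noteq> 0"
    using form_nonzero(2)[of "left_arc T (rev_arc e)"] ar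
    by (simp add: arcs_closed form_left form_rev)
  define b where "b \<longleftrightarrow> cA ?f - cB ?f + cC ?f < 0"
  define a where "a = rev_arc (turn_arc b (rev_arc e))"
  have "rev_arc a \<in> arcs T" using turn_arc_in[OF ar(2)] by (simp add: a_def)
  then have "a \<in> flow T"
    using rev_flow_iff[of "rev_arc a"] f' nz ar
    by (auto simp: a_def turn_arc_def b_def form_left form_right form_rev)
  moreover have "snd a = fst e" by (simp add: a_def)
  ultimately have "ds a = e" using flow_next_unique e by metis
  moreover have "definite (form T (turn_arc (\<not> b) (rev_arc e)))"
    using f' nz ar by (auto simp: turn_arc_def b_def form_left form_right form_rev definite_def)
  moreover have "turn_arc b (rev_arc e) = rev_arc a" by (simp add: a_def)
  ultimately show thesis using that \<open>a \<in> flow T\<close> by blast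
qed

lemma definite_walk_off_river:
  assumes "e \<in> arcs T" "definite (form T e)" shows "walk w e \<notin> river T"
proof -
  have "definite (form T (walk w e))"
    using form_walk_invariant[where P = definite] assms definite_moves by blast
  then show ?thesis by (auto simp: river_def definite_def mult_less_0_iff)
qed

lemma walk_river_downstream:
  assumes "e \<in> flow T" "walk w e \<in> river T"
  shows "walk w e = (ds ^^ length w) e"
  using assms
proof (induction w arbitrary: e)
  case (Cons b w)
  have "turn_arc b e = ds e"
  proof (rule ccontr)
    assume "turn_arc b e \<noteq> ds e"
    then have "definite (form T (turn_arc b e))" using off_river_definite Cons.prems by blast
    then show False using definite_walk_off_river[of "turn_arc b e" w] Cons.prems
      by (simp add: turn_arc_in flow_arcs)
  qed
  then show ?case using Cons.IH[OF ds_flow[OF Cons.prems(1)]] Cons.prems(2)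
    by (simp add: funpow_swap1)
qed simp

lemma walk_river_upstream:
  assumes "e \<in> flow T" "walk w (rev_arc e) \<in> river T"
  shows "\<exists>f\<in>flow T. walk w (rev_arc e) = rev_arc f \<and> e = (ds ^^ length w) f"
  using assms
proof (induction w arbitrary: e)
  case (Cons b w)
  obtain a c where a: "a \<in> flow T" "ds a = e" "turn_arc c (rev_arc e) = rev_arc a"
    "definite (form T (turn_arc (\<not> c) (rev_arc e)))"
    using upstream_exists[OF Cons.prems(1)] by blast
  have ar: "rev_arc e \<in> arcs T" using flow_arcs[OF Cons.prems(1)] arcs_closed by blast
  have "b = c"
  proof (rule ccontr)
    assume "b \<noteq> c"
    then have "b = (\<not> c)" by blast
    then show False
      using definite_walk_off_river[of "turn_arc (\<not> c) (rev_arc e)" w] a(4) Cons.prems(2)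
      by (simp add: turn_arc_in[OF ar])
  qed
  then obtain f where "f \<in> flow T" "walk w (rev_arc a) = rev_arc f" "a = (ds ^^ length w) f"
    using Cons.IH[OF a(1)] Cons.prems(2) a(3) by auto
  then show ?case using a \<open>b = c\<close> by auto
qed auto

text \<open>The river is a single path: each flow arc lies ahead of \<open>e\<close> or behind it,
  and on either side a walk that leaves the river does not return to it.\<close>

lemma flow_connected:
  assumes e: "e \<in> flow T" and f: "f \<in> flow T"
  shows "\<exists>n. f = (ds ^^ n) e \<or> e = (ds ^^ n) f"
proof -
  have riv: "f \<in> river T" "rev_arc f \<in> river T" using f by (auto simp: river_iff)
  obtain s w where sw: "f = side_walk e (s, w) \<or> rev_arc f = side_walk e (s, w)"
    using arc_side_walk[OF flow_arcs[OF e] flow_arcs[OF f]] by (metis swap_swap surj_pair)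
  show ?thesis
  proof (cases s)
    case True
    then have "f = walk w e \<or> rev_arc f = walk w e" using sw by (simp add: side_walk_def)
    then show ?thesis
    proof
      assume "f = walk w e"
      then show ?thesis using walk_river_downstream[OF e] riv by metis
    next
      assume "rev_arc f = walk w e"
      then have "rev_arc f \<in> flow T" using walk_river_downstream[OF e] riv ds_iter_flow[OF e] by metis
      then show ?thesis using flow_not_rev f by blast
    qed
  next
    case False
    then have "f = walk w (rev_arc e) \<or> rev_arc f = walk w (rev_arc e)" using sw by (simp add: side_walk_def)
    then obtain g where g: "g \<in> flow T" "rev_arc g = f \<or> rev_arc g = rev_arc f" "e = (ds ^^ length w) g"
      using walk_river_upstream[OF e] riv by metis
    have "rev_arc g \<noteq> f" using flow_not_rev g(1) f by blast
    then have "g = f" using g(2) by (metis swap_swap)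
    then show ?thesis using g(3) by blast
  qed
qed

section \<open>Positions along the river\<close>

definition flow_word :: "'v \<times> 'v \<Rightarrow> nat \<Rightarrow> bool list" where
  "flow_word e n = map (\<lambda>i. river_turn T ((ds ^^ i) e) = 1) [0..<n]"

lemma walk_flow_word: "e \<in> flow T \<Longrightarrow> walk (flow_word e n) e = (ds ^^ n) e"
  by (induction n) (simp_all add: flow_word_def walk_append ds_turn[OF ds_iter_flow])

abbreviation period :: nat where
  "period \<equiv> length r"

text \<open>The position is read off from the future turns and not from the distance to a base arc.
  It is therefore invariant under automorphisms preserving forms; it is unique because
  \<open>r\<close> has no smaller rotation period.\<close>

definition river_pos :: "'v \<times> 'v \<Rightarrow> nat \<Rightarrow> bool" where
  "river_pos e i \<longleftrightarrow> i < period \<and> (\<forall>k. river_turn T ((ds ^^ k) e) = r ! ((i + k) mod period))"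

lemma base_exists:
  obtains b where "b \<in> flow T" "river_pos b 0" "(next_form ^^ period) (form T b) = form T b"
    "least_period (\<lambda>i. river_turn T ((ds ^^ i) b)) period"
proof -
  obtain f where f: "f \<in> orbit q" "flow_form f" "(next_form ^^ period) f = f"
    "\<And>i. form_turn ((next_form ^^ i) f) = r ! (i mod period)"
    "least_period (\<lambda>i. form_turn ((next_form ^^ i) f)) period"
    using cf_river_sequence_flow[OF q_indef seq] by metis
  obtain b where b: "b \<in> arcs T" "form T b = f" using orbit_realized f(1) by blast
  have bf: "b \<in> flow T" using b f by (simp add: flow_iff)
  show thesis
  proof (rule that[OF bf])
    show "river_pos b 0" using f(4,5) b by (simp add: river_pos_def turn_ds_iter[OF bf] least_period_def)
  qed (use f b in \<open>simp_all add: turn_ds_iter[OF bf]\<close>)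
qed

lemma period_pos: "period > 0"
  by (rule base_exists) (simp add: river_pos_def)

text \<open>Otherwise \<open>n mod period\<close> would be a positive period of the turns below the
  least one.\<close>

lemma cyclic_period_dvd:
  assumes "\<And>k. r ! ((k + n) mod period) = r ! (k mod period)" shows "period dvd n"
proof -
  obtain b where b: "b \<in> flow T" "river_pos b 0" "least_period (\<lambda>i. river_turn T ((ds ^^ i) b)) period"
    using base_exists by metis
  have "river_turn T ((ds ^^ (i + n mod period)) b) = river_turn T ((ds ^^ i) b)" for i
    using b(2) assms[of i] by (simp add: river_pos_def mod_add_right_eq)
  then have "n mod period = 0"
    using b(3) period_pos unfolding least_period_def by (metis gr0I mod_less_divisor not_less)
  then show ?thesis by blast
qed

text \<open>The forms on the base arc repeat. Downstream this is inherited because iterates commute,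
  upstream because \<open>next_form\<close> is injective on flow forms.\<close>

lemma form_period:
  assumes e: "e \<in> flow T" shows "(next_form ^^ period) (form T e) = form T e"
proof -
  obtain b where b: "b \<in> flow T" "(next_form ^^ period) (form T b) = form T b" using base_exists by metis
  have comm: "(next_form ^^ n) ((next_form ^^ k) f) = (next_form ^^ k) ((next_form ^^ n) f)" for n k f
    by (metis add.commute comp_apply funpow_add)
  obtain n where "e = (ds ^^ n) b \<or> b = (ds ^^ n) e" using flow_connected[OF b(1) e] by blast
  then show ?thesis
  proof
    assume "e = (ds ^^ n) b"
    then show ?thesis using b form_ds_iter comm by metis
  next
    assume "b = (ds ^^ n) e"
    then have "(next_form ^^ n) ((next_form ^^ period) (form T e)) = (next_form ^^ n) (form T e)"
      using b form_ds_iter[OF e] comm by metis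
    then show ?thesis using next_iter_inject flow_form_next_iter e unfolding flow_iff by metis
  qed
qed

lemma form_period_mult:
  assumes e: "e \<in> flow T" shows "(next_form ^^ (period * c)) (form T e) = form T e"
  by (induction c) (simp_all add: funpow_add form_period[OF e])

lemma turn_period_mult:
  assumes e: "e \<in> flow T"
  shows "river_turn T ((ds ^^ (k + period * c)) e) = river_turn T ((ds ^^ k) e)"
  unfolding turn_ds_iter[OF e] by (simp add: funpow_add form_period_mult[OF e])

lemma pos_exists:
  assumes e: "e \<in> flow T" shows "\<exists>i. river_pos e i"
proof -
  obtain b where b: "b \<in> flow T" "river_pos b 0" using base_exists by metis
  have turn_b: "river_turn T ((ds ^^ k) b) = r ! (k mod period)" for k using b(2) by (simp add: river_pos_def)
  obtain n where "e = (ds ^^ n) b \<or> b = (ds ^^ n) e" using flow_connected[OF b(1) e] by blast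
  then show ?thesis
  proof
    assume n: "e = (ds ^^ n) b"
    have "river_turn T ((ds ^^ k) e) = r ! ((n mod period + k) mod period)" for k
      using turn_b[of "k + n"] unfolding n by (simp add: funpow_add mod_simps add.commute)
    then show ?thesis using period_pos by (auto simp: river_pos_def intro!: exI[of _ "n mod period"])
  next
    assume n: "b = (ds ^^ n) e"
    \<comment> \<open>A nonnegative representative of -n modulo the period, since \<open>e\<close>
      lies n steps before the base arc.\<close>
    let ?i = "period * n - n"
    have "1 * n \<le> period * n" using period_pos by (cases period) simp_all
    then have i: "?i + n = period * n" by linarith
    have "river_turn T ((ds ^^ k) e) = r ! ((?i mod period + k) mod period)" for k
    proof -
      have "river_turn T ((ds ^^ k) e) = river_turn T ((ds ^^ (k + ?i)) ((ds ^^ n) e))"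
        using turn_period_mult[OF e, of k n] i by (metis add.assoc comp_apply funpow_add)
      then show ?thesis using turn_b[of "k + ?i"] by (simp add: n mod_simps add.commute)
    qed
    then show ?thesis using period_pos by (auto simp: river_pos_def intro!: exI[of _ "?i mod period"])
  qed
qed

lemma pos_turn: "river_pos e i \<Longrightarrow> river_turn T ((ds ^^ k) e) = r ! ((i + k) mod period)"
  by (simp add: river_pos_def)

lemma pos_less: "river_pos e i \<Longrightarrow> i < period"
  by (simp add: river_pos_def)

lemma pos_unique:
  assumes "river_pos e i" "river_pos e j" shows "i = j"
proof -
  have main: "i = j" if "river_pos e i" "river_pos e j" "i \<le> j" for i j
  proof -
    have "r ! ((k + (j - i)) mod period) = r ! (k mod period)" for k
    proof -
      have "i < period" using that(1) pos_less by blast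
      \<comment> \<open>Looking ahead by \<open>k + (period - i)\<close> turns cancels the position
        \<open>i\<close> while all indices stay nonnegative.\<close>
      then have "r ! ((k + period) mod period) = r ! ((k + (j - i) + period) mod period)"
        using pos_turn[OF that(1), of "k + (period - i)"] pos_turn[OF that(2), of "k + (period - i)"]
          that(3) by (simp add: add_ac)
      then show ?thesis by simp
    qed
    then have "period dvd j - i" by (rule cyclic_period_dvd)
    moreover have "j - i < period" using pos_less[OF that(2)] by simp
    ultimately have "j - i = 0" using nat_dvd_not_less by blast
    then show ?thesis using that(3) by simp
  qed
  show ?thesis using main[OF assms] main[OF assms(2,1)] by (cases "i \<le> j") auto
qed

lemma pos_ds_iter:
  assumes "river_pos e i" shows "river_pos ((ds ^^ n) e) ((i + n) mod period)"
proof -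
  have "river_turn T ((ds ^^ k) ((ds ^^ n) e)) = r ! (((i + n) mod period + k) mod period)" for k
    using pos_turn[OF assms, of "k + n"] by (simp add: funpow_add mod_simps add_ac)
  then show ?thesis using period_pos by (simp add: river_pos_def)
qed

lemma pos_realized:
  assumes "i < period" obtains e where "e \<in> flow T" "river_pos e i"
proof -
  obtain b where b: "b \<in> flow T" "river_pos b 0" using base_exists by metis
  show thesis using that[of "(ds ^^ i) b"] pos_ds_iter[OF b(2), of i] ds_iter_flow[OF b(1)] assms by simp
qed

lemma river_period_eq: "river_period T = period"
  unfolding river_period_def
proof (rule Least_equality)
  show "0 < period \<and> (\<forall>e\<in>flow T. river_turn T ((ds ^^ period) e) = river_turn T e)"
    using period_pos turn_period_mult[of _ 0 1] by simp
next
  fix n assume n: "0 < n \<and> (\<forall>e\<in>flow T. river_turn T ((ds ^^ n) e) = river_turn T e)"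
  obtain b where b: "b \<in> flow T" "least_period (\<lambda>i. river_turn T ((ds ^^ i) b)) period"
    using base_exists by metis
  have "river_turn T ((ds ^^ (i + n)) b) = river_turn T ((ds ^^ i) b)" for i
    using n ds_iter_flow[OF b(1), of i] by (simp add: funpow_add add.commute[of i n])
  then show "period \<le> n" using b(2) n by (simp add: least_period_def)
qed

lemma pos_same_position:
  assumes "e \<in> flow T" "e' \<in> flow T" "river_pos e i" "river_pos e' i"
  shows "\<exists>c. e' = (ds ^^ (period * c)) e \<or> e = (ds ^^ (period * c)) e'"
proof -
  have main: "\<exists>c. n = period * c" if "river_pos e i" "river_pos ((ds ^^ n) e) i" for e n
  proof -
    have "r ! ((k + n) mod period) = r ! (k mod period)" for k
    proof -
      let ?a = "k + (period - i)"
      have i: "i + ?a = k + period" using pos_less[OF that(1)] by simp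
      have "r ! ((i + (?a + n)) mod period) = river_turn T ((ds ^^ (?a + n)) e)"
        using pos_turn[OF that(1)] by simp
      also have "\<dots> = river_turn T ((ds ^^ ?a) ((ds ^^ n) e))" by (simp only: funpow_add comp_apply)
      also have "\<dots> = r ! ((i + ?a) mod period)" using pos_turn[OF that(2)] by simp
      finally have "r ! ((k + n + period) mod period) = r ! ((k + period) mod period)"
        unfolding add.assoc[of i ?a n, symmetric] i by (simp add: add_ac)
      then show ?thesis by simp
    qed
    then have "period dvd n" by (rule cyclic_period_dvd)
    then show ?thesis by (simp add: dvd_def)
  qed
  obtain n where "e' = (ds ^^ n) e \<or> e = (ds ^^ n) e'" using flow_connected[OF assms(1,2)] by blast
  then show ?thesis using main[of e n] main[of e' n] assms(3,4) by auto
qed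

section \<open>Translations of the river\<close>

text \<open>The automorphisms of the labelled tree. This class contains the river translations and
  is closed under composition and inverses, so it contains all their integer powers.\<close>

definition form_aut :: "('v \<Rightarrow> 'v) \<Rightarrow> bool" where
  "form_aut \<sigma> \<longleftrightarrow> plane_iso T T \<sigma> \<and> (\<forall>e\<in>arcs T. form T (arc_map \<sigma> e) = form T e)"

lemma two_trees_self: "two_trees T T"
  by unfold_locales

lemmas self_iso_arcs = two_trees.plane_iso_arcs[OF two_trees_self]

lemma form_aut_flow: "form_aut \<sigma> \<Longrightarrow> arc_map \<sigma> e \<in> flow T \<longleftrightarrow> e \<in> flow T"
  by (auto simp: form_aut_def flow_iff self_iso_arcs)

lemma form_aut_ds:
  assumes s: "form_aut \<sigma>" and e: "e \<in> flow T" shows "arc_map \<sigma> (ds e) = ds (arc_map \<sigma> e)"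
proof -
  have "fst (arc_map \<sigma> (ds e)) = snd (arc_map \<sigma> e)" by simp
  then show ?thesis using flow_next_unique form_aut_flow[OF s] e ds_flow by metis
qed

lemma form_aut_ds_iter:
  assumes s: "form_aut \<sigma>" and e: "e \<in> flow T" shows "arc_map \<sigma> ((ds ^^ n) e) = (ds ^^ n) (arc_map \<sigma> e)"
  by (induction n) (simp_all add: form_aut_ds[OF s ds_iter_flow[OF e]])

lemma form_aut_pos:
  assumes s: "form_aut \<sigma>" and e: "e \<in> flow T" shows "river_pos (arc_map \<sigma> e) i \<longleftrightarrow> river_pos e i"
proof -
  have "arc_map \<sigma> e \<in> flow T" "form T (arc_map \<sigma> e) = form T e"
    using s e form_aut_flow flow_arcs by (auto simp: form_aut_def)
  then show ?thesis using e by (simp add: river_pos_def turn_ds_iter)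
qed

lemma form_aut_comp:
  assumes "form_aut \<sigma>" "form_aut \<rho>" shows "form_aut (\<sigma> \<circ> \<rho>)"
  unfolding form_aut_def
proof (intro conjI ballI)
  show "plane_iso T T (\<sigma> \<circ> \<rho>)" using assms plane_iso_comp by (auto simp: form_aut_def)
  fix e assume e: "e \<in> arcs T"
  then have "arc_map \<rho> e \<in> arcs T" using assms(2) self_iso_arcs by (simp add: form_aut_def)
  moreover have "arc_map (\<sigma> \<circ> \<rho>) e = arc_map \<sigma> (arc_map \<rho> e)" by (cases e) simp
  ultimately show "form T (arc_map (\<sigma> \<circ> \<rho>) e) = form T e" using assms e by (simp add: form_aut_def)
qed

lemma form_aut_inv:
  assumes "form_aut \<sigma>" shows "form_aut (inv \<sigma>)"
proof -
  have iso: "plane_iso T T \<sigma>" using assms by (simp add: form_aut_def)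
  then have "\<sigma> (inv \<sigma> v) = v" for v by (simp add: plane_iso_def bij_is_surj surj_f_inv_f)
  then have "arc_map \<sigma> (arc_map (inv \<sigma>) e) = e" for e by (cases e) simp
  then show ?thesis using assms plane_iso_inv[OF iso] self_iso_arcs[OF iso] unfolding form_aut_def by metis
qed

lemma form_aut_id: "form_aut id"
  by (auto simp: form_aut_def plane_iso_def)

lemma form_aut_funpow: "form_aut \<sigma> \<Longrightarrow> form_aut (\<sigma> ^^ n)"
  by (induction n) (simp_all add: form_aut_comp form_aut_id)

lemma form_aut_int_iterate: "form_aut \<sigma> \<Longrightarrow> form_aut (int_iterate \<sigma> a)"
  by (simp add: int_iterate_def form_aut_funpow form_aut_inv)

text \<open>The form on one arc determines all others through reversals and turns, so a plane
  isomorphism respecting one form respects all of them.\<close>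

lemma form_aut_exists:
  assumes e: "e \<in> arcs T" and e': "e' \<in> arcs T" and eq: "form T e' = form T e"
  shows "\<exists>\<sigma>. form_aut \<sigma> \<and> arc_map \<sigma> e = e'"
proof -
  obtain \<sigma> where iso: "plane_iso T T \<sigma>" and se: "arc_map \<sigma> e = e'"
    using two_trees.plane_iso_exists[OF two_trees_self e e'] by blast
  have w: "form T (walk w b) = form T (walk w a)"
    if "a \<in> arcs T" "b \<in> arcs T" "form T b = form T a" for a b w
    using that
  proof (induction w arbitrary: a b)
    case (Cons c w)
    have "form T (turn_arc c b) = form T (turn_arc c a)"
      using Cons.prems by (simp add: turn_arc_def form_left form_right)
    then have "form T (walk w (turn_arc c b)) = form T (walk w (turn_arc c a))"
      by (rule Cons.IH[OF turn_arc_in[OF Cons.prems(1)] turn_arc_in[OF Cons.prems(2)]])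
    then show ?case by simp
  qed simp
  have side: "form T (arc_map \<sigma> (side_walk e p)) = form T (side_walk e p)" for p
  proof -
    obtain s v where p: "p = (s, v)" by (cases p)
    have "arc_map \<sigma> (side_walk e p) = side_walk e' p"
      using two_trees.plane_iso_side_walk[OF two_trees_self iso e, of p] by (simp only: se)
    then show ?thesis
      using w[OF e e' eq, of v] w[of "rev_arc e" "rev_arc e'" v] e e' eq
      by (simp add: p side_walk_def form_rev arcs_closed)
  qed
  have "form T (arc_map \<sigma> a) = form T a" if a: "a \<in> arcs T" for a
  proof -
    obtain p where "a = side_walk e p \<or> a = rev_arc (side_walk e p)" using arc_side_walk[OF e a] by blast
    then show ?thesis
      using side[of p] side_walk_in[OF e, of p] self_iso_arcs[OF iso, of "side_walk e p"]
      by (auto simp: form_rev)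
  qed
  then show ?thesis using iso se by (auto simp: form_aut_def)
qed

text \<open>Not only the turns but also the forms repeat after a least period of turns, which makes
  the translation an automorphism. Reflexivity of \<open>RS_equiv\<close> depends on this
  existence.\<close>

lemma river_translation_exists: "\<exists>\<tau>. river_translation T \<tau>"
proof -
  obtain b where b: "b \<in> flow T" using base_exists by metis
  have "form T ((ds ^^ period) b) = form T b" using form_period b form_ds_iter by simp
  then obtain \<tau> where t: "form_aut \<tau>" "arc_map \<tau> b = (ds ^^ period) b"
    using form_aut_exists flow_arcs ds_iter_flow b by metis
  have "arc_map \<tau> e = (ds ^^ period) e" if e: "e \<in> flow T" for e
  proof -
    have comm: "(ds ^^ n) ((ds ^^ k) f) = (ds ^^ k) ((ds ^^ n) f)" for n k f
      by (metis add.commute comp_apply funpow_add)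
    obtain n where "e = (ds ^^ n) b \<or> b = (ds ^^ n) e" using flow_connected[OF b e] by blast
    then show ?thesis
    proof
      assume "e = (ds ^^ n) b"
      then show ?thesis using form_aut_ds_iter[OF t(1) b] t(2) comm by metis
    next
      assume n: "b = (ds ^^ n) e"
      then have "(ds ^^ n) (arc_map \<tau> e) = (ds ^^ n) ((ds ^^ period) e)"
        using form_aut_ds_iter[OF t(1) e] t(2) comm by metis
      then show ?thesis using ds_iter_inject form_aut_flow[OF t(1)] ds_iter_flow e by metis
    qed
  qed
  then show ?thesis using t(1) by (auto simp: river_translation_def form_aut_def river_period_eq)
qed

lemma river_translation_aut: "river_translation T \<tau> \<Longrightarrow> form_aut \<tau>"
  by (simp add: river_translation_def form_aut_def)

lemma river_translation_transitive:
  assumes t: "river_translation T \<tau>" and "e \<in> flow T" "e' \<in> flow T" "river_pos e i" "river_pos e' i"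
  shows "\<exists>a. arc_map (int_iterate \<tau> a) e = e'"
proof -
  have fwd: "arc_map (\<tau> ^^ c) f = (ds ^^ (period * c)) f" if "f \<in> flow T" for f c
  proof (induction c)
    case (Suc c)
    have "arc_map (\<tau> ^^ Suc c) f = arc_map \<tau> (arc_map (\<tau> ^^ c) f)" by (cases f) simp
    also have "\<dots> = (ds ^^ period) ((ds ^^ (period * c)) f)"
      unfolding Suc using t ds_iter_flow[OF that]
      by (simp add: river_translation_def river_period_eq)
    finally show ?case by (simp only: funpow_add comp_apply mult_Suc_right)
  qed (cases f, simp)
  have bij: "bij \<tau>" using t by (simp add: river_translation_def plane_iso_def)
  have bwd: "arc_map (inv \<tau> ^^ c) ((ds ^^ (period * c)) f) = f" if "f \<in> flow T" for f c
  proof -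
    have "(inv \<tau> ^^ c) ((\<tau> ^^ c) v) = v" for v
      by (metis bij bij_is_inj bij_fn inv_f_f inv_fn)
    then have "arc_map (inv \<tau> ^^ c) (arc_map (\<tau> ^^ c) f) = f" by (cases f) simp
    then show ?thesis using fwd[OF that] by simp
  qed
  obtain c where "e' = (ds ^^ (period * c)) e \<or> e = (ds ^^ (period * c)) e'"
    using pos_same_position assms(2-5) by blast
  then show ?thesis
  proof
    assume "e' = (ds ^^ (period * c)) e"
    then have "arc_map (int_iterate \<tau> (int c)) e = e'"
      using fwd[OF assms(2)] by (simp add: int_iterate_def)
    then show ?thesis by blast
  next
    assume e: "e = (ds ^^ (period * c)) e'"
    show ?thesis
    \<comment> \<open>For \<open>c = 0\<close> the exponent \<open>- int c\<close> is not negative,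
      and \<open>int_iterate\<close> takes its forward branch.\<close>
    proof (cases "c = 0")
      case True
      then have "arc_map (int_iterate \<tau> 0) e = e'" using e by (simp add: int_iterate_def map_prod.id)
      then show ?thesis by blast
    next
      case False
      then have "arc_map (int_iterate \<tau> (- int c)) e = e'"
        using bwd[OF assms(3)] e by (simp add: int_iterate_def)
      then show ?thesis by blast
    qed
  qed
qed

end

section \<open>What the procedure counts\<close>

definition diverges :: "nat list \<Rightarrow> nat list \<Rightarrow> nat \<Rightarrow> nat \<Rightarrow> bool" where
  "diverges r\<^sub>1 r\<^sub>2 i j \<longleftrightarrow> (\<exists>l.
     (\<forall>h<l. r\<^sub>1 ! ((i + h) mod length r\<^sub>1) = r\<^sub>2 ! ((j + h) mod length r\<^sub>2)) \<and>
     r\<^sub>1 ! ((i + l) mod length r\<^sub>1) = 1 \<and> r\<^sub>2 ! ((j + l) mod length r\<^sub>2) = 0)"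

definition diverging_pairs :: "nat list \<Rightarrow> nat list \<Rightarrow> nat set \<Rightarrow> nat set \<Rightarrow> (nat \<times> nat) set" where
  "diverging_pairs r\<^sub>1 r\<^sub>2 X Y = {(i, j). i \<in> X \<and> j \<in> Y \<and> diverges r\<^sub>1 r\<^sub>2 i j}"

lemma diverges_step:
  assumes "i < length r\<^sub>1" "j < length r\<^sub>2"
  shows "diverges r\<^sub>1 r\<^sub>2 i j \<longleftrightarrow> r\<^sub>1 ! i = 1 \<and> r\<^sub>2 ! j = 0 \<or>
    r\<^sub>1 ! i = r\<^sub>2 ! j \<and> diverges r\<^sub>1 r\<^sub>2 (Suc i mod length r\<^sub>1) (Suc j mod length r\<^sub>2)"
    (is "_ \<longleftrightarrow> ?now \<or> ?later")
proof -
  have m: "(Suc i mod length r\<^sub>1 + h) mod length r\<^sub>1 = (i + Suc h) mod length r\<^sub>1" for h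
    by (simp add: mod_simps)
  have n: "(Suc j mod length r\<^sub>2 + h) mod length r\<^sub>2 = (j + Suc h) mod length r\<^sub>2" for h
    by (simp add: mod_simps)
  show ?thesis
  proof
    assume "diverges r\<^sub>1 r\<^sub>2 i j"
    then obtain l where l: "\<And>h. h < l \<Longrightarrow> r\<^sub>1 ! ((i + h) mod length r\<^sub>1) = r\<^sub>2 ! ((j + h) mod length r\<^sub>2)"
      "r\<^sub>1 ! ((i + l) mod length r\<^sub>1) = 1" "r\<^sub>2 ! ((j + l) mod length r\<^sub>2) = 0"
      unfolding diverges_def by blast
    show "?now \<or> ?later"
    proof (cases l)
      case 0
      then show ?thesis using l(2,3) assms by simp
    next
      case (Suc l')
      have "r\<^sub>1 ! i = r\<^sub>2 ! j" using l(1)[of 0] Suc assms by simp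
      moreover have "diverges r\<^sub>1 r\<^sub>2 (Suc i mod length r\<^sub>1) (Suc j mod length r\<^sub>2)"
        unfolding diverges_def m n
        using l(1)[unfolded Suc, OF Suc_mono] l(2,3) unfolding Suc by blast
      ultimately show ?thesis by blast
    qed
  next
    assume "?now \<or> ?later"
    then show "diverges r\<^sub>1 r\<^sub>2 i j"
    proof
      assume ?now
      then show ?thesis unfolding diverges_def using assms by (intro exI[of _ 0]) simp
    next
      assume later: ?later
      then obtain l where l: "\<And>h. h < l \<Longrightarrow> r\<^sub>1 ! ((i + Suc h) mod length r\<^sub>1) = r\<^sub>2 ! ((j + Suc h) mod length r\<^sub>2)"
        "r\<^sub>1 ! ((i + Suc l) mod length r\<^sub>1) = 1" "r\<^sub>2 ! ((j + Suc l) mod length r\<^sub>2) = 0"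
        unfolding diverges_def m n by blast
      have "r\<^sub>1 ! ((i + h) mod length r\<^sub>1) = r\<^sub>2 ! ((j + h) mod length r\<^sub>2)" if "h < Suc l" for h
        using that l(1) later assms by (cases h) auto
      then show ?thesis unfolding diverges_def using l(2,3) by blast
    qed
  qed
qed

lemma Suc_mod_inject:
  assumes "i < n" "j < n" "Suc i mod n = Suc j mod n" shows "i = j"
  using assms by (auto simp: mod_Suc split: if_splits)

lemma card_diverging_shift:
  assumes "X \<subseteq> {..<length r\<^sub>1}" "Y \<subseteq> {..<length r\<^sub>2}"
  shows "card {(i, j). i \<in> X \<and> j \<in> Y \<and> diverges r\<^sub>1 r\<^sub>2 (Suc i mod length r\<^sub>1) (Suc j mod length r\<^sub>2)} =
    card (diverging_pairs r\<^sub>1 r\<^sub>2 (shift (length r\<^sub>1) X 1) (shift (length r\<^sub>2) Y 1))"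
proof (rule bij_betw_same_card)
  let ?s = "\<lambda>(i, j). (Suc i mod length r\<^sub>1, Suc j mod length r\<^sub>2)"
  show "bij_betw ?s
     {(i, j). i \<in> X \<and> j \<in> Y \<and> diverges r\<^sub>1 r\<^sub>2 (Suc i mod length r\<^sub>1) (Suc j mod length r\<^sub>2)}
     (diverging_pairs r\<^sub>1 r\<^sub>2 (shift (length r\<^sub>1) X 1) (shift (length r\<^sub>2) Y 1))"
    unfolding bij_betw_def
  proof
    show "inj_on ?s {(i, j). i \<in> X \<and> j \<in> Y \<and>
        diverges r\<^sub>1 r\<^sub>2 (Suc i mod length r\<^sub>1) (Suc j mod length r\<^sub>2)}"
      using assms by (intro inj_onI) (auto intro: Suc_mod_inject)
  qed (auto simp: diverging_pairs_def shift_def image_iff)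
qed

lemma shift_less: "X \<subseteq> {..<n} \<Longrightarrow> shift n X k \<subseteq> {..<n}"
  by (auto simp: shift_def intro!: mod_less_divisor)

text \<open>Pairs are sorted by their two first letters: (1,0) diverges at once and is what the
  counter receives, (0,0) and (1,1) are passed to the two recursive calls, and (0,1) crosses the
  wrong way.\<close>

lemma card_diverging_pairs_step:
  assumes X: "X \<subseteq> {..<length r\<^sub>1}" and Y: "Y \<subseteq> {..<length r\<^sub>2}"
    and letters: "set r\<^sub>1 \<subseteq> {0, 1}" "set r\<^sub>2 \<subseteq> {0, 1}"
  shows "card (diverging_pairs r\<^sub>1 r\<^sub>2 X Y) =
    card (letter_indices r\<^sub>1 1 \<inter> X) * card (letter_indices r\<^sub>2 0 \<inter> Y) +
    card (diverging_pairs r\<^sub>1 r\<^sub>2 (shift (length r\<^sub>1) (letter_indices r\<^sub>1 0 \<inter> X) 1)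
      (shift (length r\<^sub>2) (letter_indices r\<^sub>2 0 \<inter> Y) 1)) +
    card (diverging_pairs r\<^sub>1 r\<^sub>2 (shift (length r\<^sub>1) (letter_indices r\<^sub>1 1 \<inter> X) 1)
      (shift (length r\<^sub>2) (letter_indices r\<^sub>2 1 \<inter> Y) 1))"
proof -
  let ?L = "letter_indices r\<^sub>1" and ?M = "letter_indices r\<^sub>2"
  define B where "B c = {(i, j). i \<in> ?L c \<inter> X \<and> j \<in> ?M c \<inter> Y \<and>
    diverges r\<^sub>1 r\<^sub>2 (Suc i mod length r\<^sub>1) (Suc j mod length r\<^sub>2)}" for c
  have l1: "r\<^sub>1 ! i = 0 \<or> r\<^sub>1 ! i = 1" if "i \<in> X" for i
    using that X letters(1) nth_mem[of i r\<^sub>1] by blast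
  have l2: "r\<^sub>2 ! j = 0 \<or> r\<^sub>2 ! j = 1" if "j \<in> Y" for j
    using that Y letters(2) nth_mem[of j r\<^sub>2] by blast
  have eq: "diverging_pairs r\<^sub>1 r\<^sub>2 X Y = ((?L 1 \<inter> X) \<times> (?M 0 \<inter> Y) \<union> B 0) \<union> B 1" (is "?l = ?r")
  proof (rule set_eqI)
    fix p :: "nat \<times> nat"
    obtain i j where p: "p = (i, j)" by (cases p)
    show "p \<in> ?l \<longleftrightarrow> p \<in> ?r"
    proof (cases "i \<in> X \<and> j \<in> Y")
      case True
      then have ij: "i < length r\<^sub>1" "j < length r\<^sub>2" using X Y by auto
      have "p \<in> ?l \<longleftrightarrow> r\<^sub>1 ! i = 1 \<and> r\<^sub>2 ! j = 0 \<or>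
        r\<^sub>1 ! i = r\<^sub>2 ! j \<and> diverges r\<^sub>1 r\<^sub>2 (Suc i mod length r\<^sub>1) (Suc j mod length r\<^sub>2)"
        using True diverges_step[OF ij] by (simp add: p diverging_pairs_def)
      also have "\<dots> \<longleftrightarrow> p \<in> ?r"
        using True ij l1[of i] l2[of j] by (auto simp: p B_def letter_indices_def)
      finally show ?thesis .
    next
      case False
      then show ?thesis by (auto simp: p diverging_pairs_def B_def)
    qed
  qed
  have fin: "finite X" "finite Y" using X Y finite_subset by auto
  have finB: "finite (B c)" for c
    by (rule finite_subset[of _ "X \<times> Y"]) (use fin in \<open>auto simp: B_def\<close>)
  have d1: "((?L 1 \<inter> X) \<times> (?M 0 \<inter> Y)) \<inter> B 0 = {}" by (auto simp: B_def letter_indices_def)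
  have d2: "((?L 1 \<inter> X) \<times> (?M 0 \<inter> Y) \<union> B 0) \<inter> B 1 = {}" by (auto simp: B_def letter_indices_def)
  have "card (diverging_pairs r\<^sub>1 r\<^sub>2 X Y) =
    card ((?L 1 \<inter> X) \<times> (?M 0 \<inter> Y)) + card (B 0) + card (B 1)"
    unfolding eq using fin finB d1 d2 by (simp add: card_Un_disjoint)
  moreover have "card (B c) = card (diverging_pairs r\<^sub>1 r\<^sub>2
      (shift (length r\<^sub>1) (?L c \<inter> X) 1) (shift (length r\<^sub>2) (?M c \<inter> Y) 1))" for c
    unfolding B_def by (rule card_diverging_shift) (use X Y in auto)
  ultimately show ?thesis by (simp add: card_cartesian_product)
qed

lemma step3_counts:
  assumes "step3 r\<^sub>1 r\<^sub>2 S X Y k I I'"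
    and "set r\<^sub>1 \<subseteq> {0, 1}" "set r\<^sub>2 \<subseteq> {0, 1}"
    and "X \<subseteq> {..<length r\<^sub>1}" "Y \<subseteq> {..<length r\<^sub>2}"
  shows "I' = I + card (diverging_pairs r\<^sub>1 r\<^sub>2 X Y)"
  using assms
proof (induction rule: step3.induct)
  case (return X Y S k I)
  then have "diverging_pairs r\<^sub>1 r\<^sub>2 X Y = {}" by (auto simp: diverging_pairs_def)
  then show ?case by simp
next
  case (recurse X Y S k I I' I'')
  have s: "shift (length r\<^sub>1) (letter_indices r\<^sub>1 c \<inter> X) 1 \<subseteq> {..<length r\<^sub>1}"
    "shift (length r\<^sub>2) (letter_indices r\<^sub>2 c \<inter> Y) 1 \<subseteq> {..<length r\<^sub>2}" for c
    using recurse.prems by (intro shift_less; auto)+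
  have "I' = I + card (letter_indices r\<^sub>1 1 \<inter> X) * card (letter_indices r\<^sub>2 0 \<inter> Y) +
    card (diverging_pairs r\<^sub>1 r\<^sub>2 (shift (length r\<^sub>1) (letter_indices r\<^sub>1 0 \<inter> X) 1)
      (shift (length r\<^sub>2) (letter_indices r\<^sub>2 0 \<inter> Y) 1))"
    by (rule recurse.IH(1)[OF recurse.prems(1,2) s])
  moreover have "I'' = I' + card (diverging_pairs r\<^sub>1 r\<^sub>2
      (shift (length r\<^sub>1) (letter_indices r\<^sub>1 1 \<inter> X) 1)
      (shift (length r\<^sub>2) (letter_indices r\<^sub>2 1 \<inter> Y) 1))"
    by (rule recurse.IH(2)[OF recurse.prems(1,2) s])
  ultimately show ?case
    using card_diverging_pairs_step[OF recurse.prems(3,4,1,2)] by linarith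
qed

text \<open>Every level removes one common letter, so the bound \<open>N\<close> for the first
  disagreement drops by one; at bound 0 there is no pair left and one of the two sets is
  empty.\<close>

lemma step3_terminates:
  assumes "\<And>i j. i \<in> X \<Longrightarrow> j \<in> Y \<Longrightarrow>
      \<exists>h<N. r\<^sub>1 ! ((i + h) mod length r\<^sub>1) \<noteq> r\<^sub>2 ! ((j + h) mod length r\<^sub>2)"
    and "X \<subseteq> {..<length r\<^sub>1}" "Y \<subseteq> {..<length r\<^sub>2}"
  shows "\<exists>I'. step3 r\<^sub>1 r\<^sub>2 S X Y k I I'"
  using assms
proof (induction N arbitrary: X Y S k I)
  case 0
  then have "X = {} \<or> Y = {}" by blast
  then show ?case using step3.return by blast
next
  case (Suc N)
  show ?case
  proof (cases "X = {} \<or> Y = {}")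
    case True
    then show ?thesis using step3.return by blast
  next
    case False
    have "\<exists>I'. step3 r\<^sub>1 r\<^sub>2 S'
        (shift (length r\<^sub>1) (letter_indices r\<^sub>1 c \<inter> X) 1)
        (shift (length r\<^sub>2) (letter_indices r\<^sub>2 c \<inter> Y) 1) k' J I'" for S' c k' J
    proof (rule Suc.IH)
      fix i j assume "i \<in> shift (length r\<^sub>1) (letter_indices r\<^sub>1 c \<inter> X) 1"
        "j \<in> shift (length r\<^sub>2) (letter_indices r\<^sub>2 c \<inter> Y) 1"
      then obtain i' j' where ij: "i' \<in> X" "i' < length r\<^sub>1" "r\<^sub>1 ! i' = c" "i = Suc i' mod length r\<^sub>1"
        "j' \<in> Y" "j' < length r\<^sub>2" "r\<^sub>2 ! j' = c" "j = Suc j' mod length r\<^sub>2"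
        by (auto simp: shift_def letter_indices_def)
      obtain h where h: "h < Suc N" "r\<^sub>1 ! ((i' + h) mod length r\<^sub>1) \<noteq> r\<^sub>2 ! ((j' + h) mod length r\<^sub>2)"
        using Suc.prems(1) ij by blast
      then obtain h' where "h = Suc h'" using ij by (cases h) auto
      then show "\<exists>h<N. r\<^sub>1 ! ((i + h) mod length r\<^sub>1) \<noteq> r\<^sub>2 ! ((j + h) mod length r\<^sub>2)"
        using h ij by (intro exI[of _ h']) (simp add: mod_simps)
    qed (use Suc.prems(2,3) in \<open>auto intro!: shift_less\<close>)
    then show ?thesis using step3.recurse False by metis
  qed
qed

text \<open>The shifted set consists of the indices preceded by \<open>c\<close>; adding the length
  before subtracting 1 keeps the predecessor of index 0 meaningful.\<close>

lemma shift_letter_indices_iff: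
  assumes "length r > 0"
  shows "i \<in> shift (length r) (letter_indices r c) 1 \<longleftrightarrow>
    i < length r \<and> r ! ((i + length r - 1) mod length r) = c"
proof
  let ?m = "length r"
  assume "i \<in> shift ?m (letter_indices r c) 1"
  then obtain i' where i': "i' < ?m" "r ! i' = c" "i = (i' + 1) mod ?m"
    by (auto simp: shift_def letter_indices_def)
  have "(i + ?m - 1) mod ?m = ((i' + 1) mod ?m + (?m - 1)) mod ?m"
    using assms unfolding i'(3) by (simp only: Nat.add_diff_assoc[OF Suc_leI, symmetric] One_nat_def)
  also have "\<dots> = (i' + 1 + (?m - 1)) mod ?m" by (rule mod_add_left_eq)
  also have "\<dots> = i'" using i'(1) assms by simp
  finally show "i < ?m \<and> r ! ((i + ?m - 1) mod ?m) = c" using i' assms by simp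
next
  let ?m = "length r" and ?i = "(i + length r - 1) mod length r"
  assume i: "i < ?m \<and> r ! ?i = c"
  have "(?i + 1) mod ?m = (i + ?m - 1 + 1) mod ?m" by (rule mod_add_left_eq)
  moreover have "i + ?m - 1 + 1 = i + ?m" using assms by linarith
  ultimately have "i = (?i + 1) mod ?m" using i by simp
  moreover have "?i \<in> letter_indices r c" using i assms by (simp add: letter_indices_def)
  ultimately show "i \<in> shift ?m (letter_indices r c) 1" by (auto simp: shift_def)
qed

lemma procedure_counts:
  assumes r: "cf_river_sequence q\<^sub>1 r\<^sub>1" "cf_river_sequence q\<^sub>2 r\<^sub>2"
    and len: "length r\<^sub>1 > 0" "length r\<^sub>2 > 0"
    and letters: "set r\<^sub>1 \<subseteq> {0, 1}" "set r\<^sub>2 \<subseteq> {0, 1}"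
  shows "procedure_outputs q\<^sub>1 q\<^sub>2 N \<longleftrightarrow> N = card (diverging_pairs r\<^sub>1 r\<^sub>2
    (shift (length r\<^sub>1) (letter_indices r\<^sub>1 0) 1) (shift (length r\<^sub>2) (letter_indices r\<^sub>2 1) 1))"
proof -
  let ?m = "length r\<^sub>1" and ?n = "length r\<^sub>2"
  let ?X = "shift ?m (letter_indices r\<^sub>1 0) 1" and ?Y = "shift ?n (letter_indices r\<^sub>2 1) 1"
  have sub: "?X \<subseteq> {..<?m}" "?Y \<subseteq> {..<?n}" by (intro shift_less; auto simp: letter_indices_def)+
  have "procedure_outputs q\<^sub>1 q\<^sub>2 N \<longleftrightarrow> step3 r\<^sub>1 r\<^sub>2 [] ?X ?Y 1 0 N"
    unfolding procedure_outputs_def using r cf_river_sequence_unique by metis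
  moreover have "\<exists>I'. step3 r\<^sub>1 r\<^sub>2 [] ?X ?Y 1 0 I'"
  proof (rule step3_terminates[OF _ sub])
    fix i j assume i: "i \<in> ?X" and j: "j \<in> ?Y"
    \<comment> \<open>This offset is -1 modulo both lengths, so it leads back to the letters before
      \<open>i\<close> and \<open>j\<close>, which are 0 and 1. Hence no pair agrees for mn
      letters.\<close>
    let ?h = "?m * ?n - 1"
    have "(i + ?h) mod ?m = (i + ?m - 1) mod ?m"
    proof -
      have "?m * ?n - 1 = (?m - 1) + ?m * (?n - 1)" using len by (cases ?m; cases ?n) auto
      then have "i + ?h = (i + ?m - 1) + ?m * (?n - 1)" using len by linarith
      then show ?thesis by simp
    qed
    moreover have "(j + ?h) mod ?n = (j + ?n - 1) mod ?n"
    proof -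
      have "?m * ?n - 1 = (?n - 1) + ?n * (?m - 1)" using len by (cases ?m; cases ?n) auto
      then have "j + ?h = (j + ?n - 1) + ?n * (?m - 1)" using len by linarith
      then show ?thesis by simp
    qed
    moreover have "r\<^sub>1 ! ((i + ?m - 1) mod ?m) = 0" "r\<^sub>2 ! ((j + ?n - 1) mod ?n) = 1"
      using i j shift_letter_indices_iff len by auto
    moreover have "?h < ?m * ?n" using len by simp
    ultimately show "\<exists>h<?m * ?n. r\<^sub>1 ! ((i + h) mod ?m) \<noteq> r\<^sub>2 ! ((j + h) mod ?n)"
      by (metis zero_neq_one)
  qed
  ultimately show ?thesis using step3_counts[OF _ letters sub] by (metis add_0)
qed

lemma bij_betw_quotient_by_key:
  assumes E: "\<And>x y. (x, y) \<in> E \<longleftrightarrow> x \<in> X \<and> y \<in> X \<and> f x = f y"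
  shows "bij_betw (\<lambda>k. {x \<in> X. f x = k}) (f ` X) (X // E)"
proof -
  have cls: "E `` {x} = {y \<in> X. f y = f x}" if "x \<in> X" for x using that E by auto
  show ?thesis
    unfolding bij_betw_def
  proof
    show "inj_on (\<lambda>k. {x \<in> X. f x = k}) (f ` X)" by (rule inj_onI) blast
    show "(\<lambda>k. {x \<in> X. f x = k}) ` f ` X = X // E"
      unfolding quotient_def using cls by auto
  qed
qed

section \<open>Crossing superimpositions\<close>

context river_tree begin

text \<open>Going back from \<open>ds a\<close> starts with the turn opposite to the one made at
  \<open>a\<close>. This first letter is what separates the two rivers before their shared
  path.\<close>

lemma upstream_walk:
  assumes a: "a \<in> flow T" and f: "f \<in> flow T" and eq: "ds a = (ds ^^ Suc i) f"
  shows "\<exists>w. rev_arc f = walk ((river_turn T a = 0) # w) (rev_arc (ds a))"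
proof -
  have "a = (ds ^^ i) f" using ds_inject[OF a ds_iter_flow[OF f]] eq by simp
  then have "walk (flow_word f i) f = a" using walk_flow_word[OF f] by simp
  then obtain w where w: "rev_arc f = walk w (rev_arc a)" using rev_walk[OF flow_arcs[OF f]] by metis
  have "turn_arc (river_turn T a = 0) (rev_arc (ds a)) = rev_arc a"
    using river_turn_cases[of a] rev_turn_arc[OF flow_arcs[OF a], of "river_turn T a = 1"]
    by (auto simp: ds_turn[OF a])
  then have "rev_arc f = walk ((river_turn T a = 0) # w) (rev_arc (ds a))" using w by simp
  then show ?thesis by blast
qed

lemma length_flow_word: "length (flow_word e n) = n"
  by (simp add: flow_word_def)

lemma pos_prev_turn:
  assumes a: "a \<in> flow T" and i: "river_pos (ds a) i"
  shows "river_turn T a = r ! ((i + period - 1) mod period)"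
proof -
  obtain j where j: "river_pos a j" using pos_exists[OF a] by blast
  have "i = (j + 1) mod period" using pos_unique[OF i] pos_ds_iter[OF j, of 1] by simp
  have "(i + period - 1) mod period = ((j + 1) mod period + (period - 1)) mod period"
    using period_pos \<open>i = _\<close> by (metis Nat.add_diff_assoc One_nat_def Suc_leI)
  also have "\<dots> = (j + 1 + (period - 1)) mod period" by (rule mod_add_left_eq)
  also have "j + 1 + (period - 1) = j + period" using period_pos by linarith
  also have "(j + period) mod period = j" using pos_less[OF j] by simp
  finally show ?thesis using pos_turn[OF j, of 0] pos_less[OF j] by simp
qed

lemma letters: "set r \<subseteq> {0, 1}"
proof
  fix c assume "c \<in> set r"
  then obtain k where k: "k < period" "c = r ! k" by (auto simp: in_set_conv_nth)
  obtain b where "river_pos b 0" using base_exists by metis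
  then have "river_turn T ((ds ^^ k) b) = c" using pos_turn[of b 0 k] k by simp
  then show "c \<in> {0, 1}" using river_turn_cases[of "(ds ^^ k) b"] by auto
qed

lemma left_bank_form: "on_left_bank T x \<Longrightarrow> cA (form T x) > 0"
  unfolding on_left_bank_def by (auto simp: form_left flow_iff flow_form_def)

lemma right_bank_form: "on_right_bank T x \<Longrightarrow> cC (form T x) < 0"
  unfolding on_right_bank_def by (auto simp: form_right flow_iff flow_form_def)

text \<open>An arc on both banks would have A > 0 > C and thus belong to the river.\<close>

lemma banks_disjoint:
  assumes x: "x \<in> arcs T" "on_right_bank T x" shows "\<not> on_left_bank T x"
proof
  assume "on_left_bank T x"
  then have "cA (form T x) * cC (form T x) < 0"
    using left_bank_form right_bank_form[OF x(2)] by (simp add: mult_pos_neg)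
  then show False using x by (simp add: on_right_bank_def river_def)
qed

end

locale two_rivers = R1: river_tree T\<^sub>1 q\<^sub>1 r\<^sub>1 + R2: river_tree T\<^sub>2 q\<^sub>2 r\<^sub>2
  for T\<^sub>1 :: "'v topograph" and q\<^sub>1 r\<^sub>1 and T\<^sub>2 :: "'w topograph" and q\<^sub>2 r\<^sub>2
begin

lemma two_trees: "two_trees T\<^sub>2 T\<^sub>1"
  by unfold_locales

lemmas iso_arcs = two_trees.plane_iso_arcs[OF two_trees]
lemmas iso_inj = two_trees.plane_iso_inj[OF two_trees]
lemmas iso_turns = two_trees.plane_iso_turns[OF two_trees]
lemmas iso_turn_arc = two_trees.plane_iso_turn_arc[OF two_trees]
lemmas iso_walk = two_trees.plane_iso_walk[OF two_trees]
lemmas iso_exists = two_trees.plane_iso_exists[OF two_trees]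
lemmas iso_unique = two_trees.plane_iso_unique[OF two_trees]

text \<open>The shared path consists of the \<open>l + 1\<close> flow edges starting with \<open>e\<^sub>1\<close>, which is the image
  of \<open>e\<^sub>2\<close>. The second river joins from the right if the first one turns left and the second one
  right just before.\<close>

definition crossing :: "('w \<Rightarrow> 'v) \<Rightarrow> 'v \<times> 'v \<Rightarrow> 'w \<times> 'w \<Rightarrow> nat \<Rightarrow> bool" where
  "crossing \<phi> e\<^sub>1 e\<^sub>2 l \<longleftrightarrow>
     plane_iso T\<^sub>2 T\<^sub>1 \<phi> \<and> e\<^sub>1 \<in> flow T\<^sub>1 \<and> e\<^sub>2 \<in> flow T\<^sub>2 \<and> arc_map \<phi> e\<^sub>2 = e\<^sub>1 \<and>
     (\<exists>a\<^sub>1\<in>flow T\<^sub>1. R1.ds a\<^sub>1 = e\<^sub>1 \<and> river_turn T\<^sub>1 a\<^sub>1 = 0) \<and>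
     (\<exists>a\<^sub>2\<in>flow T\<^sub>2. R2.ds a\<^sub>2 = e\<^sub>2 \<and> river_turn T\<^sub>2 a\<^sub>2 = 1) \<and>
     (\<forall>h<l. river_turn T\<^sub>1 ((R1.ds ^^ h) e\<^sub>1) = river_turn T\<^sub>2 ((R2.ds ^^ h) e\<^sub>2)) \<and>
     river_turn T\<^sub>1 ((R1.ds ^^ l) e\<^sub>1) = 1 \<and> river_turn T\<^sub>2 ((R2.ds ^^ l) e\<^sub>2) = 0"

lemma iso_ds:
  assumes "plane_iso T\<^sub>2 T\<^sub>1 \<phi>" "e\<^sub>1 \<in> flow T\<^sub>1" "e\<^sub>2 \<in> flow T\<^sub>2" "arc_map \<phi> e\<^sub>2 = e\<^sub>1"
  shows "arc_map \<phi> (R2.ds e\<^sub>2) = R1.turn_arc (river_turn T\<^sub>2 e\<^sub>2 = 1) e\<^sub>1"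
    and "arc_map \<phi> (R2.ds e\<^sub>2) = R1.ds e\<^sub>1 \<longleftrightarrow> river_turn T\<^sub>1 e\<^sub>1 = river_turn T\<^sub>2 e\<^sub>2"
proof -
  show 1: "arc_map \<phi> (R2.ds e\<^sub>2) = R1.turn_arc (river_turn T\<^sub>2 e\<^sub>2 = 1) e\<^sub>1"
    using iso_turn_arc[OF assms(1) R2.flow_arcs[OF assms(3)]] assms(4)
    by (simp only: R2.ds_turn[OF assms(3)])
  show "arc_map \<phi> (R2.ds e\<^sub>2) = R1.ds e\<^sub>1 \<longleftrightarrow> river_turn T\<^sub>1 e\<^sub>1 = river_turn T\<^sub>2 e\<^sub>2"
    unfolding 1 R1.ds_turn[OF assms(2)]
    using R1.turn_arc_inject[OF R1.flow_arcs[OF assms(2)]] R1.river_turn_cases[of e\<^sub>1]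
      R2.river_turn_cases[of e\<^sub>2] by (metis zero_neq_one)
qed

lemma crossing_path:
  assumes c: "crossing \<phi> e\<^sub>1 e\<^sub>2 l" and "h \<le> l"
  shows "arc_map \<phi> ((R2.ds ^^ h) e\<^sub>2) = (R1.ds ^^ h) e\<^sub>1"
  using assms(2)
proof (induction h)
  case 0
  then show ?case using c by (simp add: crossing_def)
next
  case (Suc h)
  have f: "(R1.ds ^^ h) e\<^sub>1 \<in> flow T\<^sub>1" "(R2.ds ^^ h) e\<^sub>2 \<in> flow T\<^sub>2"
    using c R1.ds_iter_flow R2.ds_iter_flow by (auto simp: crossing_def)
  have "plane_iso T\<^sub>2 T\<^sub>1 \<phi>" using c by (simp add: crossing_def)
  then show ?case using iso_ds(2)[OF _ f] Suc c by (simp add: crossing_def)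
qed

text \<open>Two edges that coincide under the superimposition are both reached from \<open>e\<^sub>1\<close> (or from its
  reversal) by the turns of the two rivers, and these turns agree only along the shared path.\<close>

lemma crossing_intersection:
  assumes c: "crossing \<phi> e\<^sub>1 e\<^sub>2 l" and f: "f \<in> flow T\<^sub>1" and g: "g \<in> flow T\<^sub>2"
    and fg: "arc_map \<phi> g = f \<or> arc_map \<phi> g = rev_arc f"
  shows "\<exists>h\<le>l. f = (R1.ds ^^ h) e\<^sub>1 \<and> g = (R2.ds ^^ h) e\<^sub>2"
proof -
  have iso: "plane_iso T\<^sub>2 T\<^sub>1 \<phi>" and e1: "e\<^sub>1 \<in> flow T\<^sub>1" and e2: "e\<^sub>2 \<in> flow T\<^sub>2"
    and e12: "arc_map \<phi> e\<^sub>2 = e\<^sub>1" using c by (auto simp: crossing_def)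
  obtain a1 where a1: "a1 \<in> flow T\<^sub>1" "R1.ds a1 = e\<^sub>1" "river_turn T\<^sub>1 a1 = 0"
    using c by (auto simp: crossing_def)
  obtain a2 where a2: "a2 \<in> flow T\<^sub>2" "R2.ds a2 = e\<^sub>2" "river_turn T\<^sub>2 a2 = 1"
    using c by (auto simp: crossing_def)
  have ar: "e\<^sub>1 \<in> arcs T\<^sub>1" "rev_arc e\<^sub>1 \<in> arcs T\<^sub>1" "e\<^sub>2 \<in> arcs T\<^sub>2" "rev_arc e\<^sub>2 \<in> arcs T\<^sub>2"
    using e1 e2 R1.flow_arcs R2.flow_arcs R1.arcs_closed R2.arcs_closed by auto
  \<comment> \<open>The first river turned left into \<open>e\<^sub>1\<close> and the second one
    right into \<open>e\<^sub>2\<close>, so on the way back their words start with the different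
    letters \<open>True\<close> and \<open>False\<close>.\<close>
  have F: "(\<exists>n. f = (R1.ds ^^ n) e\<^sub>1) \<or> (\<exists>w. rev_arc f = R1.walk (True # w) (rev_arc e\<^sub>1))"
  proof -
    obtain n where n: "f = (R1.ds ^^ n) e\<^sub>1 \<or> e\<^sub>1 = (R1.ds ^^ n) f" using R1.flow_connected[OF e1 f] by blast
    show ?thesis
    proof (cases "f = (R1.ds ^^ n) e\<^sub>1")
      case False
      then obtain i where "e\<^sub>1 = (R1.ds ^^ Suc i) f" using n by (cases n) auto
      then show ?thesis using R1.upstream_walk[OF a1(1) f, of i] a1 by auto
    qed blast
  qed
  have G: "(\<exists>n. g = (R2.ds ^^ n) e\<^sub>2) \<or> (\<exists>w. rev_arc g = R2.walk (False # w) (rev_arc e\<^sub>2))"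
  proof -
    obtain n where n: "g = (R2.ds ^^ n) e\<^sub>2 \<or> e\<^sub>2 = (R2.ds ^^ n) g" using R2.flow_connected[OF e2 g] by blast
    show ?thesis
    proof (cases "g = (R2.ds ^^ n) e\<^sub>2")
      case False
      then obtain i where "e\<^sub>2 = (R2.ds ^^ Suc i) g" using n by (cases n) auto
      then show ?thesis using R2.upstream_walk[OF a2(1) g, of i] a2 by auto
    qed blast
  qed
  have map_e: "arc_map \<phi> (R2.walk w e\<^sub>2) = R1.walk w e\<^sub>1" for w
    using iso_walk[OF iso ar(3), of w] by (simp only: e12)
  have map_r: "arc_map \<phi> (R2.walk w (rev_arc e\<^sub>2)) = R1.walk w (rev_arc e\<^sub>1)" for w
    using iso_walk[OF iso ar(4), of w] by (simp only: e12 arc_map_rev)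
  have gf: "arc_map \<phi> (rev_arc g) = f \<or> arc_map \<phi> (rev_arc g) = rev_arc f"
    using fg by (auto simp: arc_map_rev)
  show ?thesis
    using F G
  proof (elim disjE exE)
    fix i j assume i: "f = (R1.ds ^^ i) e\<^sub>1" and j: "g = (R2.ds ^^ j) e\<^sub>2"
    let ?w = "R1.flow_word e\<^sub>1 i" and ?v = "R2.flow_word e\<^sub>2 j"
    have fw: "R1.walk ?w e\<^sub>1 = f" "R2.walk ?v e\<^sub>2 = g"
      using R1.walk_flow_word[OF e1] R2.walk_flow_word[OF e2] i j by auto
    then have "arc_map \<phi> g = R1.walk ?v e\<^sub>1" using map_e by metis
    then have "R1.walk ?v e\<^sub>1 = R1.walk ?w e\<^sub>1" using fg fw(1) R1.walk_not_rev[OF ar(1)] by metis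
    then have vw: "?v = ?w" using R1.walk_inject[OF ar(1)] by blast
    then have ij: "i = j" by (metis R1.length_flow_word R2.length_flow_word)
    have "i \<le> l"
    proof (rule ccontr)
      assume "\<not> i \<le> l"
      then have "?w ! l \<longleftrightarrow> river_turn T\<^sub>1 ((R1.ds ^^ l) e\<^sub>1) = 1"
        "?v ! l \<longleftrightarrow> river_turn T\<^sub>2 ((R2.ds ^^ l) e\<^sub>2) = 1"
        using ij by (simp_all add: R1.flow_word_def R2.flow_word_def)
      moreover have "river_turn T\<^sub>1 ((R1.ds ^^ l) e\<^sub>1) = 1" "river_turn T\<^sub>2 ((R2.ds ^^ l) e\<^sub>2) = 0"
        using c unfolding crossing_def by blast+
      ultimately show False unfolding vw by simp
    qed
    then show ?thesis using i j ij by blast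
  next
    fix i w assume i: "f = (R1.ds ^^ i) e\<^sub>1" and w: "rev_arc g = R2.walk (False # w) (rev_arc e\<^sub>2)"
    have "arc_map \<phi> (rev_arc g) = R1.walk (False # w) (rev_arc e\<^sub>1)" using map_r w by metis
    moreover have "f = R1.walk (R1.flow_word e\<^sub>1 i) e\<^sub>1" using R1.walk_flow_word[OF e1] i by simp
    ultimately show ?thesis using gf R1.walk_opposite[OF ar(1), of "R1.flow_word e\<^sub>1 i" "False # w"]
      by (metis list.distinct(1) swap_swap)
  next
    fix j w assume w: "rev_arc f = R1.walk (True # w) (rev_arc e\<^sub>1)" and j: "g = (R2.ds ^^ j) e\<^sub>2"
    have "arc_map \<phi> g = R1.walk (R2.flow_word e\<^sub>2 j) e\<^sub>1"
      using map_e R2.walk_flow_word[OF e2] j by metis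
    then show ?thesis using fg w R1.walk_opposite[OF ar(1), of "R2.flow_word e\<^sub>2 j" "True # w"]
      by (metis list.distinct(1) swap_swap)
  next
    fix v w assume v: "rev_arc f = R1.walk (True # v) (rev_arc e\<^sub>1)"
      and w: "rev_arc g = R2.walk (False # w) (rev_arc e\<^sub>2)"
    have "arc_map \<phi> (rev_arc g) = R1.walk (False # w) (rev_arc e\<^sub>1)" using map_r w by metis
    then have "R1.walk (False # w) (rev_arc e\<^sub>1) = R1.walk (True # v) (rev_arc e\<^sub>1) \<or>
      R1.walk (False # w) (rev_arc e\<^sub>1) = rev_arc (R1.walk (True # v) (rev_arc e\<^sub>1))"
      using gf v by (metis swap_swap)
    then show ?thesis using R1.walk_not_rev[OF ar(2)] R1.walk_inject[OF ar(2)] by blast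
  qed
qed

text \<open>A second starting point would lie further along the shared path. There the turns just
  before it agree, whereas at a starting point they are 0 and 1.\<close>

lemma crossing_unique:
  assumes c: "crossing \<phi> e\<^sub>1 e\<^sub>2 l" and c': "crossing \<phi> e\<^sub>1' e\<^sub>2' l'"
  shows "e\<^sub>1' = e\<^sub>1 \<and> e\<^sub>2' = e\<^sub>2"
proof -
  have f: "e\<^sub>1' \<in> flow T\<^sub>1" "e\<^sub>2' \<in> flow T\<^sub>2" "arc_map \<phi> e\<^sub>2' = e\<^sub>1'" using c' by (auto simp: crossing_def)
  obtain h where h: "h \<le> l" "e\<^sub>1' = (R1.ds ^^ h) e\<^sub>1" "e\<^sub>2' = (R2.ds ^^ h) e\<^sub>2"
    using crossing_intersection[OF c f(1,2)] f(3) by blast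
  show ?thesis
  proof (cases h)
    case (Suc k)
    have e: "e\<^sub>1 \<in> flow T\<^sub>1" "e\<^sub>2 \<in> flow T\<^sub>2" using c by (auto simp: crossing_def)
    obtain a1 where a1: "a1 \<in> flow T\<^sub>1" "R1.ds a1 = e\<^sub>1'" "river_turn T\<^sub>1 a1 = 0"
      using c' by (auto simp: crossing_def)
    obtain a2 where a2: "a2 \<in> flow T\<^sub>2" "R2.ds a2 = e\<^sub>2'" "river_turn T\<^sub>2 a2 = 1"
      using c' by (auto simp: crossing_def)
    have "a1 = (R1.ds ^^ k) e\<^sub>1"
      using R1.ds_inject[OF a1(1) R1.ds_iter_flow[OF e(1)], of k] a1(2) h(2) Suc by simp
    moreover have "a2 = (R2.ds ^^ k) e\<^sub>2"
      using R2.ds_inject[OF a2(1) R2.ds_iter_flow[OF e(2)], of k] a2(2) h(3) Suc by simp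
    moreover have "river_turn T\<^sub>1 ((R1.ds ^^ k) e\<^sub>1) = river_turn T\<^sub>2 ((R2.ds ^^ k) e\<^sub>2)"
      using c h(1) Suc by (simp add: crossing_def)
    ultimately show ?thesis using a1(3) a2(3) by simp
  qed (use h in simp)
qed

lemma crossing_RS:
  assumes c: "crossing \<phi> e\<^sub>1 e\<^sub>2 l" shows "\<phi> \<in> RS_superimpositions T\<^sub>1 T\<^sub>2"
proof -
  have iso: "plane_iso T\<^sub>2 T\<^sub>1 \<phi>" and e1: "e\<^sub>1 \<in> flow T\<^sub>1" and e2: "e\<^sub>2 \<in> flow T\<^sub>2"
    and e12: "arc_map \<phi> e\<^sub>2 = e\<^sub>1" using c by (auto simp: crossing_def)
  obtain a1 where a1: "a1 \<in> flow T\<^sub>1" "R1.ds a1 = e\<^sub>1" "river_turn T\<^sub>1 a1 = 0"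
    using c by (auto simp: crossing_def)
  obtain a2 where a2: "a2 \<in> flow T\<^sub>2" "R2.ds a2 = e\<^sub>2" "river_turn T\<^sub>2 a2 = 1"
    using c by (auto simp: crossing_def)
  define p where "p = map (\<lambda>h. (R1.ds ^^ h) e\<^sub>1) [0..<Suc l]"
  define d where "d = arc_map \<phi> a2"
  define x where "x = arc_map \<phi> ((R2.ds ^^ Suc l) e\<^sub>2)"
  have path: "\<And>h. h \<le> l \<Longrightarrow> arc_map \<phi> ((R2.ds ^^ h) e\<^sub>2) = (R1.ds ^^ h) e\<^sub>1"
    using crossing_path[OF c] .
  \<comment> \<open>All entries are images of consecutive flow arcs of the second river: one before
    the shared path, its l + 1 arcs, and one after it.\<close>
  have all: "d # p @ [x] = arc_map \<phi> a2 # map (\<lambda>h. arc_map \<phi> ((R2.ds ^^ h) e\<^sub>2)) [0..<Suc (Suc l)]"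
    by (simp add: d_def x_def p_def path)
  have e1_left: "e\<^sub>1 = left_arc T\<^sub>1 a1" using a1 R1.ds_left by metis
  have e2_right: "e\<^sub>2 = right_arc T\<^sub>2 a2" using a2 R2.ds_right by metis
  \<comment> \<open>At the first shared vertex \<open>e\<^sub>1\<close> is the left branch seen from
    \<open>a1\<close> and the right branch seen from \<open>d\<close>, so \<open>d\<close> must come
    in through the branch to the right of \<open>a1\<close>.\<close>
  have rev_d: "rev_arc d = right_arc T\<^sub>1 a1"
  proof -
    have "right_arc T\<^sub>1 a1 = left_arc T\<^sub>1 (rev_arc e\<^sub>1)"
      using R1.turn_relations(1)[OF R1.flow_arcs[OF a1(1)]] e1_left by simp
    also have "rev_arc e\<^sub>1 = arc_map \<phi> (rev_arc e\<^sub>2)" by (simp only: e12 arc_map_rev)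
    also have "left_arc T\<^sub>1 \<dots> = arc_map \<phi> (left_arc T\<^sub>2 (rev_arc e\<^sub>2))"
      by (rule iso_turns(1)[OF iso, symmetric]) (use e2 R2.flow_arcs R2.arcs_closed in blast)
    also have "left_arc T\<^sub>2 (rev_arc e\<^sub>2) = rev_arc a2"
      using R2.turn_relations(3)[OF R2.flow_arcs[OF a2(1)]] e2_right by simp
    finally show ?thesis by (simp only: d_def arc_map_rev)
  qed
  have right: "on_right_bank T\<^sub>1 (rev_arc d)"
    unfolding on_right_bank_def rev_d using R1.right_off_river[OF a1(1)] a1 by auto
  have fl: "(R1.ds ^^ l) e\<^sub>1 \<in> flow T\<^sub>1" "(R2.ds ^^ l) e\<^sub>2 \<in> flow T\<^sub>2"
    using R1.ds_iter_flow[OF e1] R2.ds_iter_flow[OF e2] by auto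
  have "x = left_arc T\<^sub>1 ((R1.ds ^^ l) e\<^sub>1)"
    using iso_ds(1)[OF iso fl path] c by (simp add: x_def crossing_def R1.turn_arc_def)
  then have left: "on_left_bank T\<^sub>1 x"
    unfolding on_left_bank_def using R1.left_off_river[OF fl(1)] fl(1) c by (auto simp: crossing_def)
  have set_p: "set p = (\<lambda>h. (R1.ds ^^ h) e\<^sub>1) ` {..l}"
    unfolding p_def by (simp add: lessThan_Suc_atMost atLeast0LessThan del: upt_Suc)
  have p_flow: "set p \<subseteq> flow T\<^sub>1" using R1.ds_iter_flow[OF e1] by (auto simp: set_p)
  have "river T\<^sub>1 \<inter> arc_map \<phi> ` river T\<^sub>2 = set p \<union> rev_arc ` set p"
  proof (intro equalityI subsetI)
    fix y assume y: "y \<in> river T\<^sub>1 \<inter> arc_map \<phi> ` river T\<^sub>2"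
    obtain f where f: "f \<in> flow T\<^sub>1" "y = f \<or> y = rev_arc f"
      using IntD1[OF y] R1.river_iff by (metis swap_swap)
    obtain z where z: "z \<in> river T\<^sub>2" "y = arc_map \<phi> z" using IntD2[OF y] by (rule imageE)
    obtain g where g: "g \<in> flow T\<^sub>2" "z = g \<or> z = rev_arc g" using z(1) R2.river_iff by (metis swap_swap)
    have "arc_map \<phi> g = f \<or> arc_map \<phi> g = rev_arc f"
      using f(2) g(2) z(2) by (metis arc_map_rev swap_swap)
    then obtain h where "h \<le> l" "f = (R1.ds ^^ h) e\<^sub>1"
      using crossing_intersection[OF c f(1) g(1)] by blast
    then have "f \<in> set p" by (simp add: set_p)
    then show "y \<in> set p \<union> rev_arc ` set p" using f(2) by blast
  next
    fix y assume "y \<in> set p \<union> rev_arc ` set p"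
    then obtain h where h: "h \<le> l" "y = (R1.ds ^^ h) e\<^sub>1 \<or> y = rev_arc ((R1.ds ^^ h) e\<^sub>1)"
      by (auto simp: set_p)
    have r: "(R1.ds ^^ h) e\<^sub>1 \<in> flow T\<^sub>1" "(R2.ds ^^ h) e\<^sub>2 \<in> flow T\<^sub>2"
      using R1.ds_iter_flow[OF e1] R2.ds_iter_flow[OF e2] by auto
    have 1: "(R1.ds ^^ h) e\<^sub>1 \<in> river T\<^sub>1" "rev_arc ((R1.ds ^^ h) e\<^sub>1) \<in> river T\<^sub>1"
      "(R2.ds ^^ h) e\<^sub>2 \<in> river T\<^sub>2" "rev_arc ((R2.ds ^^ h) e\<^sub>2) \<in> river T\<^sub>2"
      using r by (simp_all add: R1.river_iff R2.river_iff)
    have "(R1.ds ^^ h) e\<^sub>1 \<in> arc_map \<phi> ` river T\<^sub>2" using path[OF h(1)] 1(3) by (metis imageI)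
    moreover have "rev_arc ((R1.ds ^^ h) e\<^sub>1) \<in> arc_map \<phi> ` river T\<^sub>2"
      using path[OF h(1)] 1(4) by (metis imageI arc_map_rev)
    ultimately show "y \<in> river T\<^sub>1 \<inter> arc_map \<phi> ` river T\<^sub>2" using h(2) 1(1,2) by (metis IntI)
  qed
  moreover have "set (d # p @ [x]) \<subseteq> arc_map \<phi> ` flow T\<^sub>2"
    unfolding all using a2(1) R2.ds_iter_flow[OF e2] by (auto simp del: upt_Suc funpow.simps)
  moreover have "successively (\<lambda>a b. snd a = fst b) (d # p @ [x])"
    unfolding all
  proof (subst successively_Cons, intro conjI disjI2)
    have "fst (hd (map (\<lambda>h. arc_map \<phi> ((R2.ds ^^ h) e\<^sub>2)) [0..<Suc (Suc l)])) = \<phi> (fst e\<^sub>2)"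
      by (simp add: upt_rec)
    then show "snd (arc_map \<phi> a2) = fst (hd (map (\<lambda>h. arc_map \<phi> ((R2.ds ^^ h) e\<^sub>2)) [0..<Suc (Suc l)]))"
      using a2(2) R2.fst_ds[of a2] by simp
    show "successively (\<lambda>a b. snd a = fst b) (map (\<lambda>h. arc_map \<phi> ((R2.ds ^^ h) e\<^sub>2)) [0..<Suc (Suc l)])"
      by (subst successively_conv_nth) (simp del: upt_Suc)
  qed
  moreover have "p \<noteq> []" by (simp add: p_def)
  ultimately have "cross_along T\<^sub>1 T\<^sub>2 \<phi> p d x" unfolding cross_along_def using right left by blast
  then show ?thesis
    unfolding RS_superimpositions_def superimposition_def using iso right p_flow by blast
qed

text \<open>The bank conditions at the two ends of the path determine both rivers' turns there, and
  adjacency of the arcs forces the path to follow both flows in between.\<close>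

lemma RS_crossing:
  assumes RS: "\<phi> \<in> RS_superimpositions T\<^sub>1 T\<^sub>2" shows "\<exists>e\<^sub>1 e\<^sub>2 l. crossing \<phi> e\<^sub>1 e\<^sub>2 l"
proof -
  obtain p d x where iso: "plane_iso T\<^sub>2 T\<^sub>1 \<phi>" and cr: "cross_along T\<^sub>1 T\<^sub>2 \<phi> p d x"
    and right: "on_right_bank T\<^sub>1 (rev_arc d)" and p_flow: "set p \<subseteq> flow T\<^sub>1"
    using RS unfolding RS_superimpositions_def superimposition_def by blast
  have pne: "p \<noteq> []" and im: "set (d # p @ [x]) \<subseteq> arc_map \<phi> ` flow T\<^sub>2"
    and succ: "successively (\<lambda>a b. snd a = fst b) (d # p @ [x])"
    using cr by (auto simp: cross_along_def)
  have inj: "\<phi> u = \<phi> v \<Longrightarrow> u = v" for u v using iso by (auto simp: plane_iso_def bij_def inj_def)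
  have preimage: "\<exists>g\<in>flow T\<^sub>2. arc_map \<phi> g = y" if "y \<in> set (d # p @ [x])" for y
    using subsetD[OF im that] by (elim imageE) metis
  obtain a2 where a2: "a2 \<in> flow T\<^sub>2" "arc_map \<phi> a2 = d" using preimage[of d] by auto
  have "rev_arc d = arc_map \<phi> (rev_arc a2)" using a2(2) by (simp add: arc_map_rev)
  then have "rev_arc d \<in> arcs T\<^sub>1"
    using iso_arcs[OF iso, of "rev_arc a2"] R2.arcs_closed(1)[OF R2.flow_arcs[OF a2(1)]] by simp
  \<comment> \<open>The other alternative of \<open>cross_along\<close> would put the reversal of
    \<open>d\<close> on both banks.\<close>
  then have left: "on_left_bank T\<^sub>1 x"
    using cr right R1.banks_disjoint unfolding cross_along_def by blast
  define e\<^sub>1 where "e\<^sub>1 = hd p"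
  have e1: "e\<^sub>1 \<in> flow T\<^sub>1" using p_flow pne by (auto simp: e\<^sub>1_def)
  have "e\<^sub>1 \<in> set (d # p @ [x])" using pne by (simp add: e\<^sub>1_def)
  then obtain e\<^sub>2 where e2: "e\<^sub>2 \<in> flow T\<^sub>2" "arc_map \<phi> e\<^sub>2 = e\<^sub>1" using preimage by metis
  define l where "l = length p - 1"
  have len: "length p = Suc l" using pne by (simp add: l_def)
  have adj: "snd ((d # p @ [x]) ! i) = fst ((d # p @ [x]) ! Suc i)" if "i \<le> Suc l" for i
    using succ that len by (auto simp: successively_conv_nth)
  have "snd d = fst e\<^sub>1" using adj[of 0] len pne by (simp add: e\<^sub>1_def hd_conv_nth nth_append)
  then have "\<phi> (snd a2) = \<phi> (fst e\<^sub>2)" using a2(2) e2(2) by (metis fst_map_prod snd_map_prod)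
  then have e2_ds: "e\<^sub>2 = R2.ds a2" using inj R2.flow_next_unique[OF a2(1) e2(1)] by metis
  obtain a1 where a1: "a1 \<in> flow T\<^sub>1" "rev_arc d = right_arc T\<^sub>1 a1" "rev_arc d \<notin> river T\<^sub>1"
    using right by (auto simp: on_right_bank_def)
  have "right_arc T\<^sub>1 a1 \<notin> river T\<^sub>1" using a1(2,3) by simp
  moreover have "right_arc T\<^sub>1 a1 \<notin> flow T\<^sub>1" using calculation R1.river_iff by blast
  ultimately have t1: "river_turn T\<^sub>1 a1 = 0" using R1.right_off_river[OF a1(1)] by blast
  have "snd a1 = fst (rev_arc d)" by (simp only: a1(2) R1.fst_right_arc)
  then have e1_ds: "e\<^sub>1 = R1.ds a1"
    using \<open>snd d = fst e\<^sub>1\<close> R1.flow_next_unique[OF a1(1) e1] by simp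
  have t2: "river_turn T\<^sub>2 a2 = 1"
  proof -
    have "e\<^sub>1 = left_arc T\<^sub>1 a1" using e1_ds R1.ds_left[OF t1] by simp
    also have "\<dots> = right_arc T\<^sub>1 (rev_arc (right_arc T\<^sub>1 a1))"
      using R1.turn_relations(4)[OF R1.flow_arcs[OF a1(1)]] by simp
    also have "rev_arc (right_arc T\<^sub>1 a1) = arc_map \<phi> a2"
      unfolding a1(2)[symmetric] by (simp add: a2(2))
    also have "right_arc T\<^sub>1 (arc_map \<phi> a2) = arc_map \<phi> (right_arc T\<^sub>2 a2)"
      using iso_turns(2)[OF iso R2.flow_arcs[OF a2(1)]] by simp
    finally have "e\<^sub>2 = right_arc T\<^sub>2 a2" using iso_inj[OF iso] e2(2) by metis
    then show ?thesis
      using R2.right_off_river[OF a2(1)] R2.river_turn_cases[of a2] e2(1) by auto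
  qed
  have path: "p ! h = (R1.ds ^^ h) e\<^sub>1 \<and> arc_map \<phi> ((R2.ds ^^ h) e\<^sub>2) = (R1.ds ^^ h) e\<^sub>1" if "h \<le> l" for h
    using that
  proof (induction h)
    case 0
    then show ?case using e2(2) pne by (simp add: e\<^sub>1_def hd_conv_nth)
  next
    case (Suc h)
    then have IH: "p ! h = (R1.ds ^^ h) e\<^sub>1" "arc_map \<phi> ((R2.ds ^^ h) e\<^sub>2) = (R1.ds ^^ h) e\<^sub>1" by auto
    have "snd (p ! h) = fst (p ! Suc h)" using adj[of "Suc h"] Suc.prems len by (simp add: nth_append)
    then have adj': "fst (p ! Suc h) = snd ((R1.ds ^^ h) e\<^sub>1)" by (simp add: IH(1))
    have mem: "p ! Suc h \<in> set p" using Suc.prems len by simp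
    then have 1: "p ! Suc h = R1.ds ((R1.ds ^^ h) e\<^sub>1)"
      using R1.flow_next_unique[OF R1.ds_iter_flow[OF e1]] adj' p_flow by blast
    have "p ! Suc h \<in> set (d # p @ [x])" using mem by simp
    then obtain g where g: "g \<in> flow T\<^sub>2" "arc_map \<phi> g = p ! Suc h" using preimage by metis
    have "\<phi> (fst g) = \<phi> (snd ((R2.ds ^^ h) e\<^sub>2))"
      using g(2) adj' IH(2) by (metis fst_map_prod snd_map_prod)
    then have "g = R2.ds ((R2.ds ^^ h) e\<^sub>2)"
      using R2.flow_next_unique[OF R2.ds_iter_flow[OF e2(1)] g(1)] inj by blast
    then show ?case using 1 g(2) by simp
  qed
  have fl: "(R1.ds ^^ h) e\<^sub>1 \<in> flow T\<^sub>1" "(R2.ds ^^ h) e\<^sub>2 \<in> flow T\<^sub>2" for h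
    using R1.ds_iter_flow[OF e1] R2.ds_iter_flow[OF e2(1)] by auto
  have agree: "river_turn T\<^sub>1 ((R1.ds ^^ h) e\<^sub>1) = river_turn T\<^sub>2 ((R2.ds ^^ h) e\<^sub>2)" if "h < l" for h
    using iso_ds(2)[OF iso fl[of h] conjunct2[OF path]] path[of "Suc h"] that by simp
  obtain a where a: "a \<in> flow T\<^sub>1" "x = left_arc T\<^sub>1 a" "x \<notin> river T\<^sub>1"
    using left by (auto simp: on_left_bank_def)
  have snd_last: "fst x = snd ((R1.ds ^^ l) e\<^sub>1)"
    using adj[of "Suc l"] len path[of l] by (simp add: nth_append)
  \<comment> \<open>The bank condition only provides some flow arc \<open>a\<close>; as flow arcs
    have distinct heads, it is the last shared one.\<close>
  then have a_eq: "a = (R1.ds ^^ l) e\<^sub>1"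
    using R1.flow_prev_unique[OF a(1) fl(1)] a(2) by (metis R1.fst_left_arc)
  have "left_arc T\<^sub>1 a \<notin> flow T\<^sub>1" using a(2,3) R1.river_iff by blast
  then have turn1: "river_turn T\<^sub>1 ((R1.ds ^^ l) e\<^sub>1) = 1" by (simp add: river_turn_def flip: a_eq)
  obtain g where g: "g \<in> flow T\<^sub>2" "arc_map \<phi> g = x" using preimage[of x] by auto
  have "\<phi> (fst g) = \<phi> (snd ((R2.ds ^^ l) e\<^sub>2))"
    using g(2) snd_last path[of l] by (metis fst_map_prod snd_map_prod order_refl)
  then have "g = R2.ds ((R2.ds ^^ l) e\<^sub>2)" using R2.flow_next_unique[OF fl(2) g(1)] inj by blast
  then have "x = R1.turn_arc (river_turn T\<^sub>2 ((R2.ds ^^ l) e\<^sub>2) = 1) ((R1.ds ^^ l) e\<^sub>1)"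
    using iso_ds(1)[OF iso fl(1,2)[of l] conjunct2[OF path]] g(2) by simp
  then have "snd (R1.turn_arc (river_turn T\<^sub>2 ((R2.ds ^^ l) e\<^sub>2) = 1) a) = snd (R1.turn_arc False a)"
    using a(2) a_eq by (simp add: R1.turn_arc_def)
  then have "river_turn T\<^sub>2 ((R2.ds ^^ l) e\<^sub>2) \<noteq> 1"
    using R1.turn_arc_inject[OF R1.flow_arcs[OF a(1)]] by blast
  then have turn2: "river_turn T\<^sub>2 ((R2.ds ^^ l) e\<^sub>2) = 0" using R2.river_turn_cases by blast
  have "crossing \<phi> e\<^sub>1 e\<^sub>2 l"
    unfolding crossing_def
    by (intro conjI bexI[of _ a1] bexI[of _ a2] allI impI iso e1 e2 a1(1) a2(1) t1 t2 agree turn1 turn2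
        e1_ds[symmetric] e2_ds[symmetric])
  then show ?thesis by blast
qed

section \<open>Counting the crossings\<close>

text \<open>The positions of the first shared edge in the two cyclic sequences form a complete
  invariant of a crossing modulo translations. It is introduced as a relation, so that the choice in
  \<open>key\<close> is made only once uniqueness and existence can be stated.\<close>

definition has_key :: "('w \<Rightarrow> 'v) \<Rightarrow> nat \<times> nat \<Rightarrow> bool" where
  "has_key \<phi> = (\<lambda>(i, j). \<exists>e\<^sub>1 e\<^sub>2 l. crossing \<phi> e\<^sub>1 e\<^sub>2 l \<and> R1.river_pos e\<^sub>1 i \<and> R2.river_pos e\<^sub>2 j)"

definition key :: "('w \<Rightarrow> 'v) \<Rightarrow> nat \<times> nat" where
  "key \<phi> = (SOME p. has_key \<phi> p)"

definition keys :: "(nat \<times> nat) set" where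
  "keys = diverging_pairs r\<^sub>1 r\<^sub>2
    (shift (length r\<^sub>1) (letter_indices r\<^sub>1 0) 1) (shift (length r\<^sub>2) (letter_indices r\<^sub>2 1) 1)"

lemma keys_subset: "keys \<subseteq> {..<length r\<^sub>1} \<times> {..<length r\<^sub>2}"
  unfolding keys_def diverging_pairs_def shift_letter_indices_iff[OF R1.period_pos]
    shift_letter_indices_iff[OF R2.period_pos] by auto

lemma has_key_unique: "has_key \<phi> p \<Longrightarrow> has_key \<phi> p' \<Longrightarrow> p = p'"
proof -
  assume p: "has_key \<phi> p" and p': "has_key \<phi> p'"
  obtain i j i' j' where ij: "p = (i, j)" "p' = (i', j')" by (cases p; cases p')
  obtain e\<^sub>1 e\<^sub>2 l where 1: "crossing \<phi> e\<^sub>1 e\<^sub>2 l" "R1.river_pos e\<^sub>1 i" "R2.river_pos e\<^sub>2 j"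
    using p unfolding has_key_def ij prod.case by blast
  obtain f\<^sub>1 f\<^sub>2 l' where 2: "crossing \<phi> f\<^sub>1 f\<^sub>2 l'" "R1.river_pos f\<^sub>1 i'" "R2.river_pos f\<^sub>2 j'"
    using p' unfolding has_key_def ij prod.case by blast
  have "f\<^sub>1 = e\<^sub>1" "f\<^sub>2 = e\<^sub>2" using crossing_unique[OF 1(1) 2(1)] by auto
  then show "p = p'" using R1.pos_unique[OF 1(2), of i'] R2.pos_unique[OF 1(3), of j'] 2 ij by simp
qed

lemma RS_has_key: "\<phi> \<in> RS_superimpositions T\<^sub>1 T\<^sub>2 \<longleftrightarrow> (\<exists>p. has_key \<phi> p)"
proof
  assume "\<phi> \<in> RS_superimpositions T\<^sub>1 T\<^sub>2"
  then obtain e\<^sub>1 e\<^sub>2 l where c: "crossing \<phi> e\<^sub>1 e\<^sub>2 l" using RS_crossing by blast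
  then obtain i j where "R1.river_pos e\<^sub>1 i" "R2.river_pos e\<^sub>2 j"
    using R1.pos_exists R2.pos_exists unfolding crossing_def by metis
  then have "has_key \<phi> (i, j)" unfolding has_key_def prod.case using c by blast
  then show "\<exists>p. has_key \<phi> p" by blast
next
  assume "\<exists>p. has_key \<phi> p"
  then obtain i j where "has_key \<phi> (i, j)" by (metis surj_pair)
  then show "\<phi> \<in> RS_superimpositions T\<^sub>1 T\<^sub>2" using crossing_RS unfolding has_key_def prod.case by blast
qed

lemma key_iff: "has_key \<phi> p \<longleftrightarrow> \<phi> \<in> RS_superimpositions T\<^sub>1 T\<^sub>2 \<and> key \<phi> = p"
proof -
  have "has_key \<phi> (key \<phi>)" if "has_key \<phi> p" for p unfolding key_def using that by (rule someI)
  then show ?thesis using has_key_unique RS_has_key by metis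
qed

text \<open>Given which edges are identified, the remaining conditions concern only turns before and
  after them, and these are letters of \<open>r\<^sub>1\<close> and \<open>r\<^sub>2\<close> at
  indices determined by the positions.\<close>

lemma crossing_in_keys:
  assumes iso: "plane_iso T\<^sub>2 T\<^sub>1 \<phi>" and e1: "e\<^sub>1 \<in> flow T\<^sub>1" and e2: "e\<^sub>2 \<in> flow T\<^sub>2" and e12: "arc_map \<phi> e\<^sub>2 = e\<^sub>1"
    and pos: "R1.river_pos e\<^sub>1 i" "R2.river_pos e\<^sub>2 j"
  shows "(\<exists>l. crossing \<phi> e\<^sub>1 e\<^sub>2 l) \<longleftrightarrow> (i, j) \<in> keys"
proof -
  obtain a1 where a1: "a1 \<in> flow T\<^sub>1" "R1.ds a1 = e\<^sub>1" using R1.upstream_exists[OF e1] by blast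
  obtain a2 where a2: "a2 \<in> flow T\<^sub>2" "R2.ds a2 = e\<^sub>2" using R2.upstream_exists[OF e2] by blast
  have 1: "(\<exists>a\<in>flow T\<^sub>1. R1.ds a = e\<^sub>1 \<and> river_turn T\<^sub>1 a = 0) \<longleftrightarrow>
      r\<^sub>1 ! ((i + length r\<^sub>1 - 1) mod length r\<^sub>1) = 0"
    using R1.pos_prev_turn[of _ i] pos(1) a1 by metis
  have 2: "(\<exists>a\<in>flow T\<^sub>2. R2.ds a = e\<^sub>2 \<and> river_turn T\<^sub>2 a = 1) \<longleftrightarrow>
      r\<^sub>2 ! ((j + length r\<^sub>2 - 1) mod length r\<^sub>2) = 1"
    using R2.pos_prev_turn[of _ j] pos(2) a2 by metis
  have "(\<exists>l. crossing \<phi> e\<^sub>1 e\<^sub>2 l) \<longleftrightarrow> r\<^sub>1 ! ((i + length r\<^sub>1 - 1) mod length r\<^sub>1) = 0 \<and>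
      r\<^sub>2 ! ((j + length r\<^sub>2 - 1) mod length r\<^sub>2) = 1 \<and> diverges r\<^sub>1 r\<^sub>2 i j"
    unfolding crossing_def diverges_def 1 2 R1.pos_turn[OF pos(1)] R2.pos_turn[OF pos(2)]
    using iso e1 e2 e12 by blast
  also have "\<dots> \<longleftrightarrow> (i, j) \<in> keys"
    unfolding keys_def diverging_pairs_def mem_Collect_eq case_prod_conv
      shift_letter_indices_iff[OF R1.period_pos] shift_letter_indices_iff[OF R2.period_pos]
    using R1.pos_less[OF pos(1)] R2.pos_less[OF pos(2)] by blast
  finally show ?thesis .
qed

text \<open>Every admissible pair of positions occurs: choose flow arcs at these positions and an
  isomorphism identifying them.\<close>

lemma key_image: "key ` RS_superimpositions T\<^sub>1 T\<^sub>2 = keys"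
proof (intro equalityI subsetI)
  fix p assume "p \<in> key ` RS_superimpositions T\<^sub>1 T\<^sub>2"
  then obtain \<phi> where "has_key \<phi> p" unfolding key_iff by (elim imageE) metis
  moreover obtain i j where "p = (i, j)" by (cases p)
  ultimately obtain e\<^sub>1 e\<^sub>2 l where "p = (i, j)" "crossing \<phi> e\<^sub>1 e\<^sub>2 l" "R1.river_pos e\<^sub>1 i" "R2.river_pos e\<^sub>2 j"
    unfolding has_key_def by auto
  then show "p \<in> keys" using crossing_in_keys[of \<phi> e\<^sub>1 e\<^sub>2 i j] unfolding crossing_def by blast
next
  fix p assume p: "p \<in> keys"
  obtain i j where ij: "p = (i, j)" by (cases p)
  then have less: "i < length r\<^sub>1" "j < length r\<^sub>2" using p keys_subset by auto
  obtain e\<^sub>1 where e1: "e\<^sub>1 \<in> flow T\<^sub>1" "R1.river_pos e\<^sub>1 i" using R1.pos_realized[OF less(1)] .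
  obtain e\<^sub>2 where e2: "e\<^sub>2 \<in> flow T\<^sub>2" "R2.river_pos e\<^sub>2 j" using R2.pos_realized[OF less(2)] .
  obtain \<phi> where "plane_iso T\<^sub>2 T\<^sub>1 \<phi>" "arc_map \<phi> e\<^sub>2 = e\<^sub>1"
    using iso_exists[OF R2.flow_arcs[OF e2(1)] R1.flow_arcs[OF e1(1)]] by blast
  then have "\<exists>l. crossing \<phi> e\<^sub>1 e\<^sub>2 l" using crossing_in_keys[OF _ e1(1) e2(1) _ e1(2) e2(2)] p ij by blast
  then have "has_key \<phi> p" unfolding has_key_def ij prod.case using e1(2) e2(2) by blast
  then show "p \<in> key ` RS_superimpositions T\<^sub>1 T\<^sub>2" unfolding key_iff by (metis imageI)
qed

lemma has_key_translate:
  assumes k: "has_key \<phi> (i, j)" and s: "R1.form_aut \<sigma>" and t: "R2.form_aut \<tau>"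
    and RS: "\<sigma> \<circ> \<phi> \<circ> \<tau> \<in> RS_superimpositions T\<^sub>1 T\<^sub>2"
  shows "has_key (\<sigma> \<circ> \<phi> \<circ> \<tau>) (i, j)"
proof -
  obtain e\<^sub>1 e\<^sub>2 l where c: "crossing \<phi> e\<^sub>1 e\<^sub>2 l" and pos: "R1.river_pos e\<^sub>1 i" "R2.river_pos e\<^sub>2 j"
    using k unfolding has_key_def prod.case by blast
  have e: "e\<^sub>1 \<in> flow T\<^sub>1" "e\<^sub>2 \<in> flow T\<^sub>2" "arc_map \<phi> e\<^sub>2 = e\<^sub>1" using c by (auto simp: crossing_def)
  have t': "R2.form_aut (inv \<tau>)" using t R2.form_aut_inv by blast
  \<comment> \<open>Since \<tau> is applied before \<phi>, the matching arc of the second river is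
    moved by the inverse of \<tau>.\<close>
  let ?f1 = "arc_map \<sigma> e\<^sub>1" and ?f2 = "arc_map (inv \<tau>) e\<^sub>2"
  have "\<tau> (inv \<tau> v) = v" for v
    using t by (simp add: R2.form_aut_def plane_iso_def bij_is_surj surj_f_inv_f)
  then have "arc_map (\<sigma> \<circ> \<phi> \<circ> \<tau>) ?f2 = ?f1" unfolding e(3)[symmetric] by (cases e\<^sub>2) simp
  moreover have "?f1 \<in> flow T\<^sub>1" "?f2 \<in> flow T\<^sub>2" using R1.form_aut_flow[OF s] R2.form_aut_flow[OF t'] e by auto
  moreover have pos': "R1.river_pos ?f1 i" "R2.river_pos ?f2 j"
    using R1.form_aut_pos[OF s] R2.form_aut_pos[OF t'] e pos by auto
  moreover have "plane_iso T\<^sub>2 T\<^sub>1 (\<sigma> \<circ> \<phi> \<circ> \<tau>)"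
    using RS by (simp add: RS_superimpositions_def superimposition_def)
  moreover have "(i, j) \<in> keys"
    using k key_iff key_image by (metis imageI)
  ultimately have "\<exists>l. crossing (\<sigma> \<circ> \<phi> \<circ> \<tau>) ?f1 ?f2 l"
    using crossing_in_keys[of "\<sigma> \<circ> \<phi> \<circ> \<tau>" ?f1 ?f2 i j] by blast
  then show ?thesis unfolding has_key_def prod.case using pos' by blast
qed

text \<open>Translations carry the starting edges of one crossing to those of the other, and
  isomorphisms that agree on a single arc are equal.\<close>

lemma same_key_translate:
  assumes k: "has_key \<phi> (i, j)" and k': "has_key \<psi> (i, j)"
    and s: "river_translation T\<^sub>1 \<sigma>" and t: "river_translation T\<^sub>2 \<tau>"
  shows "\<exists>a b. \<psi> = int_iterate \<sigma> a \<circ> \<phi> \<circ> int_iterate \<tau> b"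
proof -
  obtain e\<^sub>1 e\<^sub>2 l where c: "crossing \<phi> e\<^sub>1 e\<^sub>2 l" and pos: "R1.river_pos e\<^sub>1 i" "R2.river_pos e\<^sub>2 j"
    using k unfolding has_key_def prod.case by blast
  obtain f\<^sub>1 f\<^sub>2 l' where c': "crossing \<psi> f\<^sub>1 f\<^sub>2 l'" and pos': "R1.river_pos f\<^sub>1 i" "R2.river_pos f\<^sub>2 j"
    using k' unfolding has_key_def prod.case by blast
  have e: "e\<^sub>1 \<in> flow T\<^sub>1" "e\<^sub>2 \<in> flow T\<^sub>2" "arc_map \<phi> e\<^sub>2 = e\<^sub>1" "plane_iso T\<^sub>2 T\<^sub>1 \<phi>"
    using c by (auto simp: crossing_def)
  have f: "f\<^sub>1 \<in> flow T\<^sub>1" "f\<^sub>2 \<in> flow T\<^sub>2" "arc_map \<psi> f\<^sub>2 = f\<^sub>1" "plane_iso T\<^sub>2 T\<^sub>1 \<psi>"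
    using c' by (auto simp: crossing_def)
  obtain a where a: "arc_map (int_iterate \<sigma> a) e\<^sub>1 = f\<^sub>1"
    using R1.river_translation_transitive[OF s e(1) f(1) pos(1) pos'(1)] by blast
  obtain b where b: "arc_map (int_iterate \<tau> b) f\<^sub>2 = e\<^sub>2"
    using R2.river_translation_transitive[OF t f(2) e(2) pos'(2) pos(2)] by blast
  have "plane_iso T\<^sub>1 T\<^sub>1 (int_iterate \<sigma> a)" "plane_iso T\<^sub>2 T\<^sub>2 (int_iterate \<tau> b)"
    using R1.form_aut_int_iterate[OF R1.river_translation_aut[OF s], of a]
      R2.form_aut_int_iterate[OF R2.river_translation_aut[OF t], of b]
    by (auto simp: R1.form_aut_def R2.form_aut_def)
  then have "plane_iso T\<^sub>2 T\<^sub>1 (int_iterate \<sigma> a \<circ> \<phi> \<circ> int_iterate \<tau> b)"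
    by (intro plane_iso_comp[OF _ plane_iso_comp[OF e(4)]])
  moreover have "arc_map (int_iterate \<sigma> a \<circ> \<phi> \<circ> int_iterate \<tau> b) f\<^sub>2 = arc_map \<psi> f\<^sub>2"
    unfolding f(3) a[symmetric] e(3)[symmetric] b[symmetric] by (cases f\<^sub>2) simp
  ultimately show ?thesis using iso_unique[OF f(4) _ R2.flow_arcs[OF f(2)]] by metis
qed

lemma RS_equiv_iff:
  "(\<phi>, \<psi>) \<in> RS_equiv T\<^sub>1 T\<^sub>2 \<longleftrightarrow>
    \<phi> \<in> RS_superimpositions T\<^sub>1 T\<^sub>2 \<and> \<psi> \<in> RS_superimpositions T\<^sub>1 T\<^sub>2 \<and> key \<phi> = key \<psi>"
proof
  assume "(\<phi>, \<psi>) \<in> RS_equiv T\<^sub>1 T\<^sub>2"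
  then obtain \<sigma> \<tau> a b where RS: "\<phi> \<in> RS_superimpositions T\<^sub>1 T\<^sub>2" "\<psi> \<in> RS_superimpositions T\<^sub>1 T\<^sub>2"
    and st: "river_translation T\<^sub>1 \<sigma>" "river_translation T\<^sub>2 \<tau>"
    and eq: "\<psi> = int_iterate \<sigma> a \<circ> \<phi> \<circ> int_iterate \<tau> b"
    unfolding RS_equiv_def by blast
  obtain i j where ij: "key \<phi> = (i, j)" by (cases "key \<phi>")
  then have "has_key \<phi> (i, j)" using RS(1) key_iff by blast
  then have "has_key \<psi> (i, j)"
    unfolding eq
    by (rule has_key_translate[OF _ R1.form_aut_int_iterate[OF R1.river_translation_aut[OF st(1)]]
          R2.form_aut_int_iterate[OF R2.river_translation_aut[OF st(2)]] RS(2)[unfolded eq]])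
  then have "key \<psi> = (i, j)" using key_iff by blast
  then show "\<phi> \<in> RS_superimpositions T\<^sub>1 T\<^sub>2 \<and> \<psi> \<in> RS_superimpositions T\<^sub>1 T\<^sub>2 \<and> key \<phi> = key \<psi>"
    using RS ij by simp
next
  assume RS: "\<phi> \<in> RS_superimpositions T\<^sub>1 T\<^sub>2 \<and> \<psi> \<in> RS_superimpositions T\<^sub>1 T\<^sub>2 \<and> key \<phi> = key \<psi>"
  obtain i j where ij: "key \<phi> = (i, j)" by (cases "key \<phi>")
  have k: "has_key \<phi> (i, j)" "has_key \<psi> (i, j)" using RS ij key_iff by auto
  obtain \<sigma> \<tau> where st: "river_translation T\<^sub>1 \<sigma>" "river_translation T\<^sub>2 \<tau>"
    using R1.river_translation_exists R2.river_translation_exists by blast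
  then show "(\<phi>, \<psi>) \<in> RS_equiv T\<^sub>1 T\<^sub>2"
    unfolding RS_equiv_def using same_key_translate[OF k st] RS by blast
qed

lemma RS_classes_bij: "bij_betw (\<lambda>k. {\<phi> \<in> RS_superimpositions T\<^sub>1 T\<^sub>2. key \<phi> = k}) keys (RS_classes T\<^sub>1 T\<^sub>2)"
  using bij_betw_quotient_by_key[OF RS_equiv_iff] unfolding key_image RS_classes_def .

lemma finite_keys: "finite keys"
  by (rule finite_subset[OF keys_subset]) simp

lemma finite_RS_classes: "finite (RS_classes T\<^sub>1 T\<^sub>2)"
  using RS_classes_bij finite_keys bij_betw_finite by blast

lemma Int_RS_eq: "Int_RS T\<^sub>1 T\<^sub>2 = card keys"
  using bij_betw_same_card[OF RS_classes_bij] by (simp add: Int_RS_def)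

lemma procedure_outputs_iff: "procedure_outputs q\<^sub>1 q\<^sub>2 N \<longleftrightarrow> N = Int_RS T\<^sub>1 T\<^sub>2"
  unfolding Int_RS_eq keys_def
  by (rule procedure_counts[OF R1.seq R2.seq R1.period_pos R2.period_pos R1.letters R2.letters])

end

text \<open>Finiteness ensures that \<open>Int_RS\<close>, a cardinality, is not the default value 0
  of an infinite set. The equivalence for every N says both that the procedure terminates and that
  it outputs no other number.\<close>

theorem mainTheorem5:
  fixes q\<^sub>1 q\<^sub>2 :: bqf and T\<^sub>1 :: "'v topograph" and T\<^sub>2 :: "'w topograph"
  assumes "PIBQF q\<^sub>1" and "PIBQF q\<^sub>2"
    and "topograph_of T\<^sub>1 q\<^sub>1" and "topograph_of T\<^sub>2 q\<^sub>2"
  shows "finite (RS_classes T\<^sub>1 T\<^sub>2) \<and>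
    (\<forall>N. procedure_outputs q\<^sub>1 q\<^sub>2 N \<longleftrightarrow> N = Int_RS T\<^sub>1 T\<^sub>2)"
proof -
  have q: "indef q\<^sub>1" "indef q\<^sub>2" using assms(1,2) PIBQF_indef by auto
  obtain r\<^sub>1 r\<^sub>2 where r: "cf_river_sequence q\<^sub>1 r\<^sub>1" "cf_river_sequence q\<^sub>2 r\<^sub>2"
    using cf_river_sequence_exists q by blast
  interpret two_rivers T\<^sub>1 q\<^sub>1 r\<^sub>1 T\<^sub>2 q\<^sub>2 r\<^sub>2
    by unfold_locales (use assms(3,4) q r in \<open>simp_all add: topograph_of_def\<close>)
  show ?thesis using finite_RS_classes procedure_outputs_iff by blast
qed

end
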